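(* For every $m\ge3$ and $a\ge0$, the following families are in bijection: (1) marked $m$-bipartite trees whose number of marked pairs is $a$ and such that the unique node-child of the root node is the rightmost child of the root node; (2) admissible marked $m$-regular bipartite maps whose number of marked edges is $a$. The bijection can be chosen such that the number of black nodes in the first family corresponds to the number of black vertices in the second family.
   Context: Maps. A map is a cellular embedding of a connected graph (multiple edges allowed) in a closed oriented surface of arbitrary genus, up to orientation-preserving homeomorphism. An $m$-regular bipartite map is a map whose vertices all have degree $m$ and are colored black or white so that adjacent vertices have different colors. It is rooted if a corner at a white vertex $v_0$ (the root vertex) is marked. A marked map is a rooted map where some edges are marked and given a fixed orientation. An orientation of all its edges is compatible if it agrees with the fixed orientation of the marked edges; a compatible orientation is root-accessible if from each vertex there is an oriented path to the root vertex avoiding the marked edges. A 1-orientation is an orientation in which each white vertex has outdegree $m-1$ and each black vertex has outdegree $1$. A marked $m$-regular bipartite map is admissible if it admits a compatible root-accessible 1-orientation in which the unique ingoing edge at $v_0$ is the one preceding the root corner in clockwise order around $v_0$. Trees. Trees are plane trees; vertices of degree 1 are leaves, the others are nodes. A rooted tree is a plane tree with a marked leaf (the root leaf); the node adjacent to it, if any, is the root node. Children of a node are ordered from left to right following the clockwise walk around the tree (outer face on the left) starting at the root leaf. A blossoming tree is a rooted tree whose leaves are of two kinds, opening and closing, with as many opening as closing leaves, the root leaf being opening. An $m$-bipartite tree is a blossoming tree that is either nodeless (a single edge joining two leaves), or has its nodes colored black or white with no edge joining two nodes of the same color, all nodes of degree $m$, the root node white, all opening (resp. closing) leaves adjacent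 to white (resp. black) nodes, and every white node having exactly one child that is a black node, its other $m-2$ children being opening leaves. The trees in family (1) have a root node, hence are not nodeless. A marked matching of a blossoming tree is a perfect matching of the opening leaves (including the root leaf) with the closing leaves, where some of the pairs are marked, such that for each unmarked pair the opening leaf appears before the closing leaf in the clockwise walk starting at the root leaf. A marked $m$-bipartite tree is an $m$-bipartite tree endowed with a marked matching. *)

theory Defs
  imports "HOL-Combinatorics.Orbits"
begin

section \<open>Maps\<close>

text \<open>
  A map is encoded by its rotation system. The darts are the half-edges; \<open>rot\<close> sends a dart to the
  next dart in clockwise order around its vertex, and \<open>opp\<close> exchanges the two darts of an edge.
  Vertices are the orbits of \<open>rot\<close> and edges the orbits of \<open>opp\<close>. The faces, hence the surface and
  its genus, are determined by these two permutations, so two maps are related by an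
  orientation-preserving homeomorphism iff their rotation systems are isomorphic. Since maps are
  finite, natural numbers are enough to label the darts.
\<close>

record comb_map =
  darts :: "nat set"
  rot :: "nat \<Rightarrow> nat"
  opp :: "nat \<Rightarrow> nat"

text \<open>
  The dart \<open>root_dart\<close> stands for the corner between itself and the next dart clockwise around the
  same vertex: it belongs to the edge that precedes the root corner in clockwise order.
  The set \<open>white\<close> contains the darts that are incident to white vertices. A marked edge with its
  fixed orientation is represented in \<open>marks\<close> by the dart at its origin.
\<close>

record marked_map = comb_map +
  white :: "nat set"
  root_dart :: nat
  marks :: "nat set"

definition vertices :: "'a comb_map_scheme \<Rightarrow> nat set set" where
  "vertices M = orbit (rot M) ` darts M"

definition adjacent_darts :: "'a comb_map_scheme \<Rightarrow> (nat \<times> nat) set" where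
  "adjacent_darts M = {(d, rot M d) | d. d \<in> darts M} \<union> {(d, opp M d) | d. d \<in> darts M}"

definition is_comb_map :: "'a comb_map_scheme \<Rightarrow> bool" where
  "is_comb_map M \<longleftrightarrow>
     finite (darts M) \<and> rot M permutes darts M \<and> opp M permutes darts M \<and>
     (\<forall>d\<in>darts M. opp M d \<noteq> d \<and> opp M (opp M d) = d) \<and>
     (\<forall>d\<in>darts M. \<forall>e\<in>darts M. (d, e) \<in> (adjacent_darts M)\<^sup>*)"

definition regular :: "nat \<Rightarrow> 'a comb_map_scheme \<Rightarrow> bool" where
  "regular m M \<longleftrightarrow> (\<forall>v\<in>vertices M. card v = m)"

definition bicolored :: "'a marked_map_scheme \<Rightarrow> bool" where
  "bicolored M \<longleftrightarrow>
     white M \<subseteq> darts M \<and>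
     (\<forall>d\<in>darts M. (rot M d \<in> white M \<longleftrightarrow> d \<in> white M) \<and> (opp M d \<in> white M \<longleftrightarrow> d \<notin> white M))"

definition white_vertices :: "'a marked_map_scheme \<Rightarrow> nat set set" where
  "white_vertices M = {v \<in> vertices M. v \<subseteq> white M}"

definition black_vertices :: "'a marked_map_scheme \<Rightarrow> nat set set" where
  "black_vertices M = {v \<in> vertices M. v \<inter> white M = {}}"

definition root_vertex :: "'a marked_map_scheme \<Rightarrow> nat set" where
  "root_vertex M = orbit (rot M) (root_dart M)"

definition marked_edges :: "'a marked_map_scheme \<Rightarrow> nat set set" where
  "marked_edges M = (\<lambda>d. {d, opp M d}) ` marks M"

definition marked_regular_bipartite_map :: "nat \<Rightarrow> 'a marked_map_scheme \<Rightarrow> bool" where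
  "marked_regular_bipartite_map m M \<longleftrightarrow>
     is_comb_map M \<and> regular m M \<and> bicolored M \<and>
     root_dart M \<in> white M \<and>
     marks M \<subseteq> darts M \<and> (\<forall>d\<in>marks M. opp M d \<notin> marks M)"

text \<open>An orientation is given by the set of its outgoing darts, one for each edge.\<close>

definition orientation :: "'a comb_map_scheme \<Rightarrow> nat set \<Rightarrow> bool" where
  "orientation M X \<longleftrightarrow> X \<subseteq> darts M \<and> (\<forall>d\<in>darts M. opp M d \<in> X \<longleftrightarrow> d \<notin> X)"

definition compatible :: "'a marked_map_scheme \<Rightarrow> nat set \<Rightarrow> bool" where
  "compatible M X \<longleftrightarrow> marks M \<subseteq> X"

definition unmarked_steps :: "'a marked_map_scheme \<Rightarrow> nat set \<Rightarrow> (nat set \<times> nat set) set" where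
  "unmarked_steps M X =
     {(orbit (rot M) d, orbit (rot M) (opp M d)) | d. d \<in> X \<and> {d, opp M d} \<notin> marked_edges M}"

definition root_accessible :: "'a marked_map_scheme \<Rightarrow> nat set \<Rightarrow> bool" where
  "root_accessible M X \<longleftrightarrow> (\<forall>v\<in>vertices M. (v, root_vertex M) \<in> (unmarked_steps M X)\<^sup>*)"

definition one_orientation :: "nat \<Rightarrow> 'a marked_map_scheme \<Rightarrow> nat set \<Rightarrow> bool" where
  "one_orientation m M X \<longleftrightarrow>
     orientation M X \<and>
     (\<forall>v\<in>white_vertices M. card (v \<inter> X) = m - 1) \<and>
     (\<forall>v\<in>black_vertices M. card (v \<inter> X) = 1)"

definition admissible :: "nat \<Rightarrow> 'a marked_map_scheme \<Rightarrow> bool" where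
  "admissible m M \<longleftrightarrow>
     (\<exists>X. one_orientation m M X \<and> compatible M X \<and> root_accessible M X \<and>
          root_vertex M - X = {root_dart M})"

definition map_isomorphism ::
    "(nat \<Rightarrow> nat) \<Rightarrow> 'a marked_map_scheme \<Rightarrow> 'b marked_map_scheme \<Rightarrow> bool" where
  "map_isomorphism \<phi> M N \<longleftrightarrow>
     bij_betw \<phi> (darts M) (darts N) \<and>
     (\<forall>d\<in>darts M. \<phi> (rot M d) = rot N (\<phi> d) \<and> \<phi> (opp M d) = opp N (\<phi> d)) \<and>
     \<phi> ` white M = white N \<and> \<phi> (root_dart M) = root_dart N \<and> \<phi> ` marks M = marks N"

definition map_iso :: "nat \<Rightarrow> (marked_map \<times> marked_map) set" where
  "map_iso m = {(M, N).
     marked_regular_bipartite_map m M \<and> marked_regular_bipartite_map m N \<and>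
     (\<exists>\<phi>. map_isomorphism \<phi> M N)}"

definition map_family :: "nat \<Rightarrow> nat \<Rightarrow> marked_map set" where
  "map_family m a = {M. marked_regular_bipartite_map m M \<and> admissible m M \<and> card (marked_edges M) = a}"

lemma map_isomorphism_inv:
  assumes M: "marked_regular_bipartite_map m M" and iso: "map_isomorphism \<phi> M N"
  shows "map_isomorphism (inv_into (darts M) \<phi>) N M"
proof -
  let ?\<psi> = "inv_into (darts M) \<phi>"
  have bij: "bij_betw \<phi> (darts M) (darts N)"
    using iso by (simp add: map_isomorphism_def)
  have inj: "inj_on \<phi> (darts M)" and img: "\<phi> ` darts M = darts N"
    using bij by (auto simp: bij_betw_def)
  have perm: "rot M permutes darts M" "opp M permutes darts M"
    using M by (auto simp: marked_regular_bipartite_map_def is_comb_map_def)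
  have sub: "white M \<subseteq> darts M" "marks M \<subseteq> darts M"
    using M by (auto simp: marked_regular_bipartite_map_def bicolored_def)
  have root: "root_dart M \<in> darts M"
    using M sub by (auto simp: marked_regular_bipartite_map_def)
  have comm: "?\<psi> (rot N e) = rot M (?\<psi> e) \<and> ?\<psi> (opp N e) = opp M (?\<psi> e)" if e: "e \<in> darts N" for e
  proof -
    obtain d where d: "d \<in> darts M" "e = \<phi> d"
      using e img by auto
    have "rot N e = \<phi> (rot M d)" "opp N e = \<phi> (opp M d)"
      using iso d by (auto simp: map_isomorphism_def)
    moreover have "rot M d \<in> darts M" "opp M d \<in> darts M"
      using perm d(1) by (auto simp: permutes_in_image)
    ultimately show ?thesis
      using d inj by (simp add: inv_into_f_f)
  qed
  have "?\<psi> ` \<phi> ` A = A" if "A \<subseteq> darts M" for A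
    using that inj by (simp add: inv_into_image_cancel)
  then have "?\<psi> ` white N = white M" "?\<psi> ` marks N = marks M"
    using iso sub unfolding map_isomorphism_def by metis+
  moreover have "?\<psi> (root_dart N) = root_dart M"
    using iso root inj by (auto simp: map_isomorphism_def intro: inv_into_f_eq)
  ultimately show ?thesis
    using comm bij_betw_inv_into[OF bij] by (auto simp: map_isomorphism_def)
qed

lemma map_isomorphism_comp:
  assumes "map_isomorphism \<phi> M N" "map_isomorphism \<psi> N K"
  shows "map_isomorphism (\<psi> \<circ> \<phi>) M K"
  using assms bij_betw_trans[of \<phi> "darts M" "darts N" \<psi> "darts K"]
  unfolding map_isomorphism_def image_comp[symmetric] by (auto simp: bij_betw_apply)

lemma equiv_map_iso: "equiv {M. marked_regular_bipartite_map m M} (map_iso m)"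
proof (rule equivI)
  show "map_iso m \<subseteq> {M. marked_regular_bipartite_map m M} \<times> {M. marked_regular_bipartite_map m M}"
    by (auto simp: map_iso_def)
  have "map_isomorphism id M M" for M :: marked_map
    by (simp add: map_isomorphism_def)
  then show "refl_on {M. marked_regular_bipartite_map m M} (map_iso m)"
    by (auto simp: refl_on_def map_iso_def)
  show "sym (map_iso m)"
    using map_isomorphism_inv by (fastforce simp: sym_def map_iso_def)
  show "trans (map_iso m)"
    using map_isomorphism_comp by (fastforce simp: trans_def map_iso_def)
qed


section \<open>Trees\<close>

datatype leaf_kind = Opening | Closing

datatype node_color = Black | White

text \<open>
  A rooted plane tree with an opening root leaf is encoded by the subtree hanging from its root
  leaf, which is itself left implicit: this subtree is a single leaf for the nodeless tree, and is
  otherwise the root node with its children from left to right. The degree of a node is thus one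
  more than the number of its children. A node without children would be a vertex of degree 1;
  \<open>rooted_plane_tree\<close> excludes it.
\<close>

datatype ptree = Leaf leaf_kind | Node node_color "ptree list"

fun subtrees :: "ptree \<Rightarrow> ptree set" where
  "subtrees (Leaf k) = {Leaf k}"
| "subtrees (Node c ts) = insert (Node c ts) (\<Union>t\<in>set ts. subtrees t)"

definition rooted_plane_tree :: "ptree \<Rightarrow> bool" where
  "rooted_plane_tree t \<longleftrightarrow> (\<forall>c ts. Node c ts \<in> subtrees t \<longrightarrow> ts \<noteq> [])"

fun leaves :: "ptree \<Rightarrow> leaf_kind list" where
  "leaves (Leaf k) = [k]"
| "leaves (Node c ts) = concat (map leaves ts)"

text \<open>The leaves in the order of the clockwise walk, starting with the root leaf.\<close>

definition walk :: "ptree \<Rightarrow> leaf_kind list" where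
  "walk t = Opening # leaves t"

definition blossoming :: "ptree \<Rightarrow> bool" where
  "blossoming t \<longleftrightarrow>
     rooted_plane_tree t \<and> count_list (walk t) Opening = count_list (walk t) Closing"

fun is_node :: "node_color \<Rightarrow> ptree \<Rightarrow> bool" where
  "is_node c (Leaf k) \<longleftrightarrow> False"
| "is_node c (Node c' ts) \<longleftrightarrow> c' = c"

fun black_nodes :: "ptree \<Rightarrow> nat" where
  "black_nodes (Leaf k) = 0"
| "black_nodes (Node c ts) = (if c = Black then 1 else 0) + sum_list (map black_nodes ts)"

definition good_node :: "nat \<Rightarrow> node_color \<Rightarrow> ptree list \<Rightarrow> bool" where
  "good_node m c ts \<longleftrightarrow>
     Suc (length ts) = m \<and>
     (\<forall>t\<in>set ts. \<not> is_node c t) \<and>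
     (\<forall>k. Leaf k \<in> set ts \<longrightarrow> k = (case c of White \<Rightarrow> Opening | Black \<Rightarrow> Closing)) \<and>
     (c = White \<longrightarrow> length (filter (is_node Black) ts) = 1 \<and>
                    length (filter (\<lambda>t. t = Leaf Opening) ts) = m - 2)"

definition m_bipartite_tree :: "nat \<Rightarrow> ptree \<Rightarrow> bool" where
  "m_bipartite_tree m t \<longleftrightarrow>
     blossoming t \<and>
     ((\<exists>k. t = Leaf k) \<or>
      is_node White t \<and> (\<forall>c ts. Node c ts \<in> subtrees t \<longrightarrow> good_node m c ts))"

text \<open>
  A leaf is identified with its position in the walk. A matching is a set of pairs (opening leaf,
  closing leaf).
\<close>

record marked_tree =
  tree :: ptree
  pairs :: "(nat \<times> nat) set"
  marked_pairs :: "(nat \<times> nat) set"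

definition positions :: "leaf_kind \<Rightarrow> ptree \<Rightarrow> nat set" where
  "positions k t = {i. i < length (walk t) \<and> walk t ! i = k}"

definition perfect_matching :: "ptree \<Rightarrow> (nat \<times> nat) set \<Rightarrow> bool" where
  "perfect_matching t P \<longleftrightarrow>
     P \<subseteq> positions Opening t \<times> positions Closing t \<and>
     (\<forall>i\<in>positions Opening t. \<exists>!j. (i, j) \<in> P) \<and>
     (\<forall>j\<in>positions Closing t. \<exists>!i. (i, j) \<in> P)"

definition marked_bipartite_tree :: "nat \<Rightarrow> marked_tree \<Rightarrow> bool" where
  "marked_bipartite_tree m T \<longleftrightarrow>
     m_bipartite_tree m (tree T) \<and>
     perfect_matching (tree T) (pairs T) \<and>
     marked_pairs T \<subseteq> pairs T \<and>
     (\<forall>(i, j) \<in> pairs T - marked_pairs T. i < j)"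

definition node_child_rightmost :: "ptree \<Rightarrow> bool" where
  "node_child_rightmost t \<longleftrightarrow> (\<exists>c ts c' us. t = Node c (ts @ [Node c' us]))"

definition tree_family :: "nat \<Rightarrow> nat \<Rightarrow> marked_tree set" where
  "tree_family m a =
     {T. marked_bipartite_tree m T \<and> card (marked_pairs T) = a \<and> node_child_rightmost (tree T)}"

end

theory Submission
  imports Defs "HOL-Library.Multiset"
begin

text \<open>
  Gluing the matched leaves of a tree gives a map with a spanning tree. Orient every tree edge towards
  the root and every other edge from its opening to its closing leaf: this is a 1-orientation. A
  1-orientation amounts to the perfect matching formed by its edges going from black to white, so
  the spanning tree and its matching have to be recovered from the marked map alone.

  Walk around the map starting at the root. At a black vertex an unmarked edge is traversed unless
  its white end has been passed before. At a white vertex an unmarked edge is cut if some admissible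
  matching avoids it and all the edges cut so far; otherwise all these matchings contain it, and it
  is traversed. If the walk came back to an open white vertex, reversing the resulting directed cycle
  would give an admissible matching that misses a traversed edge; hence the traversed edges form a
  spanning tree. Conversely, in a glued tree every matching that agrees with the tree matching before
  a tree edge going down from a white vertex must contain this edge: the alternating path that starts
  at another edge of that vertex stays forever in the part of the map that is visited later. So the
  walk is forced, and the tree is determined by the map.
\<close>

section \<open>Plane trees labelled by darts\<close>

text \<open>A map has in general several admissible matchings and its genus is arbitrary, so neither
  uniqueness of the orientation nor planarity can single out the tree. Finiteness takes their place:
  for uniqueness, an injective map of a finite set of darts into itself is onto; for existence, the
  list of visited darts cannot grow forever.

  The correspondence is kept as a relation, \<open>opened_map\<close>, between a map and a tree
  labelled by its darts. A map opens in at most one way, every admissible map opens, every tree of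
  the family is the reading of an opening, and equal readings come from isomorphic maps. The image
  of a tree can thus be the set of all maps that open to it.

  Two conditions on trees come from the walk. An unmarked edge cut at a black vertex was cut at its
  white end before, whence the order in unmarked pairs. The dart before the root corner is the last
  one met at the root, so requiring its edge to be the ingoing one makes the last child of the root
  a node.\<close>

text \<open>
  The edge above a node consists of the dart \<open>pdart\<close> at its parent and the dart \<open>odart\<close> at the
  node itself. A leaf is a single dart at its parent.
\<close>

datatype 'a dtree =
    DLeaf (pdart: 'a)
  | DNode (pdart: 'a) (odart: 'a) (subs: "'a dtree list")

text \<open>The dart of a node comes after its subtree, when the walk goes back up.\<close>

fun tour :: "'a dtree \<Rightarrow> 'a list" where
  "tour (DLeaf d) = [d]"
| "tour (DNode d e ts) = d # concat (map tour ts) @ [e]"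

fun leaf_darts :: "'a dtree \<Rightarrow> 'a list" where
  "leaf_darts (DLeaf d) = [d]"
| "leaf_darts (DNode d e ts) = concat (map leaf_darts ts)"

fun edge_darts :: "'a dtree \<Rightarrow> 'a list" where
  "edge_darts (DLeaf d) = []"
| "edge_darts (DNode d e ts) = d # e # concat (map edge_darts ts)"

fun dnodes :: "'a dtree \<Rightarrow> ('a \<times> 'a \<times> 'a dtree list) set" where
  "dnodes (DLeaf d) = {}"
| "dnodes (DNode d e ts) = insert (d, e, ts) (\<Union>t\<in>set ts. dnodes t)"

abbreviation forest_tour :: "'a dtree list \<Rightarrow> 'a list" where
  "forest_tour ts \<equiv> concat (map tour ts)"

abbreviation forest_leaf_darts :: "'a dtree list \<Rightarrow> 'a list" where
  "forest_leaf_darts ts \<equiv> concat (map leaf_darts ts)"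

abbreviation forest_edge_darts :: "'a dtree list \<Rightarrow> 'a list" where
  "forest_edge_darts ts \<equiv> concat (map edge_darts ts)"

abbreviation forest_nodes :: "'a dtree list \<Rightarrow> ('a \<times> 'a \<times> 'a dtree list) set" where
  "forest_nodes ts \<equiv> (\<Union>t\<in>set ts. dnodes t)"

lemma tour_neq_Nil [simp]: "tour t \<noteq> []"
  by (cases t) auto

lemma hd_tour [simp]: "hd (tour t) = pdart t"
  by (cases t) auto

lemma pdart_in_tour [simp]: "pdart t \<in> set (tour t)"
  by (cases t) auto

lemma mset_tour: "mset (tour t) = mset (leaf_darts t) + mset (edge_darts t)"
proof (induction t)
  case (DNode d e ts)
  then have "mset (forest_tour ts) = mset (forest_leaf_darts ts) + mset (forest_edge_darts ts)"
    by (induction ts) auto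
  then show ?case by simp
qed simp

lemma mset_forest_tour:
  "mset (forest_tour ts) = mset (forest_leaf_darts ts) + mset (forest_edge_darts ts)"
  by (induction ts) (auto simp: mset_tour)

lemma set_forest_tour:
  "set (forest_tour ts) = set (forest_leaf_darts ts) \<union> set (forest_edge_darts ts)"
  using mset_forest_tour[of ts] by (metis set_mset_mset set_mset_union)

lemma distinct_forest_tour:
  "distinct (forest_tour ts) \<longleftrightarrow> distinct (forest_leaf_darts ts @ forest_edge_darts ts)"
  by (rule mset_eq_imp_distinct_iff) (simp only: mset_forest_tour mset_append)

lemma set_edge_darts: "set (edge_darts t) = (\<Union>(d, e, us)\<in>dnodes t. {d, e})"
  by (induction t) auto

lemma leaf_darts_filter:
  assumes "set (edge_darts t) \<subseteq> E" "set (leaf_darts t) \<inter> E = {}"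
  shows "filter (\<lambda>z. z \<notin> E) (tour t) = leaf_darts t"
  using assms
proof (induction t)
  case (DNode d e ts)
  have "filter (\<lambda>z. z \<notin> E) (forest_tour us) = forest_leaf_darts us" if "set us \<subseteq> set ts" for us
    using that
  proof (induction us)
    case (Cons u us)
    have "filter (\<lambda>z. z \<notin> E) (tour u) = leaf_darts u"
      using Cons.prems DNode.prems by (intro DNode.IH) auto
    then show ?case using Cons by simp
  qed simp
  then show ?case using DNode.prems by auto
qed auto

text \<open>The tour leaves a node only after finishing its subtree, so a subtree is an interval of
  the tour. Statements about descendants become statements about positions.\<close>

lemma dnodes_split:
  assumes "(d, e, us) \<in> dnodes t"
  shows "\<exists>p q. tour t = p @ tour (DNode d e us) @ q"
  using assms
proof (induction t)
  case (DNode d' e' ts)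
  show ?case
  proof (cases "(d, e, us) = (d', e', ts)")
    case True
    then show ?thesis by (auto intro: exI[of _ "[]"])
  next
    case False
    then obtain t where t: "t \<in> set ts" "(d, e, us) \<in> dnodes t" using DNode.prems by auto
    obtain p q where pq: "tour t = p @ tour (DNode d e us) @ q" using DNode.IH[OF t] by blast
    obtain xs ys where "ts = xs @ t # ys" using t(1) by (auto dest: split_list)
    then have "tour (DNode d' e' ts) =
        (d' # forest_tour xs @ p) @ tour (DNode d e us) @ q @ forest_tour ys @ [e']"
      using pq by simp
    then show ?thesis by blast
  qed
qed simp

lemma forest_nodes_split:
  assumes "(d, e, us) \<in> forest_nodes ts"
  shows "\<exists>p q. forest_tour ts = p @ tour (DNode d e us) @ q"
proof -
  obtain t where t: "t \<in> set ts" "(d, e, us) \<in> dnodes t" using assms by auto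
  obtain p q where pq: "tour t = p @ tour (DNode d e us) @ q" using dnodes_split[OF t(2)] by blast
  obtain xs ys where "ts = xs @ t # ys" using t(1) by (auto dest: split_list)
  then have "forest_tour ts = (forest_tour xs @ p) @ tour (DNode d e us) @ q @ forest_tour ys"
    using pq by simp
  then show ?thesis by blast
qed

lemma dnodes_trans: "(d, e, us) \<in> dnodes t \<Longrightarrow> dnodes (DNode d e us) \<subseteq> dnodes t"
  by (induction t) fastforce+

text \<open>Regroups the tour by vertices instead of edges: the darts around a node are its own dart
  and the upper darts of its children, and only the top dart belongs to a vertex outside the
  tree.\<close>

lemma set_tour_nodes:
  "set (tour t) = insert (pdart t) (\<Union>(d, e, us)\<in>dnodes t. insert e (pdart ` set us))"
proof (induction t)
  case (DNode d e ts)
  have "set (forest_tour ts) = pdart ` set ts \<union> (\<Union>(d, e, us)\<in>forest_nodes ts. insert e (pdart ` set us))"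
    using DNode by (simp add: UN_simps(3)[symmetric]) blast
  then show ?case by auto
qed simp

lemma set_forest_tour_nodes:
  "set (forest_tour ts) =
     pdart ` set ts \<union> (\<Union>(d, e, us)\<in>forest_nodes ts. insert e (pdart ` set us))"
  by (auto simp: set_tour_nodes)

lemma dnode_darts:
  assumes "(d, e, us) \<in> forest_nodes ts"
  shows "d \<in> set (forest_edge_darts ts)" "e \<in> set (forest_edge_darts ts)"
    "d \<in> set (forest_tour ts)" "e \<in> set (forest_tour ts)" "pdart ` set us \<subseteq> set (forest_tour ts)"
proof -
  show 1: "d \<in> set (forest_edge_darts ts)" "e \<in> set (forest_edge_darts ts)"
    using assms by (force simp: set_edge_darts)+
  then show "d \<in> set (forest_tour ts)" "e \<in> set (forest_tour ts)"
    by (simp_all only: set_forest_tour UnI2)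
  show "pdart ` set us \<subseteq> set (forest_tour ts)"
    using assms unfolding set_forest_tour_nodes by fastforce
qed

text \<open>With distinct labels no dart is both a leaf and half of an edge, so the set of edge
  darts alone tells which children are nodes. Uniqueness of the tree is later reduced to this
  set.\<close>

lemma pdart_edge_iff:
  assumes "distinct (forest_tour ts)" "t \<in> set ts \<or> (\<exists>d e us. (d, e, us) \<in> forest_nodes ts \<and> t \<in> set us)"
  shows "pdart t \<in> set (forest_edge_darts ts) \<longleftrightarrow> (\<exists>d e us. t = DNode d e us)"
proof -
  have *: "dnodes t \<subseteq> forest_nodes ts \<and> set (leaf_darts t) \<subseteq> set (forest_leaf_darts ts)"
  proof (cases "t \<in> set ts")
    case False
    then obtain d e us t' where u: "(d, e, us) \<in> dnodes t'" "t' \<in> set ts" "t \<in> set us" using assms(2) by auto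
    have "set (forest_leaf_darts us) \<subseteq> set (leaf_darts t')"
      using u(1) by (induction t') fastforce+
    then show ?thesis using u dnodes_trans[OF u(1)] by auto
  qed auto
  show ?thesis
  proof (cases t)
    case (DLeaf d)
    then have "d \<in> set (forest_leaf_darts ts)" using * by auto
    then show ?thesis using assms(1) DLeaf unfolding distinct_forest_tour distinct_append by auto
  next
    case (DNode d e us)
    then have "(d, e, us) \<in> forest_nodes ts" using * by auto
    then show ?thesis using DNode dnode_darts(1)[of d e us ts] by auto
  qed
qed

section \<open>The order in which a list meets its entries\<close>

definition before :: "'a list \<Rightarrow> 'a \<Rightarrow> 'a \<Rightarrow> bool" where
  "before xs a b \<longleftrightarrow> (\<exists>us vs. xs = us @ vs \<and> a \<in> set us \<and> b \<in> set vs)"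

lemma before_append: "before xs a b \<Longrightarrow> before (xs @ ys) a b"
proof -
  assume "before xs a b"
  then obtain us vs where "xs = us @ vs" "a \<in> set us" "b \<in> set vs" by (auto simp: before_def)
  then have "xs @ ys = us @ (vs @ ys)" "a \<in> set us" "b \<in> set (vs @ ys)" by auto
  then show ?thesis unfolding before_def by blast
qed

lemma before_nth:
  assumes "distinct xs" "i < length xs" "j < length xs"
  shows "before xs (xs ! i) (xs ! j) \<longleftrightarrow> i < j"
proof
  assume "before xs (xs ! i) (xs ! j)"
  then obtain us vs where s: "xs = us @ vs" "xs ! i \<in> set us" "xs ! j \<in> set vs" by (auto simp: before_def)
  obtain k l where k: "k < length us" "us ! k = xs ! i" and l: "l < length vs" "vs ! l = xs ! j"
    using s by (auto simp: in_set_conv_nth)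
  have "i = k" using assms s k by (metis (no_types, lifting) length_append nth_append nth_eq_iff_index_eq trans_less_add1)
  moreover have "j = length us + l"
    using assms s l by (metis (no_types, lifting) length_append nat_add_left_cancel_less nth_append_length_plus nth_eq_iff_index_eq)
  ultimately show "i < j" using k by simp
next
  assume "i < j"
  then have "xs ! i \<in> set (take j xs)" "xs ! j \<in> set (drop j xs)"
    using assms nth_mem[of i "take j xs"] nth_mem[of 0 "drop j xs"] by auto
  then show "before xs (xs ! i) (xs ! j)"
    unfolding before_def by (metis append_take_drop_id)
qed

lemma before_cases:
  assumes "distinct xs" "a \<in> set xs" "b \<in> set xs" "a \<noteq> b"
  shows "before xs a b \<longleftrightarrow> \<not> before xs b a"
proof -
  obtain i j where "i < length xs" "j < length xs" "xs ! i = a" "xs ! j = b"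
    using assms by (auto simp: in_set_conv_nth)
  then show ?thesis using assms before_nth[of xs i j] before_nth[of xs j i] by (metis linorder_cases not_less_iff_gr_or_eq)
qed

text \<open>Leaf positions count leaves only, whereas the tour meets all darts; here the two orders
  are compared. Filtering keeps a splitting of the list, and the converse follows because exactly
  one of two distinct entries comes first.\<close>

lemma before_filter:
  assumes "distinct xs" "a \<in> set xs" "b \<in> set xs" "P a" "P b"
  shows "before (filter P xs) a b \<longleftrightarrow> before xs a b"
proof -
  have *: "before (filter P xs) x y" if "before xs x y" "P x" "P y" for x y
  proof -
    obtain us vs where "xs = us @ vs" "x \<in> set us" "y \<in> set vs" using \<open>before xs x y\<close> by (auto simp: before_def)
    then have "filter P xs = filter P us @ filter P vs" "x \<in> set (filter P us)" "y \<in> set (filter P vs)"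
      using that by auto
    then show ?thesis unfolding before_def by blast
  qed
  show ?thesis
  proof (cases "a = b")
    case True
    have "\<not> before ys b b" if "distinct ys" for ys using that by (auto simp: before_def)
    then show ?thesis using assms True by auto
  next
    case False
    then show ?thesis using *[of a b] *[of b a] assms before_cases[of xs a b] before_cases[of "filter P xs" a b]
      by auto
  qed
qed

lemma concat_map_distinct_inj:
  assumes "distinct (concat (map f xs))" "x \<in> set xs" "y \<in> set xs" "z \<in> set (f x)" "z \<in> set (f y)"
  shows "x = y"
  using assms by (induction xs) auto

text \<open>The nodes once more, as a list: it can be counted, and the edge darts become a
  concatenation of two-element lists, one for each node.\<close>

fun node_list :: "'a dtree \<Rightarrow> ('a \<times> 'a \<times> 'a dtree list) list" where
  "node_list (DLeaf d) = []"
| "node_list (DNode d e ts) = (d, e, ts) # concat (map node_list ts)"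

lemma set_node_list: "set (node_list t) = dnodes t"
  by (induction t) auto

lemma edge_darts_node_list: "edge_darts t = concat (map (\<lambda>(d, e, us). [d, e]) (node_list t))"
proof (induction t)
  case (DNode d e ts)
  then have "forest_edge_darts ts = concat (map (\<lambda>(d, e, us). [d, e]) (concat (map node_list ts)))"
    by (induction ts) auto
  then show ?case by simp
qed simp

lemma forest_edge_darts_node_list:
  "forest_edge_darts ts = concat (map (\<lambda>(d, e, us). [d, e]) (concat (map node_list ts)))"
  by (induction ts) (auto simp: edge_darts_node_list)

text \<open>All edge darts are distinct, so a dart lies in one edge only and is either its upper or
  its lower end.\<close>

lemma forest_nodes_disjoint:
  assumes "distinct (forest_tour ts)" "(d, e, us) \<in> forest_nodes ts" "(d', e', us') \<in> forest_nodes ts"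
  shows "d \<noteq> e'" "d = d' \<or> e = e' \<Longrightarrow> (d, e, us) = (d', e', us')"
proof -
  have dist: "distinct (concat (map (\<lambda>(d, e, us). [d, e]) (concat (map node_list ts))))"
    using assms(1) unfolding distinct_forest_tour forest_edge_darts_node_list by simp
  have mem: "(d, e, us) \<in> set (concat (map node_list ts))" "(d', e', us') \<in> set (concat (map node_list ts))"
    using assms by (auto simp: set_node_list)
  have "[x, y] \<in> set (map (\<lambda>(d, e, us). [d, e]) (concat (map node_list ts))) \<Longrightarrow> x \<noteq> y" for x y
    using dist unfolding distinct_concat_iff by fastforce
  from this[of d e] have ne: "d \<noteq> e" using mem(1) by force
  have eq: "(d, e, us) = (d', e', us')" if "z \<in> {d, e}" "z \<in> {d', e'}" for z
    by (rule concat_map_distinct_inj[OF dist mem, of z]) (use that in simp_all)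
  show "d = d' \<or> e = e' \<Longrightarrow> (d, e, us) = (d', e', us')"
    using eq[of d] eq[of e] by blast
  show "d \<noteq> e'"
    using eq[of d] ne by blast
qed

lemma distinct_map_pdart: "distinct (forest_tour ts) \<Longrightarrow> distinct (map pdart ts)"
proof (induction ts)
  case (Cons t ts)
  have "pdart t \<notin> set (map pdart ts)"
  proof -
    have "set (map pdart ts) \<subseteq> set (forest_tour ts)" by auto
    moreover have "pdart t \<notin> set (forest_tour ts)"
      using Cons.prems pdart_in_tour[of t] by (auto simp del: pdart_in_tour)
    ultimately show ?thesis by blast
  qed
  then show ?case using Cons by simp
qed simp

lemma node_distinct_darts:
  assumes "distinct (forest_tour ts)" "(d, e, us) \<in> forest_nodes ts"
  shows "distinct (e # map pdart us)"
proof -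
  obtain p q where "forest_tour ts = p @ tour (DNode d e us) @ q"
    using forest_nodes_split[OF assms(2)] by blast
  then have "distinct (forest_tour us @ [e])" using assms(1) by simp
  moreover have "pdart ` set us \<subseteq> set (forest_tour us)" by auto
  ultimately show ?thesis using distinct_map_pdart[of us] by auto
qed

lemma forest_edge_dartE:
  assumes "z \<in> set (forest_edge_darts ts)"
  obtains d e us where "(d, e, us) \<in> forest_nodes ts" "z = d \<or> z = e"
  using assms by (auto simp: set_edge_darts)

lemma forest_leaf_darts_filter:
  assumes "distinct (forest_tour ts)"
  shows "filter (\<lambda>z. z \<notin> set (forest_edge_darts ts)) (forest_tour ts) = forest_leaf_darts ts"
proof -
  let ?E = "set (forest_edge_darts ts)"
  have disj: "set (forest_leaf_darts ts) \<inter> ?E = {}"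
    using assms unfolding distinct_forest_tour distinct_append by blast
  have "filter (\<lambda>z. z \<notin> ?E) (forest_tour us) = forest_leaf_darts us" if "set us \<subseteq> set ts" for us
    using that
  proof (induction us)
    case (Cons u us)
    have "filter (\<lambda>z. z \<notin> ?E) (tour u) = leaf_darts u"
    proof (rule leaf_darts_filter)
      show "set (edge_darts u) \<subseteq> ?E" "set (leaf_darts u) \<inter> ?E = {}"
        using Cons.prems disj by auto
    qed
    then show ?case using Cons by simp
  qed simp
  then show ?thesis by blast
qed

lemma forest_nodes_child:
  assumes "(d, e, us) = (r, r, ts) \<or> (d, e, us) \<in> forest_nodes ts" "DNode d' e' us' \<in> set us"
  shows "(d', e', us') \<in> forest_nodes ts"
proof (cases "(d, e, us) = (r, r, ts)")
  case True
  then show ?thesis using assms(2) by (auto intro!: bexI[of _ "DNode d' e' us'"])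
next
  case False
  then obtain t where t: "t \<in> set ts" "(d, e, us) \<in> dnodes t" using assms(1) by auto
  have "(d', e', us') \<in> dnodes (DNode d e us)" using assms(2) by (auto intro!: bexI[of _ "DNode d' e' us'"])
  then show ?thesis using t dnodes_trans[OF t(2)] by blast
qed

fun is_dnode :: "'a dtree \<Rightarrow> bool" where
  "is_dnode (DLeaf d) \<longleftrightarrow> False"
| "is_dnode (DNode d e ts) \<longleftrightarrow> True"

lemma is_dnode_iff: "is_dnode t \<longleftrightarrow> (\<exists>d e us. t = DNode d e us)"
  by (cases t) auto

section \<open>Tours and matchings of a rooted map\<close>

definition root_leaf :: "marked_map \<Rightarrow> nat" where
  "root_leaf M = rot M (root_dart M)"

text \<open>The walk starts in the root corner, just after \<open>root_dart\<close>, so the first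
  dart it meets is \<open>root_leaf\<close>. The edge of that dart is cut, which makes it a
  leaf.\<close>

definition full_tour :: "marked_map \<Rightarrow> nat dtree list \<Rightarrow> nat list" where
  "full_tour M ts = root_leaf M # forest_tour ts"

definition full_leaves :: "marked_map \<Rightarrow> nat dtree list \<Rightarrow> nat list" where
  "full_leaves M ts = root_leaf M # forest_leaf_darts ts"

text \<open>The root has no edge above it; the root leaf stands for both of its darts.\<close>

definition all_nodes :: "marked_map \<Rightarrow> nat dtree list \<Rightarrow> (nat \<times> nat \<times> nat dtree list) set" where
  "all_nodes M ts = insert (root_leaf M, root_leaf M, ts) (forest_nodes ts)"

definition tree_darts :: "nat dtree list \<Rightarrow> nat set" where
  "tree_darts ts = set (forest_edge_darts ts)"

text \<open>An edge of the matching is recorded by its white dart, so a black vertex meets it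
  through \<open>opp\<close>. The conditions range over darts instead of vertices, which avoids sets
  of sets.\<close>

definition matching :: "marked_map \<Rightarrow> nat set \<Rightarrow> bool" where
  "matching M Y \<longleftrightarrow> Y \<subseteq> white M \<and>
     (\<forall>z\<in>white M. \<exists>!y. y \<in> Y \<and> y \<in> orbit (rot M) z) \<and>
     (\<forall>z\<in>darts M - white M. \<exists>!y. y \<in> Y \<and> opp M y \<in> orbit (rot M) z)"

text \<open>Degrees and connectivity come later: for a glued map they are consequences of its
  spanning tree, see \<open>regular\<close> and \<open>is_comb_map\<close>.\<close>

locale bipartite_map =
  fixes M :: marked_map
  assumes finite_darts: "finite (darts M)"
    and rot_permutes: "rot M permutes darts M"
    and opp_permutes: "opp M permutes darts M"
    and opp_neq: "d \<in> darts M \<Longrightarrow> opp M d \<noteq> d"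
    and opp_opp: "d \<in> darts M \<Longrightarrow> opp M (opp M d) = d"
    and white_darts: "white M \<subseteq> darts M"
    and rot_white: "d \<in> darts M \<Longrightarrow> rot M d \<in> white M \<longleftrightarrow> d \<in> white M"
    and opp_white: "d \<in> darts M \<Longrightarrow> opp M d \<in> white M \<longleftrightarrow> d \<notin> white M"
    and root_white: "root_dart M \<in> white M"
    and marks_darts: "marks M \<subseteq> darts M"
    and marks_opp: "d \<in> marks M \<Longrightarrow> opp M d \<notin> marks M"
begin

lemma rot_in_darts [simp]: "rot M d \<in> darts M \<longleftrightarrow> d \<in> darts M"
  using rot_permutes by (rule permutes_in_image)

lemma opp_in_darts [simp]: "opp M d \<in> darts M \<longleftrightarrow> d \<in> darts M"
  using opp_permutes by (rule permutes_in_image)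

lemma rot_eq_iff [simp]: "rot M x = rot M y \<longleftrightarrow> x = y"
  using permutes_inj[OF rot_permutes] by (rule inj_eq)

lemma opp_eq_iff [simp]: "opp M x = opp M y \<longleftrightarrow> x = y"
  using permutes_inj[OF opp_permutes] by (rule inj_eq)

lemma permutation_rot: "permutation (rot M)"
  using finite_darts rot_permutes permutation_permutes by blast

lemma orbit_self [simp]: "d \<in> orbit (rot M) d"
  using permutation_rot by (rule permutation_self_in_orbit)

lemma orbit_rot [simp]: "orbit (rot M) (rot M d) = orbit (rot M) d"
  using permutation_rot by (rule permutation_orbit_step)

lemma orbit_eq: "z \<in> orbit (rot M) d \<Longrightarrow> orbit (rot M) z = orbit (rot M) d"
  by (induction rule: orbit.induct) simp_all

lemma orbit_darts: "d \<in> darts M \<Longrightarrow> orbit (rot M) d \<subseteq> darts M"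
  by (rule permutes_orbit_subset[OF rot_permutes])

lemma orbit_white: "d \<in> darts M \<Longrightarrow> z \<in> orbit (rot M) d \<Longrightarrow> z \<in> white M \<longleftrightarrow> d \<in> white M"
proof (rotate_tac, induction rule: orbit.induct)
  case (step y)
  then show ?case using rot_white orbit_darts by blast
qed (simp add: rot_white)

lemma orbit_subset_closed:
  assumes "d \<in> S" "\<And>z. z \<in> S \<Longrightarrow> rot M z \<in> S"
  shows "orbit (rot M) d \<subseteq> S"
proof
  fix z assume "z \<in> orbit (rot M) d"
  then show "z \<in> S" by (induction rule: orbit.induct) (auto simp: assms)
qed

lemma root_dart_darts [simp]: "root_dart M \<in> darts M"
  using root_white white_darts by blast

lemma root_leaf_darts [simp]: "root_leaf M \<in> darts M"
  by (simp add: root_leaf_def)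

lemma root_leaf_white [simp]: "root_leaf M \<in> white M"
  by (simp add: root_leaf_def rot_white root_white)

text \<open>Rotating the list gives its cyclic shift, an equation that encodes the whole cyclic
  order around a vertex at once. The list starts at the own dart, since the walk enters a node by
  its upper edge and meets the children after it.\<close>

lemma orbit_chain:
  assumes "map (rot M) (e # xs) = xs @ [e]"
  shows "orbit (rot M) e = insert e (set xs)"
proof
  have *: "z \<in> insert e (set xs) \<Longrightarrow> rot M z \<in> insert e (set xs)" for z
    using arg_cong[OF assms, of set] by auto
  show "orbit (rot M) e \<subseteq> insert e (set xs)"
    by (rule orbit_subset_closed) (use * in auto)
  have "i < length (e # xs) \<Longrightarrow> (e # xs) ! i \<in> orbit (rot M) e" for i
  proof (induction i)
    case (Suc i)
    have "rot M ((e # xs) ! i) = (xs @ [e]) ! i"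
      using Suc.prems assms by (metis Suc_lessD nth_map)
    also have "\<dots> = (e # xs) ! Suc i" using Suc.prems by (simp add: nth_append)
    finally show ?case using Suc by (metis Suc_lessD orbit.step)
  qed simp
  then show "insert e (set xs) \<subseteq> orbit (rot M) e"
    by (metis in_set_conv_nth list.simps(15) subsetI)
qed

end

section \<open>Maps opened along a spanning tree\<close>

definition next_dart :: "marked_map \<Rightarrow> nat set \<Rightarrow> nat \<Rightarrow> nat" where
  "next_dart M E z = (if z \<in> E then rot M (opp M z) else rot M z)"

text \<open>Cutting every edge of \<open>M\<close> outside the tree leaves \<open>ts\<close>, hung
  from the root leaf. \<open>node_child\<close>, \<open>forward\<close> and \<open>last_node\<close>
  are conditions of the tree family, stated on darts. The root enters \<open>all_nodes\<close> with
  the root leaf as own dart and so obeys the same rotation rule as the other nodes.\<close>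

locale opened_map = bipartite_map M for M +
  fixes m :: nat and ts :: "nat dtree list"
  assumes m_ge: "m \<ge> 3"
    and distinct_tour: "distinct (full_tour M ts)"
    and set_tour: "set (full_tour M ts) = darts M"
    and node_opp: "(d, e, us) \<in> forest_nodes ts \<Longrightarrow> e = opp M d"
    and node_rot: "(d, e, us) \<in> all_nodes M ts \<Longrightarrow>
           map (rot M) (e # map pdart us) = map pdart us @ [e]"
    and node_deg: "(d, e, us) \<in> all_nodes M ts \<Longrightarrow> Suc (length us) = m"
    and node_child: "(d, e, us) \<in> all_nodes M ts \<Longrightarrow> e \<in> white M \<Longrightarrow> length (filter is_dnode us) = 1"
    and marks_white: "marks M \<subseteq> white M"
    and marks_tree: "marks M \<inter> tree_darts ts = {}"
    and forward: "z \<in> white M \<Longrightarrow> z \<in> set (full_leaves M ts) \<Longrightarrow> z \<notin> marks M \<Longrightarrow>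
           before (full_tour M ts) z (opp M z)"
    and last_node: "is_dnode (last ts)"
begin

abbreviation "E \<equiv> tree_darts ts"

lemma ts_neq [simp]: "ts \<noteq> []"
  using node_deg[of "root_leaf M" "root_leaf M" ts] m_ge by (auto simp: all_nodes_def)

lemma distinct_forest: "distinct (forest_tour ts)"
  using distinct_tour by (simp add: full_tour_def)

lemma root_leaf_notin: "root_leaf M \<notin> set (forest_tour ts)"
  using distinct_tour by (simp add: full_tour_def)

lemma tree_darts_subset: "E \<subseteq> set (forest_tour ts)"
  unfolding tree_darts_def set_forest_tour by blast

lemma tree_darts_darts: "E \<subseteq> darts M"
  using tree_darts_subset set_tour unfolding full_tour_def by auto

lemma root_leaf_not_tree: "root_leaf M \<notin> E"
  using root_leaf_notin tree_darts_subset by blast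

lemma full_leaves_filter: "full_leaves M ts = filter (\<lambda>z. z \<notin> E) (full_tour M ts)"
  using forest_leaf_darts_filter[OF distinct_forest] root_leaf_not_tree
  by (simp add: full_leaves_def full_tour_def tree_darts_def)

lemma distinct_leaves: "distinct (full_leaves M ts)"
  using distinct_tour by (simp add: full_leaves_filter)

lemma set_leaves: "set (full_leaves M ts) = darts M - E"
  by (auto simp: full_leaves_filter set_tour)

lemma nodes_darts:
  assumes "(d, e, us) \<in> all_nodes M ts"
  shows "d \<in> darts M" "e \<in> darts M" "pdart ` set us \<subseteq> darts M"
proof -
  have sub: "set (forest_tour ts) \<subseteq> darts M" using set_tour by (auto simp: full_tour_def)
  have "d \<in> darts M \<and> e \<in> darts M \<and> pdart ` set us \<subseteq> darts M"
  proof (cases "(d, e, us) = (root_leaf M, root_leaf M, ts)")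
    case True
    then show ?thesis using sub unfolding set_forest_tour_nodes by auto
  next
    case False
    then have "(d, e, us) \<in> forest_nodes ts" using assms unfolding all_nodes_def by blast
    from dnode_darts[OF this] show ?thesis using sub by blast
  qed
  then show "d \<in> darts M" "e \<in> darts M" "pdart ` set us \<subseteq> darts M" by auto
qed

lemma tree_dart_cases:
  assumes "z \<in> E"
  obtains d e us where "(d, e, us) \<in> forest_nodes ts" "z = d \<or> z = e"
  using assms unfolding tree_darts_def by (auto simp: set_edge_darts)

lemma node_tree_darts: "(d, e, us) \<in> forest_nodes ts \<Longrightarrow> d \<in> E \<and> e \<in> E"
  using dnode_darts[of d e us ts] by (simp add: tree_darts_def)

lemma tree_darts_opp: "z \<in> darts M \<Longrightarrow> opp M z \<in> E \<longleftrightarrow> z \<in> E"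
proof -
  have *: "opp M z \<in> E" if "z \<in> E" for z
    using that
  proof (cases rule: tree_dart_cases)
    case (1 d e us)
    then have "d \<in> darts M" "d \<in> E" "e \<in> E" "e = opp M d"
      using nodes_darts[of d e us] node_tree_darts node_opp by (auto simp: all_nodes_def)
    then show ?thesis using 1 opp_opp by auto
  qed
  assume "z \<in> darts M"
  then show ?thesis using *[of z] *[of "opp M z"] opp_opp by auto
qed

lemma node_orbit:
  assumes "(d, e, us) \<in> all_nodes M ts"
  shows "orbit (rot M) e = insert e (pdart ` set us)"
  using orbit_chain[OF node_rot[OF assms]] by simp

lemma node_distinct:
  assumes "(d, e, us) \<in> all_nodes M ts"
  shows "distinct (e # map pdart us)"
proof (cases "(d, e, us) = (root_leaf M, root_leaf M, ts)")
  case True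
  then show ?thesis using distinct_map_pdart[OF distinct_forest] root_leaf_notin
    unfolding set_forest_tour_nodes by auto
next
  case False
  then have "(d, e, us) \<in> forest_nodes ts" using assms unfolding all_nodes_def by blast
  then show ?thesis by (rule node_distinct_darts[OF distinct_forest])
qed

lemma node_card: "(d, e, us) \<in> all_nodes M ts \<Longrightarrow> card (orbit (rot M) e) = m"
  using node_distinct[of d e us] node_deg[of d e us]
  by (simp add: node_orbit distinct_card card_image distinct_map)

lemma dart_node:
  assumes "z \<in> darts M"
  obtains d e us where "(d, e, us) \<in> all_nodes M ts" "z \<in> orbit (rot M) e"
proof -
  have "z = root_leaf M \<or> z \<in> pdart ` set ts \<or>
      (\<exists>(d, e, us)\<in>forest_nodes ts. z \<in> insert e (pdart ` set us))"
  proof -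
    have "z = root_leaf M \<or> z \<in> set (forest_tour ts)"
      using assms set_tour by (auto simp: full_tour_def)
    then show ?thesis unfolding set_forest_tour_nodes by blast
  qed
  then consider "z \<in> insert (root_leaf M) (pdart ` set ts)"
    | d e us where "(d, e, us) \<in> forest_nodes ts" "z \<in> insert e (pdart ` set us)" by blast
  then show ?thesis
  proof cases
    case 1
    moreover have n: "(root_leaf M, root_leaf M, ts) \<in> all_nodes M ts" by (simp add: all_nodes_def)
    ultimately show ?thesis using that[OF n] node_orbit[OF n] by simp
  next
    case (2 d e us)
    moreover have n: "(d, e, us) \<in> all_nodes M ts" using 2 by (simp add: all_nodes_def)
    ultimately show ?thesis using that[OF n] node_orbit[OF n] by simp
  qed
qed

lemma child_node:
  assumes "(d, e, us) \<in> all_nodes M ts" "DNode d' e' us' \<in> set us"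
  shows "(d', e', us') \<in> forest_nodes ts"
  by (rule forest_nodes_child[OF _ assms(2)]) (use assms(1) in \<open>simp add: all_nodes_def\<close>)

lemma child_tree_dart:
  assumes "(d, e, us) \<in> all_nodes M ts" "u \<in> set us"
  shows "pdart u \<in> E \<longleftrightarrow> is_dnode u"
proof -
  have "u \<in> set ts \<or> (\<exists>d e us. (d, e, us) \<in> forest_nodes ts \<and> u \<in> set us)"
    using assms by (auto simp: all_nodes_def)
  from pdart_edge_iff[OF distinct_forest this] show ?thesis
    by (simp add: tree_darts_def is_dnode_iff)
qed

text \<open>With tree edges directed to the root and cut edges directed from white to black, the
  edges from black to white are the tree edges whose upper end is white.\<close>

definition Y where "Y = {d \<in> white M. \<exists>e us. (d, e, us) \<in> forest_nodes ts}"

lemma Y_own: "(d, e, us) \<in> all_nodes M ts \<Longrightarrow> e \<notin> Y"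
proof
  assume a: "(d, e, us) \<in> all_nodes M ts" "e \<in> Y"
  then obtain e' us' where n: "(e, e', us') \<in> forest_nodes ts" by (auto simp: Y_def)
  then have "e \<in> E" using node_tree_darts by blast
  then have "(d, e, us) \<in> forest_nodes ts" using a(1) root_leaf_not_tree by (auto simp: all_nodes_def)
  then show False using forest_nodes_disjoint(1)[OF distinct_forest n] by blast
qed

lemma Y_tree: "Y \<subseteq> E"
  using node_tree_darts by (auto simp: Y_def)

text \<open>A white vertex is matched to its only node child, a black one to its parent; the root is
  white, so every black vertex has a parent.\<close>

lemma matching_Y: "matching M Y"
  unfolding matching_def
proof (intro conjI ballI)
  show "Y \<subseteq> white M" by (auto simp: Y_def)
next
  fix z assume z: "z \<in> white M"
  then obtain d e us where n: "(d, e, us) \<in> all_nodes M ts" "z \<in> orbit (rot M) e"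
    using dart_node white_darts by blast
  have e: "e \<in> darts M" "e \<in> white M"
    using nodes_darts[OF n(1)] orbit_white[OF _ n(2)] z by auto
  obtain u where u: "filter is_dnode us = [u]"
    using node_child[OF n(1) e(2)] by (auto simp: length_Suc_conv)
  then have filt: "v \<in> set us \<and> is_dnode v \<longleftrightarrow> v = u" for v
    using arg_cong[OF u, of set] by (metis (mono_tags, lifting) empty_set insert_iff list.simps(15) mem_Collect_eq set_filter singletonD)
  have orb: "orbit (rot M) z = insert e (pdart ` set us)" using orbit_eq[OF n(2)] node_orbit[OF n(1)] by simp
  have iff: "y \<in> Y \<longleftrightarrow> y = pdart u" if yz: "y \<in> orbit (rot M) z" for y
  proof (cases "y = e")
    case True
    moreover have "u \<in> set us" using filt by blast
    moreover have "e \<notin> pdart ` set us" using node_distinct[OF n(1)] by simp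
    ultimately show ?thesis using Y_own[OF n(1)] by auto
  next
    case False
    then obtain v where v: "v \<in> set us" "y = pdart v" using yz unfolding orb by auto
    have yw: "y \<in> white M" using orbit_white[of z y] z yz white_darts by blast
    have "y \<in> Y \<longleftrightarrow> is_dnode v"
    proof
      assume "is_dnode v"
      then obtain d' e' us' where "v = DNode d' e' us'" by (auto simp: is_dnode_iff)
      then have "(y, e', us') \<in> forest_nodes ts" using child_node[OF n(1), of d' e' us'] v by simp
      then show "y \<in> Y" using yw unfolding Y_def by blast
    next
      assume "y \<in> Y"
      then show "is_dnode v" using Y_tree child_tree_dart[OF n(1) v(1)] v(2) by auto
    qed
    also have "\<dots> \<longleftrightarrow> v = u" using filt v(1) by blast
    also have "\<dots> \<longleftrightarrow> y = pdart u"
    proof -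
      have "inj_on pdart (set us)" using node_distinct[OF n(1)] by (simp add: distinct_map)
      moreover have "u \<in> set us" using filt by blast
      ultimately show ?thesis using v by (auto dest: inj_onD)
    qed
    finally show ?thesis .
  qed
  have "u \<in> set us" using filt by blast
  then have "pdart u \<in> orbit (rot M) z" using orb by auto
  then show "\<exists>!y. y \<in> Y \<and> y \<in> orbit (rot M) z" using iff by metis
next
  fix z assume z: "z \<in> darts M - white M"
  then obtain d e us where n: "(d, e, us) \<in> all_nodes M ts" "z \<in> orbit (rot M) e"
    using dart_node by blast
  have e: "e \<in> darts M" "e \<notin> white M"
    using nodes_darts[OF n(1)] orbit_white[OF _ n(2)] z by auto
  have nf: "(d, e, us) \<in> forest_nodes ts" using n(1) e by (auto simp: all_nodes_def)
  have d: "d \<in> darts M" "e = opp M d" using nodes_darts[OF n(1)] node_opp[OF nf] by auto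
  have dY: "d \<in> Y" using d e nf opp_white by (auto simp: Y_def)
  have orb: "orbit (rot M) z = insert e (pdart ` set us)" using orbit_eq[OF n(2)] node_orbit[OF n(1)] by simp
  have "y = d" if y: "y \<in> Y" "opp M y \<in> orbit (rot M) z" for y
  proof (rule ccontr)
    assume "y \<noteq> d"
    then have "opp M y \<noteq> e" using d by simp
    then obtain v where v: "v \<in> set us" "opp M y = pdart v" using y orb by auto
    have "opp M y \<in> E" using y(1) Y_tree tree_darts_opp tree_darts_darts by blast
    then have "is_dnode v" using child_tree_dart[OF n(1) v(1)] v(2) by simp
    then obtain d' e' us' where "v = DNode d' e' us'" by (auto simp: is_dnode_iff)
    then have 1: "(opp M y, e', us') \<in> forest_nodes ts" using child_node[OF n(1)] v by simp
    obtain e'' us'' where 2: "(y, e'', us'') \<in> forest_nodes ts" using y(1) by (auto simp: Y_def)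
    then have "e'' = opp M y" by (rule node_opp)
    then show False using forest_nodes_disjoint(1)[OF distinct_forest 1 2] by simp
  qed
  then show "\<exists>!y. y \<in> Y \<and> opp M y \<in> orbit (rot M) z" using dY d orb by blast
qed

lemma tour_next_aux:
  assumes "dnodes t \<subseteq> forest_nodes ts"
    "set (leaf_darts t) \<inter> E = {}"
  shows "successively (\<lambda>x y. y = next_dart M E x) (tour t) \<and> next_dart M E (last (tour t)) = rot M (pdart t)"
  using assms
proof (induction t)
  case (DLeaf d)
  then show ?case by (simp add: next_dart_def)
next
  case (DNode d e us)
  let ?P = "\<lambda>x y. y = next_dart M E x"
  have n: "(d, e, us) \<in> forest_nodes ts" using DNode.prems(1) by simp
  then have na: "(d, e, us) \<in> all_nodes M ts" by (simp add: all_nodes_def)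
  have de: "d \<in> E" "e \<in> E" "e = opp M d" "d = opp M e"
    using node_tree_darts[OF n] node_opp[OF n] opp_opp nodes_darts(1)[OF na] by auto
  have IH: "successively ?P (tour u) \<and> next_dart M E (last (tour u)) = rot M (pdart u)" if "u \<in> set us" for u
  proof (rule DNode.IH[OF that])
    show "dnodes u \<subseteq> forest_nodes ts" using DNode.prems(1) that by (simp only: dnodes.simps) blast
    show "set (leaf_darts u) \<inter> E = {}" using DNode.prems(2) that by auto
  qed
  \<comment> \<open>Before the children \<open>vs\<close>, \<open>x\<close> is the last dart on the
    tour and \<open>y\<close> the last dart around this node. They differ when an edge has just been
    followed down or up, but both lead to the same next dart.\<close>
  have chain: "set vs \<subseteq> set us \<Longrightarrow> next_dart M E x = rot M y \<Longrightarrow> map (rot M) (y # map pdart vs) = map pdart vs @ [e] \<Longrightarrow>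
      successively ?P (x # forest_tour vs @ [e])" for x y vs
  proof (induction vs arbitrary: x y)
    case Nil
    then show ?case by simp
  next
    case (Cons v vs)
    have v: "successively ?P (tour v)" "next_dart M E (last (tour v)) = rot M (pdart v)"
      using IH Cons.prems(1) by auto
    have "successively ?P (last (tour v) # forest_tour vs @ [e])"
      using Cons v by (intro Cons.IH[of _ "pdart v"]) auto
    then have "successively ?P (tour v @ forest_tour vs @ [e])"
      using v by (auto simp: successively_append_iff successively_Cons)
    moreover have "next_dart M E x = hd (tour v)" using Cons.prems by simp
    ultimately show ?case by (simp add: successively_Cons)
  qed
  have "successively ?P (d # forest_tour us @ [e])"
  proof (rule chain[of us d e])
    show "next_dart M E d = rot M e" unfolding next_dart_def de(3)[symmetric] using de(1) by simp
  qed (use node_rot[OF na] in auto)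
  moreover have "next_dart M E e = rot M d" unfolding next_dart_def de(4)[symmetric] using de(2) by simp
  ultimately show ?case by simp
qed

text \<open>\<open>next_dart\<close> traces the boundary of the spanning tree: a tree edge is
  crossed before turning, a cut edge is not. The tour is thus determined by its start and the set of
  tree darts, which is how two openings are compared.\<close>

lemma tour_next: "successively (\<lambda>x y. y = next_dart M E x) (full_tour M ts)"
proof -
  let ?P = "\<lambda>x y. y = next_dart M E x"
  have chain: "set vs \<subseteq> set ts \<Longrightarrow> next_dart M E x = rot M y \<Longrightarrow> map (rot M) (y # map pdart vs) = map pdart vs @ [e] \<Longrightarrow>
      successively ?P (x # forest_tour vs)" for x y vs e
  proof (induction vs arbitrary: x y)
    case (Cons v vs)
    have "set (leaf_darts v) \<inter> E = {}"
      using Cons.prems(1) set_leaves by (auto simp: full_leaves_def)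
    then have v: "successively ?P (tour v)" "next_dart M E (last (tour v)) = rot M (pdart v)"
      using tour_next_aux[of v] Cons.prems(1) by auto
    have "successively ?P (last (tour v) # forest_tour vs)"
      using Cons v by (intro Cons.IH[of _ "pdart v"]) auto
    then have "successively ?P (tour v @ forest_tour vs)"
      using v by (auto simp: successively_append_iff successively_Cons)
    moreover have "next_dart M E x = hd (tour v)" using Cons.prems by simp
    ultimately show ?case by (simp add: successively_Cons)
  qed simp
  show ?thesis unfolding full_tour_def
    by (rule chain[of ts _ "root_leaf M"])
      (use root_leaf_not_tree node_rot[of "root_leaf M" "root_leaf M" ts] in \<open>auto simp: all_nodes_def next_dart_def\<close>)
qed

end

section \<open>One-orientations as perfect matchings\<close>

definition out_darts :: "marked_map \<Rightarrow> nat set \<Rightarrow> nat set" where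
  "out_darts M Y = (white M - Y) \<union> opp M ` Y"

text \<open>Paths of \<open>unmarked_steps\<close> followed on darts: rotation moves within a
  vertex, the other two parts are the outgoing edges of white and of black vertices. The set
  \<open>K\<close> of forbidden edges starts as the marks and grows with the cuts. Edges of
  \<open>Y\<close> are not tested against it because \<open>root_matching\<close> keeps
  \<open>Y\<close> and \<open>K\<close> disjoint.\<close>

definition reach :: "marked_map \<Rightarrow> nat set \<Rightarrow> nat set \<Rightarrow> (nat \<times> nat) set" where
  "reach M Y K = {(z, rot M z) | z. z \<in> darts M} \<union> {(z, opp M z) | z. z \<in> white M - Y - K}
     \<union> {(opp M y, y) | y. y \<in> Y}"

text \<open>Admissibility with forbidden edges \<open>K\<close> in place of the marks. The paths to
  the root have to avoid \<open>K\<close> as well: at the end of the exploration this shows that no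
  dart was missed.\<close>

definition root_matching :: "marked_map \<Rightarrow> nat set \<Rightarrow> nat set \<Rightarrow> bool" where
  "root_matching M K Y \<longleftrightarrow> matching M Y \<and> Y \<inter> K = {} \<and> root_dart M \<in> Y \<and>
     (\<forall>z\<in>darts M. (z, root_dart M) \<in> (reach M Y K)\<^sup>*)"

context bipartite_map
begin

lemma orbit_rtrancl:
  assumes "\<And>x. x \<in> darts M \<Longrightarrow> (x, rot M x) \<in> Q" "z \<in> orbit (rot M) d" "d \<in> darts M"
  shows "(d, z) \<in> Q\<^sup>*"
  using assms(2)
proof (induction rule: orbit.induct)
  case (step y)
  then show ?case using assms(1)[of y] orbit_darts[OF assms(3)] by (meson rtrancl.rtrancl_into_rtrancl subsetD)
qed (use assms in auto)

lemma matchingD: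
  assumes "matching M Y"
  shows "Y \<subseteq> white M" "z \<in> white M \<Longrightarrow> \<exists>!y. y \<in> Y \<and> y \<in> orbit (rot M) z"
    "z \<in> darts M \<Longrightarrow> z \<notin> white M \<Longrightarrow> \<exists>!y. y \<in> Y \<and> opp M y \<in> orbit (rot M) z"
  using assms unfolding matching_def by auto

lemma matching_white_unique:
  assumes "matching M Y" "y \<in> Y" "y' \<in> Y" "y' \<in> orbit (rot M) y"
  shows "y' = y"
proof -
  have "\<exists>!x. x \<in> Y \<and> x \<in> orbit (rot M) y" using matchingD(1,2)[OF assms(1)] assms(2) by blast
  then obtain w where "\<And>x. x \<in> Y \<Longrightarrow> x \<in> orbit (rot M) y \<Longrightarrow> x = w" by (elim ex1E) blast
  from this[of y] this[of y'] show ?thesis using assms orbit_self by simp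
qed

lemma matching_black_unique:
  assumes "matching M Y" "y \<in> Y" "y' \<in> Y" "opp M y' \<in> orbit (rot M) (opp M y)"
  shows "y' = y"
proof -
  have "y \<in> white M" using assms matchingD(1) by blast
  then have "opp M y \<in> darts M" "opp M y \<notin> white M" using white_darts opp_white by auto
  then have "\<exists>!x. x \<in> Y \<and> opp M x \<in> orbit (rot M) (opp M y)" by (rule matchingD(3)[OF assms(1)])
  then obtain w where "\<And>x. x \<in> Y \<Longrightarrow> opp M x \<in> orbit (rot M) (opp M y) \<Longrightarrow> x = w" by (elim ex1E) blast
  from this[of y] this[of y'] show ?thesis using assms orbit_self by simp
qed

lemma white_vertex:
  assumes "v \<in> white_vertices M"
  obtains z where "z \<in> white M" "v = orbit (rot M) z" "v \<subseteq> white M"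
  using assms orbit_self unfolding white_vertices_def vertices_def by blast

lemma black_vertex:
  assumes "v \<in> black_vertices M"
  obtains z where "z \<in> darts M" "z \<notin> white M" "v = orbit (rot M) z" "v \<inter> white M = {}"
  using assms orbit_self unfolding black_vertices_def vertices_def by blast

lemma orbit_white_vertex: "z \<in> white M \<Longrightarrow> orbit (rot M) z \<in> white_vertices M"
  using white_darts orbit_white unfolding white_vertices_def vertices_def by blast

lemma orbit_black_vertex: "z \<in> darts M \<Longrightarrow> z \<notin> white M \<Longrightarrow> orbit (rot M) z \<in> black_vertices M"
  using orbit_white unfolding black_vertices_def vertices_def by blast

lemma orientation_out_darts:
  assumes "Y \<subseteq> white M"
  shows "orientation M (out_darts M Y)"
proof -
  have Yd: "Y \<subseteq> darts M" using assms white_darts by blast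
  have "opp M d \<in> out_darts M Y \<longleftrightarrow> d \<notin> out_darts M Y" if "d \<in> darts M" for d
  proof (cases "d \<in> white M")
    case True
    then have "opp M d \<notin> white M" using that opp_white by blast
    moreover have "d \<notin> opp M ` Y" using True assms Yd opp_white by blast
    ultimately show ?thesis using True by (auto simp: out_darts_def)
  next
    case False
    then have "opp M d \<in> white M" using that opp_white by blast
    moreover have "opp M d \<notin> opp M ` Y" using False assms by auto
    moreover have "d \<in> opp M ` Y \<longleftrightarrow> opp M d \<in> Y"
    proof
      assume "d \<in> opp M ` Y"
      then obtain y where "y \<in> Y" "d = opp M y" by blast
      then show "opp M d \<in> Y" using Yd opp_opp[of y] by auto
    qed (use opp_opp[OF that] in \<open>auto intro: image_eqI[of _ _ "opp M d"]\<close>)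
    ultimately show ?thesis using False by (auto simp: out_darts_def)
  qed
  moreover have "out_darts M Y \<subseteq> darts M" using assms white_darts by (auto simp: out_darts_def)
  ultimately show ?thesis unfolding orientation_def by blast
qed

lemma one_orientation_out_darts:
  assumes "matching M Y" "regular m M"
  shows "one_orientation m M (out_darts M Y)"
  unfolding one_orientation_def
proof (intro conjI ballI)
  show "orientation M (out_darts M Y)" using orientation_out_darts matchingD(1)[OF assms(1)] by blast
next
  fix v assume v: "v \<in> white_vertices M"
  then obtain z where z: "z \<in> white M" "v = orbit (rot M) z" "v \<subseteq> white M" by (rule white_vertex)
  obtain y where y: "y \<in> Y" "y \<in> v" "\<And>y'. y' \<in> Y \<Longrightarrow> y' \<in> v \<Longrightarrow> y' = y"
    using matchingD(2)[OF assms(1) z(1)] z(2) by blast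
  have "opp M ` Y \<inter> white M = {}" using matchingD(1)[OF assms(1)] white_darts opp_white by blast
  then have "v \<inter> out_darts M Y = v - {y}" using y z(3) unfolding out_darts_def by blast
  moreover have "card v = m" using v assms(2) unfolding regular_def white_vertices_def by blast
  ultimately show "card (v \<inter> out_darts M Y) = m - 1" using y(2) by simp
next
  fix v assume v: "v \<in> black_vertices M"
  then obtain z where z: "z \<in> darts M" "z \<notin> white M" "v = orbit (rot M) z" "v \<inter> white M = {}"
    by (rule black_vertex)
  obtain y where y: "y \<in> Y" "opp M y \<in> v" "\<And>y'. y' \<in> Y \<Longrightarrow> opp M y' \<in> v \<Longrightarrow> y' = y"
    using matchingD(3)[OF assms(1) z(1,2)] z(3) by blast
  have "v \<inter> out_darts M Y = {opp M y}" using y z(4) unfolding out_darts_def by blast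
  then show "card (v \<inter> out_darts M Y) = 1" by simp
qed

text \<open>Outdegree \<open>m - 1\<close> leaves one ingoing dart at a white vertex, and the single
  outgoing dart of a black vertex has an ingoing white dart as its other end.\<close>

lemma one_orientation_matching:
  assumes "one_orientation m M X" "regular m M" "m \<ge> 1"
  shows "matching M (white M - X)" "out_darts M (white M - X) = X"
proof -
  have X: "X \<subseteq> darts M" "\<And>d. d \<in> darts M \<Longrightarrow> opp M d \<in> X \<longleftrightarrow> d \<notin> X"
    using assms(1) unfolding one_orientation_def orientation_def by auto
  show "matching M (white M - X)"
    unfolding matching_def
  proof (intro conjI ballI)
    fix z assume z: "z \<in> white M"
    let ?v = "orbit (rot M) z"
    have v: "?v \<in> white_vertices M" "finite ?v" "?v \<subseteq> white M"
      using z orbit_white_vertex finite_orbit[OF orbit_self] by (auto simp: white_vertices_def)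
    then have "card (?v \<inter> X) = m - 1" "card ?v = m"
      using assms(1,2) unfolding one_orientation_def regular_def white_vertices_def by auto
    \<comment> \<open>Truncated subtraction: \<open>m - (m - 1)\<close> is 1 only because
      \<open>m \<ge> 1\<close>.\<close>
    then have "card (?v - X) = 1" using v(2) assms(3) by (simp add: card_Diff_subset_Int)
    then obtain y where "?v - X = {y}" by (auto simp: card_1_singleton_iff)
    then have "y' \<in> white M - X \<and> y' \<in> ?v \<longleftrightarrow> y' = y" for y' using v(3) by blast
    then show "\<exists>!y. y \<in> white M - X \<and> y \<in> ?v" by simp
  next
    fix z assume z: "z \<in> darts M - white M"
    let ?v = "orbit (rot M) z"
    have v: "?v \<in> black_vertices M" "?v \<subseteq> darts M" "?v \<inter> white M = {}"
      using z orbit_black_vertex orbit_darts by (auto simp: black_vertices_def)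
    then have "card (?v \<inter> X) = 1" using assms(1) unfolding one_orientation_def by blast
    then obtain x where x: "?v \<inter> X = {x}" by (auto simp: card_1_singleton_iff)
    have xd: "x \<in> darts M" "x \<notin> white M" "x \<in> X" "x \<in> ?v" using x v by blast+
    then have 1: "opp M x \<in> white M - X" using X opp_white by blast
    have 2: "opp M (opp M x) \<in> ?v" using xd opp_opp by simp
    have 3: "y = opp M x" if "y \<in> white M - X" "opp M y \<in> ?v" for y
    proof -
      have "y \<in> darts M" using that white_darts by blast
      then have "opp M y \<in> ?v \<inter> X" using that X by blast
      then have "opp M y = x" using x by blast
      then show ?thesis using opp_opp \<open>y \<in> darts M\<close> by auto
    qed
    show "\<exists>!y. y \<in> white M - X \<and> opp M y \<in> ?v"
      by (rule ex1I[of _ "opp M x"]) (use 1 2 in simp, use 3 in simp)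
  qed simp
  show "out_darts M (white M - X) = X"
  proof
    show "out_darts M (white M - X) \<subseteq> X" using X(2) white_darts by (auto simp: out_darts_def)
    show "X \<subseteq> out_darts M (white M - X)"
    proof
      fix x assume x: "x \<in> X"
      then have xd: "x \<in> darts M" using X by blast
      show "x \<in> out_darts M (white M - X)"
      proof (cases "x \<in> white M")
        case False
        then have "opp M x \<in> white M - X" "x = opp M (opp M x)" using xd x X(2) opp_white opp_opp by auto
        then show ?thesis unfolding out_darts_def by blast
      qed (use x in \<open>auto simp: out_darts_def\<close>)
    qed
  qed
qed

lemma marked_edge_iff:
  assumes "marks M \<subseteq> white M" "z \<in> white M"
  shows "{z, opp M z} \<in> marked_edges M \<longleftrightarrow> z \<in> marks M"
proof
  assume "{z, opp M z} \<in> marked_edges M"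
  then obtain k where k: "k \<in> marks M" "{z, opp M z} = {k, opp M k}" by (auto simp: marked_edges_def)
  have "opp M z \<notin> white M" using assms white_darts opp_white by blast
  then show "z \<in> marks M" using k assms by (auto simp: doubleton_eq_iff)
qed (auto simp: marked_edges_def)

text \<open>A path of vertices lifts to darts by going around each vertex to the dart by which the
  path leaves it; conversely, rotation steps disappear when darts are replaced by their
  vertices.\<close>

lemma root_accessible_iff:
  assumes Y: "matching M Y" "Y \<inter> marks M = {}" and mw: "marks M \<subseteq> white M"
  shows "root_accessible M (out_darts M Y) \<longleftrightarrow> (\<forall>z\<in>darts M. (z, root_dart M) \<in> (reach M Y (marks M))\<^sup>*)"
proof -
  let ?S = "unmarked_steps M (out_darts M Y)" and ?R = "reach M Y (marks M)"
  have Yw: "Y \<subseteq> white M" "Y \<subseteq> darts M" using matchingD(1)[OF Y(1)] white_darts by auto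
  have rotR: "(x, rot M x) \<in> ?R" if "x \<in> darts M" for x using that by (auto simp: reach_def)
  have 1: "(z, root_dart M) \<in> ?R\<^sup>*" if "(v, root_vertex M) \<in> ?S\<^sup>*" "z \<in> darts M" "v = orbit (rot M) z" for v z
    using that
  proof (induction arbitrary: z rule: converse_rtrancl_induct)
    case base
    then have "root_dart M \<in> orbit (rot M) z" using orbit_self[of "root_dart M"] by (simp add: root_vertex_def)
    then show ?case using orbit_rtrancl[of ?R] rotR base by blast
  next
    case (step v v')
    obtain d where d: "v = orbit (rot M) d" "v' = orbit (rot M) (opp M d)" "d \<in> out_darts M Y"
      "{d, opp M d} \<notin> marked_edges M" using step.hyps(1) by (auto simp: unmarked_steps_def)
    have dd: "d \<in> darts M" using d(3) Yw white_darts by (auto simp: out_darts_def)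
    have "d \<in> orbit (rot M) z" using d step.prems orbit_self by metis
    then have "(z, d) \<in> ?R\<^sup>*" using orbit_rtrancl[of ?R] rotR step.prems by blast
    moreover have "(d, opp M d) \<in> ?R"
    proof (cases "d \<in> white M")
      case True
      then have "d \<notin> opp M ` Y" using Yw opp_white by blast
      then have "d \<in> white M - Y - marks M" using d True by (auto simp: out_darts_def marked_edges_def)
      then show ?thesis by (auto simp: reach_def)
    next
      case False
      then obtain y where "y \<in> Y" "d = opp M y" using d by (auto simp: out_darts_def)
      then show ?thesis using Yw opp_opp[of y] by (auto simp: reach_def)
    qed
    moreover have "(opp M d, root_dart M) \<in> ?R\<^sup>*" using step.IH[of "opp M d"] d dd by simp
    ultimately show ?case by simp
  qed
  have 2: "(orbit (rot M) z, root_vertex M) \<in> ?S\<^sup>*" if "(z, root_dart M) \<in> ?R\<^sup>*" for z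
    using that
  proof (induction rule: converse_rtrancl_induct)
    case base
    then show ?case by (simp add: root_vertex_def)
  next
    case (step z z')
    from step.hyps(1) consider "z' = rot M z" | "z \<in> white M - Y - marks M" "z' = opp M z" | "z = opp M z'" "z' \<in> Y"
      by (auto simp: reach_def)
    then show ?case
    proof cases
      case 1
      then show ?thesis using step.IH by simp
    next
      case 2
      then have "{z, opp M z} \<notin> marked_edges M" "z \<in> out_darts M Y" using marked_edge_iff[OF mw] by (auto simp: out_darts_def)
      then have "(orbit (rot M) z, orbit (rot M) z') \<in> ?S" using 2 by (auto simp: unmarked_steps_def)
      then show ?thesis using step.IH by (rule converse_rtrancl_into_rtrancl)
    next
      case 3
      then have "{z, opp M z} = {z', opp M z'}" "opp M z = z'" using Yw opp_opp by auto
      then have "{z, opp M z} \<notin> marked_edges M" "z \<in> out_darts M Y" using 3 marked_edge_iff[OF mw, of z'] Yw Y(2)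
        by (auto simp: out_darts_def)
      then have "(orbit (rot M) z, orbit (rot M) (opp M z)) \<in> ?S" unfolding unmarked_steps_def by blast
      then have "(orbit (rot M) z, orbit (rot M) z') \<in> ?S" using \<open>opp M z = z'\<close> by simp
      then show ?thesis using step.IH by (rule converse_rtrancl_into_rtrancl)
    qed
  qed
  show ?thesis
  proof
    assume "root_accessible M (out_darts M Y)"
    then show "\<forall>z\<in>darts M. (z, root_dart M) \<in> ?R\<^sup>*" using 1 by (auto simp: root_accessible_def vertices_def)
  next
    assume "\<forall>z\<in>darts M. (z, root_dart M) \<in> ?R\<^sup>*"
    then show "root_accessible M (out_darts M Y)" using 2 by (auto simp: root_accessible_def vertices_def)
  qed
qed

text \<open>The only outgoing dart of a black vertex starts its path to the root, so it is unmarked.\<close>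

lemma admissible_marks_white:
  assumes "admissible m M"
  shows "marks M \<subseteq> white M"
proof
  fix z assume z: "z \<in> marks M"
  obtain X where X: "one_orientation m M X" "compatible M X" "root_accessible M X"
    using assms by (auto simp: admissible_def)
  have zd: "z \<in> darts M" "z \<in> X" using z marks_darts X(2) by (auto simp: compatible_def)
  show "z \<in> white M"
  proof (rule ccontr)
    assume nw: "z \<notin> white M"
    let ?v = "orbit (rot M) z"
    have v: "?v \<in> black_vertices M" using orbit_black_vertex[OF zd(1) nw] .
    then have "card (?v \<inter> X) = 1" using X(1) by (auto simp: one_orientation_def)
    moreover have "z \<in> ?v \<inter> X" using zd by simp
    ultimately have vX: "?v \<inter> X = {z}" by (metis card_1_singletonE singletonD)
    have "?v \<noteq> root_vertex M"
      using v root_white orbit_self[of "root_dart M"] by (auto simp: root_vertex_def black_vertices_def)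
    moreover have "(?v, root_vertex M) \<in> (unmarked_steps M X)\<^sup>*"
      using X(3) v by (auto simp: root_accessible_def black_vertices_def)
    ultimately obtain u where "(?v, u) \<in> unmarked_steps M X" by (meson converse_rtranclE)
    then obtain d where d: "?v = orbit (rot M) d" "d \<in> X" "{d, opp M d} \<notin> marked_edges M"
      by (auto simp: unmarked_steps_def)
    then have "d = z" using vX orbit_self by blast
    then show False using d z by (auto simp: marked_edges_def)
  qed
qed

text \<open>The ingoing darts of a white vertex are exactly its darts in \<open>Y\<close>, so the
  condition on the root corner becomes membership of \<open>root_dart M\<close> in the
  matching.\<close>

lemma admissible_iff:
  assumes "regular m M" "m \<ge> 1" and mw: "marks M \<subseteq> white M"
  shows "admissible m M \<longleftrightarrow> (\<exists>Y. root_matching M (marks M) Y)"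
proof
  assume "admissible m M"
  then obtain X where X: "one_orientation m M X" "compatible M X" "root_accessible M X"
    "root_vertex M - X = {root_dart M}" by (auto simp: admissible_def)
  let ?Y = "white M - X"
  have Y: "matching M ?Y" "out_darts M ?Y = X" using one_orientation_matching[OF X(1) assms(1,2)] .
  have disj: "?Y \<inter> marks M = {}" using X(2) by (auto simp: compatible_def)
  have "\<forall>z\<in>darts M. (z, root_dart M) \<in> (reach M ?Y (marks M))\<^sup>*"
    using root_accessible_iff[OF Y(1) disj mw] X(3) Y(2) by simp
  then show "\<exists>Y. root_matching M (marks M) Y" using Y(1) disj X(4) root_white by (auto simp: root_matching_def)
next
  assume "\<exists>Y. root_matching M (marks M) Y"
  then obtain Y where Y: "matching M Y" "Y \<inter> marks M = {}" "root_dart M \<in> Y"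
    "\<forall>z\<in>darts M. (z, root_dart M) \<in> (reach M Y (marks M))\<^sup>*" by (auto simp: root_matching_def)
  have "root_vertex M - out_darts M Y = {root_dart M}"
  proof -
    have w: "root_vertex M \<subseteq> white M"
      using root_white orbit_white[OF root_dart_darts] unfolding root_vertex_def by blast
    have "opp M ` Y \<inter> white M = {}" using matchingD(1)[OF Y(1)] white_darts opp_white by blast
    then have "root_vertex M - out_darts M Y = root_vertex M \<inter> Y" using w by (auto simp: out_darts_def)
    also have "\<dots> = {root_dart M}" using matching_white_unique[OF Y(1,3)] Y(3) by (auto simp: root_vertex_def)
    finally show ?thesis .
  qed
  moreover have "compatible M (out_darts M Y)" using mw Y(2) by (auto simp: compatible_def out_darts_def)
  ultimately show "admissible m M"
    using one_orientation_out_darts[OF Y(1) assms(1)] root_accessible_iff[OF Y(1,2) mw] Y(4)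
    unfolding admissible_def by blast
qed

lemma card_marked_edges: "marks M \<subseteq> white M \<Longrightarrow> card (marked_edges M) = card (marks M)"
proof -
  assume mw: "marks M \<subseteq> white M"
  have "inj_on (\<lambda>d. {d, opp M d}) (marks M)"
  proof (rule inj_onI)
    fix x y assume xy: "x \<in> marks M" "y \<in> marks M" "{x, opp M x} = {y, opp M y}"
    then have "x \<in> white M" "y \<in> white M" "opp M x \<notin> white M" using mw white_darts opp_white by blast+
    then show "x = y" using xy(3) by (auto simp: doubleton_eq_iff)
  qed
  then show ?thesis unfolding marked_edges_def by (rule card_image)
qed

end

section \<open>The orientation read from an opening is admissible\<close>

context opened_map
begin

lemma tree_reach_aux:
  assumes "\<And>x. x \<in> darts M \<Longrightarrow> (x, rot M x) \<in> Q"
    "\<And>d e us. (d, e, us) \<in> forest_nodes ts \<Longrightarrow> (e, d) \<in> Q"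
    "dnodes t \<subseteq> forest_nodes ts" "(pdart t, r) \<in> Q\<^sup>*" "(d, e, us) \<in> dnodes t"
  shows "(e, r) \<in> Q\<^sup>*"
  using assms(3-5)
proof (induction t)
  case (DNode d' e' us')
  have n: "(d', e', us') \<in> forest_nodes ts" using DNode.prems(1) by simp
  then have na: "(d', e', us') \<in> all_nodes M ts" unfolding all_nodes_def by blast
  have e': "(e', r) \<in> Q\<^sup>*"
    using DNode.prems(2) assms(2)[OF n] by (simp add: converse_rtrancl_into_rtrancl)
  show ?case
  proof (cases "(d, e, us) = (d', e', us')")
    case False
    then obtain u where u: "u \<in> set us'" "(d, e, us) \<in> dnodes u" using DNode.prems(3) by auto
    have "e' \<in> orbit (rot M) (pdart u)"
      using node_orbit[OF na] u(1) orbit_eq[of "pdart u" e'] by auto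
    moreover have "pdart u \<in> darts M" using nodes_darts(3)[OF na] u(1) by blast
    ultimately have "(pdart u, e') \<in> Q\<^sup>*" using orbit_rtrancl[of Q] assms(1) by blast
    then show ?thesis
    proof (intro DNode.IH[OF u(1) _ _ u(2)])
      show "dnodes u \<subseteq> forest_nodes ts" using DNode.prems(1) u(1) by (simp only: dnodes.simps) blast
    qed (use e' in simp)
  qed (use e' in simp)
qed simp

text \<open>From any dart one turns to the own dart of its node and goes up, until the root is
  reached. The relation \<open>Q\<close> is left open because the argument serves both for
  connectivity and for accessibility in the tree orientation.\<close>

lemma tree_reach:
  assumes "\<And>x. x \<in> darts M \<Longrightarrow> (x, rot M x) \<in> Q"
    "\<And>d e us. (d, e, us) \<in> forest_nodes ts \<Longrightarrow> (e, d) \<in> Q"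
    "z \<in> darts M"
  shows "(z, root_leaf M) \<in> Q\<^sup>*"
proof -
  obtain d e us where n: "(d, e, us) \<in> all_nodes M ts" "z \<in> orbit (rot M) e"
    using dart_node[OF assms(3)] .
  have "(e, root_leaf M) \<in> Q\<^sup>*"
  proof (cases "(d, e, us) = (root_leaf M, root_leaf M, ts)")
    case False
    then obtain t where t: "t \<in> set ts" "(d, e, us) \<in> dnodes t"
      using n(1) unfolding all_nodes_def by auto
    have na: "(root_leaf M, root_leaf M, ts) \<in> all_nodes M ts" by (simp add: all_nodes_def)
    have "root_leaf M \<in> orbit (rot M) (pdart t)"
      using node_orbit[OF na] t(1) orbit_eq[of "pdart t" "root_leaf M"] by auto
    moreover have "pdart t \<in> darts M" using nodes_darts(3)[OF na] t(1) by blast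
    ultimately have "(pdart t, root_leaf M) \<in> Q\<^sup>*" using orbit_rtrancl[of Q] assms(1) by blast
    moreover have "dnodes t \<subseteq> forest_nodes ts" using t(1) by blast
    ultimately show ?thesis using tree_reach_aux[of Q t] assms(1,2) t(2) by blast
  qed simp
  moreover have "(z, e) \<in> Q\<^sup>*"
    using orbit_rtrancl[of Q e z] assms(1,3) n(2) orbit_eq[OF n(2)] orbit_self[of e] by auto
  ultimately show ?thesis by simp
qed

lemma regular: "regular m M"
  unfolding regular_def vertices_def
proof (intro ballI)
  fix v assume "v \<in> orbit (rot M) ` darts M"
  then obtain z where z: "z \<in> darts M" "v = orbit (rot M) z" by auto
  obtain d e us where n: "(d, e, us) \<in> all_nodes M ts" "z \<in> orbit (rot M) e" using dart_node[OF z(1)] .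
  show "card v = m" using orbit_eq[OF n(2)] node_card[OF n(1)] z by simp
qed

lemma is_comb_map: "is_comb_map M"
proof -
  let ?A = "adjacent_darts M"
  have to_root: "(z, root_leaf M) \<in> ?A\<^sup>*" if "z \<in> darts M" for z
  proof (rule tree_reach[OF _ _ that])
    show "(x, rot M x) \<in> ?A" if "x \<in> darts M" for x using that by (auto simp: adjacent_darts_def)
    fix d e us assume n: "(d, e, us) \<in> forest_nodes ts"
    then have "d \<in> darts M" "e = opp M d" using nodes_darts(1) node_opp unfolding all_nodes_def by blast+
    then have "e \<in> darts M" "d = opp M e" using opp_opp by auto
    then show "(e, d) \<in> ?A" unfolding adjacent_darts_def by blast
  qed
  \<comment> \<open>A rotation step is undone by going around the rest of the vertex, an edge step
    by crossing back.\<close>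
  have rev: "(y, x) \<in> ?A\<^sup>*" if xy: "(x, y) \<in> ?A" for x y
  proof -
    have x: "x \<in> darts M" and "y = rot M x \<or> y = opp M x" using xy by (auto simp: adjacent_darts_def)
    then consider "y = rot M x" | "y = opp M x" by blast
    then show ?thesis
    proof cases
      case 1
      have "x \<in> orbit (rot M) y" using 1 by simp
      then show ?thesis
        using orbit_rtrancl[of ?A x y] x 1 by (auto simp: adjacent_darts_def)
    next
      case 2
      then have "x = opp M y" "y \<in> darts M" using opp_opp x by auto
      then have "(y, x) \<in> ?A" unfolding adjacent_darts_def by blast
      then show ?thesis by blast
    qed
  qed
  have "(y, x) \<in> ?A\<^sup>*" if "(x, y) \<in> ?A\<^sup>*" for x y
    using that by (induction rule: rtrancl_induct) (use rev in \<open>auto intro: rtrancl_trans\<close>)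
  then have "(x, y) \<in> ?A\<^sup>*" if "x \<in> darts M" "y \<in> darts M" for x y
    using to_root[OF that(1)] to_root[OF that(2)] by (meson rtrancl_trans)
  then show ?thesis
    unfolding is_comb_map_def using finite_darts rot_permutes opp_permutes opp_neq opp_opp by blast
qed

lemma marked_regular_bipartite_map: "marked_regular_bipartite_map m M"
  unfolding marked_regular_bipartite_map_def bicolored_def
  using is_comb_map regular white_darts rot_white opp_white root_white marks_darts marks_opp by blast

text \<open>The last child of the root is followed by the root leaf, so it hangs from
  \<open>root_dart M\<close>. This is where the rightmost position of the node child enters.\<close>

lemma root_in_Y: "root_dart M \<in> Y"
proof -
  have na: "(root_leaf M, root_leaf M, ts) \<in> all_nodes M ts" by (simp add: all_nodes_def)
  have "map (rot M) (root_leaf M # map pdart ts) = map pdart ts @ [root_leaf M]" by (rule node_rot[OF na])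
  then have "last (map (rot M) (root_leaf M # map pdart ts)) = root_leaf M" by simp
  then have "rot M (pdart (last ts)) = root_leaf M" by (simp add: last_map)
  then have "pdart (last ts) = root_dart M" by (simp add: root_leaf_def)
  moreover obtain d e us where l: "last ts = DNode d e us" using last_node by (auto simp: is_dnode_iff)
  moreover have "DNode d e us \<in> set ts" using l last_in_set[OF ts_neq] by simp
  then have "(d, e, us) \<in> forest_nodes ts" by (rule child_node[OF na])
  ultimately show ?thesis using root_white unfolding Y_def by auto
qed

lemma root_matching_Y: "root_matching M (marks M) Y"
  unfolding root_matching_def
proof (intro conjI ballI)
  show "matching M Y" by (rule matching_Y)
  show "Y \<inter> marks M = {}" using Y_tree marks_tree by blast
  show "root_dart M \<in> Y" by (rule root_in_Y)
  let ?Q = "reach M Y (marks M)"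
  have rotQ: "(x, rot M x) \<in> ?Q" if "x \<in> darts M" for x using that by (auto simp: reach_def)
  fix z assume "z \<in> darts M"
  then have "(z, root_leaf M) \<in> ?Q\<^sup>*"
  proof (rule tree_reach[rotated 2])
    fix d e us assume n: "(d, e, us) \<in> forest_nodes ts"
    then have na: "(d, e, us) \<in> all_nodes M ts" unfolding all_nodes_def by blast
    have de: "d \<in> darts M" "e = opp M d" "e \<in> E" using nodes_darts(1)[OF na] node_opp[OF n] node_tree_darts[OF n] by auto
    show "(e, d) \<in> ?Q"
    proof (cases "d \<in> white M")
      case True
      then have "d \<in> Y" using n unfolding Y_def by blast
      then show ?thesis using de by (auto simp: reach_def)
    next
      case False
      then have "e \<in> white M" "d = opp M e" using de opp_white opp_opp by auto
      moreover have "e \<notin> Y" "e \<notin> marks M" using Y_own[OF na] de(3) marks_tree by auto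
      ultimately show ?thesis unfolding reach_def by blast
    qed
  qed (use rotQ in auto)
  moreover have "(root_leaf M, root_dart M) \<in> ?Q\<^sup>*"
    using orbit_rtrancl[of ?Q "root_dart M" "root_leaf M"] rotQ by (simp add: root_leaf_def)
  ultimately show "(z, root_dart M) \<in> ?Q\<^sup>*" by simp
qed

lemma admissible: "admissible m M"
  using admissible_iff[OF regular _ marks_white] m_ge root_matching_Y by auto

end

section \<open>Reading the marked tree of an opened map\<close>

definition dart_kind :: "marked_map \<Rightarrow> nat \<Rightarrow> leaf_kind" where
  "dart_kind M d = (if d \<in> white M then Opening else Closing)"

definition dart_color :: "marked_map \<Rightarrow> nat \<Rightarrow> node_color" where
  "dart_color M d = (if d \<in> white M then White else Black)"

fun shape :: "marked_map \<Rightarrow> nat dtree \<Rightarrow> ptree" where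
  "shape M (DLeaf d) = Leaf (dart_kind M d)"
| "shape M (DNode d e ts) = Node (dart_color M e) (map (shape M) ts)"

definition leaf_pairs :: "marked_map \<Rightarrow> nat list \<Rightarrow> (nat \<times> nat) set" where
  "leaf_pairs M ls =
     {(i, j). i < length ls \<and> j < length ls \<and> ls ! i \<in> white M \<and> ls ! j = opp M (ls ! i)}"

text \<open>Pairs are recorded as positions in the list of leaves, so the reading forgets the names
  of the darts and isomorphic maps can have the same one.\<close>

definition reading :: "marked_map \<Rightarrow> nat dtree list \<Rightarrow> marked_tree" where
  "reading M ts =
     \<lparr>tree = Node White (map (shape M) ts),
      pairs = leaf_pairs M (full_leaves M ts),
      marked_pairs = {(i, j) \<in> leaf_pairs M (full_leaves M ts). full_leaves M ts ! i \<in> marks M}\<rparr>"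

lemma reading_simps [simp]:
  "tree (reading M ts) = Node White (map (shape M) ts)"
  "pairs (reading M ts) = leaf_pairs M (full_leaves M ts)"
  "marked_pairs (reading M ts) = {(i, j) \<in> leaf_pairs M (full_leaves M ts). full_leaves M ts ! i \<in> marks M}"
  by (simp_all add: reading_def)

lemma leaves_shape: "leaves (shape M t) = map (dart_kind M) (leaf_darts t)"
proof (induction t)
  case (DNode d e ts)
  then have "concat (map leaves (map (shape M) ts)) = map (dart_kind M) (forest_leaf_darts ts)"
    by (induction ts) auto
  then show ?case by simp
qed simp

lemma leaves_forest: "concat (map leaves (map (shape M) ts)) = map (dart_kind M) (forest_leaf_darts ts)"
  by (induction ts) (auto simp: leaves_shape)

lemma subtrees_shape:
  assumes "Node c vs \<in> subtrees (shape M t)"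
  shows "\<exists>(d, e, us)\<in>dnodes t. c = dart_color M e \<and> vs = map (shape M) us"
  using assms by (induction t) fastforce+

lemma count_list_map_filter: "count_list (map f xs) y = length (filter (\<lambda>x. f x = y) xs)"
  by (induction xs) auto

lemma length_filter_concat: "length (filter P (concat xss)) = sum_list (map (\<lambda>xs. length (filter P xs)) xss)"
  by (induction xss) auto

lemma black_nodes_shape:
  "black_nodes (shape M t) = length (filter (\<lambda>(d, e, us). e \<notin> white M) (node_list t))"
proof (induction t)
  case (DNode d e ts)
  have "map (\<lambda>t. black_nodes (shape M t)) ts =
      map (\<lambda>t. length (filter (\<lambda>(d, e, us). e \<notin> white M) (node_list t))) ts"
    using DNode by simp
  from arg_cong[OF this, of sum_list] show ?case
    by (simp add: dart_color_def length_filter_concat comp_def del: map_eq_conv)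
qed simp

lemma distinct_own_darts:
  assumes "distinct (concat (map (\<lambda>(d, e, us). [d, e]) xs))"
  shows "distinct (map (\<lambda>(d, e, us). e) xs)"
  using assms
proof (induction xs)
  case (Cons x xs)
  have "set (map (\<lambda>(d, e, us). e) xs) \<subseteq> set (concat (map (\<lambda>(d, e, us). [d, e]) xs))" by force
  then show ?case using Cons by (cases x) auto
qed simp

lemma dart_kind_eq [simp]:
  "dart_kind M d = Opening \<longleftrightarrow> d \<in> white M" "dart_kind M d = Closing \<longleftrightarrow> d \<notin> white M"
  by (auto simp: dart_kind_def)

context opened_map
begin

text \<open>Each black vertex contains the own dart of exactly one node. The root is white, so the
  nodes of the forest are all that has to be counted.\<close>

lemma card_black_vertices: "card (black_vertices M) = black_nodes (tree (reading M ts))"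
proof -
  let ?xs = "filter (\<lambda>(d, e, us). e \<notin> white M) (concat (map node_list ts))"
  let ?B = "set (map (\<lambda>(d, e, us). e) ?xs)"
  have sx: "set (concat (map node_list ts)) = forest_nodes ts" by (auto simp: set_node_list)
  have dist: "distinct (concat (map (\<lambda>(d, e, us). [d, e]) (concat (map node_list ts))))"
    using distinct_forest unfolding distinct_forest_tour forest_edge_darts_node_list by simp
  have "distinct (map (\<lambda>(d, e, us). e) ?xs)"
    using distinct_own_darts[OF dist] by (rule distinct_map_filter)
  then have "card ?B = length ?xs" using distinct_card by fastforce
  also have "\<dots> = black_nodes (tree (reading M ts))"
    by (simp add: length_filter_concat black_nodes_shape comp_def)
  finally have cB: "card ?B = black_nodes (tree (reading M ts))" .
  have B: "e \<in> ?B \<longleftrightarrow> e \<notin> white M \<and> (\<exists>d us. (d, e, us) \<in> forest_nodes ts)" for e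
    unfolding sx[symmetric] by force
  have "bij_betw (orbit (rot M)) ?B (black_vertices M)"
    unfolding bij_betw_def
  proof
    show "inj_on (orbit (rot M)) ?B"
    proof (rule inj_onI)
      fix x y assume "x \<in> ?B" "y \<in> ?B" and eq: "orbit (rot M) x = orbit (rot M) y"
      then obtain dx ux dy uy where n: "(dx, x, ux) \<in> forest_nodes ts" "(dy, y, uy) \<in> forest_nodes ts"
        unfolding B by blast
      then have na: "(dx, x, ux) \<in> all_nodes M ts" unfolding all_nodes_def by blast
      have "y \<in> orbit (rot M) x" using eq by simp
      then have "y = x \<or> (\<exists>u\<in>set ux. y = pdart u)" using node_orbit[OF na] by auto
      \<comment> \<open>Otherwise \<open>y\<close> would be the upper end of one tree edge and the
        lower end of another.\<close>
      moreover have False if u: "u \<in> set ux" "y = pdart u" for u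
      proof -
        have "is_dnode u" using child_tree_dart[OF na u(1)] node_tree_darts[OF n(2)] u(2) by blast
        then obtain d' e' us' where u': "u = DNode d' e' us'" by (auto simp: is_dnode_iff)
        have "(d', e', us') \<in> forest_nodes ts" using child_node[OF na] u u' by blast
        moreover have "d' = y" using u u' by simp
        ultimately show False using forest_nodes_disjoint(1)[OF distinct_forest _ n(2)] by blast
      qed
      ultimately show "x = y" by blast
    qed
    show "orbit (rot M) ` ?B = black_vertices M"
    proof
      show "orbit (rot M) ` ?B \<subseteq> black_vertices M"
      proof
        fix v assume "v \<in> orbit (rot M) ` ?B"
        then obtain d e us where n: "(d, e, us) \<in> forest_nodes ts" "e \<notin> white M" "v = orbit (rot M) e"
          by (elim imageE) (unfold B, blast)
        then have "(d, e, us) \<in> all_nodes M ts" unfolding all_nodes_def by blast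
        then show "v \<in> black_vertices M" using nodes_darts(2) orbit_black_vertex n by blast
      qed
      show "black_vertices M \<subseteq> orbit (rot M) ` ?B"
      proof
        fix v assume "v \<in> black_vertices M"
        then obtain z where z: "z \<in> darts M" "z \<notin> white M" "v = orbit (rot M) z" by (rule black_vertex)
        obtain d e us where n: "(d, e, us) \<in> all_nodes M ts" "z \<in> orbit (rot M) e" using dart_node[OF z(1)] .
        have "e \<notin> white M" using orbit_white[OF nodes_darts(2)[OF n(1)] n(2)] z by simp
        moreover have "(d, e, us) \<in> forest_nodes ts"
          using n(1) calculation unfolding all_nodes_def by auto
        ultimately have "e \<in> ?B" unfolding B by blast
        then show "v \<in> orbit (rot M) ` ?B" using orbit_eq[OF n(2)] z by blast
      qed
    qed
  qed
  then show ?thesis using cB bij_betw_same_card by metis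
qed

lemma child_white:
  assumes "(d, e, us) \<in> all_nodes M ts" "u \<in> set us"
  shows "pdart u \<in> white M \<longleftrightarrow> e \<in> white M"
  using orbit_white[OF nodes_darts(2)[OF assms(1)], of "pdart u"] node_orbit[OF assms(1)] assms(2) by simp

lemma good_node_shape:
  assumes n: "(d, e, us) \<in> all_nodes M ts"
  shows "good_node m (dart_color M e) (map (shape M) us)"
proof -
  have node: "e' \<in> white M \<longleftrightarrow> e \<notin> white M" if "DNode d' e' us' \<in> set us" for d' e' us'
  proof -
    have "e' = opp M d'" by (rule node_opp[OF child_node[OF n that]])
    moreover have "d' \<in> darts M" using nodes_darts(3)[OF n] that by auto
    ultimately show ?thesis using child_white[OF n that] opp_white by simp
  qed
  have 1: "\<forall>t\<in>set (map (shape M) us). \<not> is_node (dart_color M e) t"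
  proof
    fix t assume "t \<in> set (map (shape M) us)"
    then obtain u where u: "u \<in> set us" "t = shape M u" by auto
    show "\<not> is_node (dart_color M e) t"
    proof (cases u)
      case (DNode d' e' us')
      then show ?thesis using node[of d' e' us'] u by (auto simp: dart_color_def)
    qed (use u in simp)
  qed
  have 2: "\<forall>k. Leaf k \<in> set (map (shape M) us) \<longrightarrow> k = (case dart_color M e of White \<Rightarrow> Opening | Black \<Rightarrow> Closing)"
  proof (intro allI impI)
    fix k assume "Leaf k \<in> set (map (shape M) us)"
    then obtain u where u: "u \<in> set us" "Leaf k = shape M u" by auto
    have "\<exists>d'. u = DLeaf d'" using u(2) by (cases u rule: dtree.exhaust) simp_all
    then show "k = (case dart_color M e of White \<Rightarrow> Opening | Black \<Rightarrow> Closing)"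
      using u child_white[OF n u(1)] by (auto simp: dart_color_def dart_kind_def)
  qed
  have 3: "length (filter (is_node Black) (map (shape M) us)) = 1 \<and>
      length (filter (\<lambda>t. t = Leaf Opening) (map (shape M) us)) = m - 2" if "e \<in> white M"
  proof -
    have a: "is_node Black (shape M u) \<longleftrightarrow> is_dnode u" if "u \<in> set us" for u
    proof (cases u)
      case (DNode d' e' us')
      then show ?thesis using node[of d' e' us'] \<open>e \<in> white M\<close> that by (auto simp: dart_color_def)
    qed simp
    have b: "shape M u = Leaf Opening \<longleftrightarrow> \<not> is_dnode u" if "u \<in> set us" for u
      using child_white[OF n that] \<open>e \<in> white M\<close> by (cases u) (auto simp: dart_kind_def)
    have "filter (is_node Black \<circ> shape M) us = filter is_dnode us"
      by (rule filter_cong) (auto simp: a)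
    moreover have "filter ((\<lambda>t. t = Leaf Opening) \<circ> shape M) us = filter (\<lambda>u. \<not> is_dnode u) us"
      by (rule filter_cong) (auto simp: b)
    moreover have "length (filter is_dnode us) = 1" using node_child[OF n that] .
    moreover have "length us = length (filter is_dnode us) + length (filter (\<lambda>u. \<not> is_dnode u) us)"
      by (simp add: sum_length_filter_compl)
    ultimately show ?thesis using node_deg[OF n] by (simp add: filter_map)
  qed
  show ?thesis
    unfolding good_node_def using 1 2 3 node_deg[OF n] by (simp add: dart_color_def)
qed

lemma walk_reading: "walk (tree (reading M ts)) = map (dart_kind M) (full_leaves M ts)"
  using leaves_forest[of M ts] by (simp add: walk_def full_leaves_def dart_kind_def)

lemma leaf_opp: "z \<in> set (full_leaves M ts) \<Longrightarrow> opp M z \<in> set (full_leaves M ts)"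
  using tree_darts_opp by (auto simp: set_leaves)

lemma m_bipartite_tree_reading: "m_bipartite_tree m (tree (reading M ts))"
proof -
  let ?t = "tree (reading M ts)" and ?L = "full_leaves M ts"
  have root: "(root_leaf M, root_leaf M, ts) \<in> all_nodes M ts" by (simp add: all_nodes_def)
  have nodes: "\<exists>(d, e, us)\<in>all_nodes M ts. c = dart_color M e \<and> vs = map (shape M) us"
    if sub: "Node c vs \<in> subtrees ?t" for c vs
  proof (cases "(c, vs) = (White, map (shape M) ts)")
    case True
    then show ?thesis using root by (intro bexI[OF _ root]) (auto simp: dart_color_def)
  next
    case False
    then obtain t where t: "t \<in> set ts" "Node c vs \<in> subtrees (shape M t)" using sub by auto
    obtain d e us where n: "(d, e, us) \<in> dnodes t" "c = dart_color M e" "vs = map (shape M) us"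
      using subtrees_shape[OF t(2)] by auto
    then have "(d, e, us) \<in> all_nodes M ts" using t(1) unfolding all_nodes_def by blast
    then show ?thesis using n by blast
  qed
  have good: "good_node m c vs" if "Node c vs \<in> subtrees ?t" for c vs
    using nodes[OF that] good_node_shape by auto
  have "rooted_plane_tree ?t"
    unfolding rooted_plane_tree_def
  proof (intro allI impI)
    fix c vs assume "Node c vs \<in> subtrees ?t"
    then have "Suc (length vs) = m" using good by (auto simp: good_node_def)
    then show "vs \<noteq> []" using m_ge by auto
  qed
  moreover have "count_list (walk ?t) Opening = count_list (walk ?t) Closing"
  proof -
    let ?W = "{z \<in> set ?L. z \<in> white M}" and ?B = "{z \<in> set ?L. z \<notin> white M}"
    have L: "set ?L \<subseteq> darts M" by (auto simp: set_leaves)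
    \<comment> \<open>\<open>opp\<close> exchanges white and black leaves, the root leaf included,
      so the two kinds are equally many.\<close>
    have "bij_betw (opp M) ?W ?B"
      unfolding bij_betw_def
    proof
      show "opp M ` ?W = ?B"
      proof
        show "opp M ` ?W \<subseteq> ?B" using leaf_opp L opp_white by blast
        show "?B \<subseteq> opp M ` ?W"
        proof
          fix z assume z: "z \<in> ?B"
          then have "z = opp M (opp M z)" "opp M z \<in> ?W" using L leaf_opp opp_white opp_opp[of z] by auto
          then show "z \<in> opp M ` ?W" by blast
        qed
      qed
    qed (simp add: inj_on_def)
    then have "card ?W = card ?B" by (rule bij_betw_same_card)
    moreover have "count_list (walk ?t) Opening = card ?W"
      using distinct_card[OF distinct_filter[OF distinct_leaves, of "\<lambda>z. z \<in> white M"]]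
      unfolding walk_reading count_list_map_filter by simp
    moreover have "count_list (walk ?t) Closing = card ?B"
      using distinct_card[OF distinct_filter[OF distinct_leaves, of "\<lambda>z. z \<notin> white M"]]
      unfolding walk_reading count_list_map_filter by simp
    ultimately show ?thesis by simp
  qed
  ultimately show ?thesis
    unfolding m_bipartite_tree_def blossoming_def using good by auto
qed

lemma leaf_pairs_iff:
  "(i, j) \<in> leaf_pairs M (full_leaves M ts) \<longleftrightarrow> i < length (full_leaves M ts) \<and> j < length (full_leaves M ts) \<and>
     full_leaves M ts ! i \<in> white M \<and> full_leaves M ts ! j = opp M (full_leaves M ts ! i)"
  by (simp add: leaf_pairs_def)

lemma leaf_nth_darts: "i < length (full_leaves M ts) \<Longrightarrow> full_leaves M ts ! i \<in> darts M"
  using nth_mem[of i "full_leaves M ts"] by (simp add: set_leaves)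

lemma perfect_matching_reading: "perfect_matching (tree (reading M ts)) (pairs (reading M ts))"
proof -
  let ?t = "tree (reading M ts)" and ?L = "full_leaves M ts" and ?P = "leaf_pairs M (full_leaves M ts)"
  have pO: "i \<in> positions Opening ?t \<longleftrightarrow> i < length ?L \<and> ?L ! i \<in> white M" for i
    unfolding positions_def walk_reading by auto
  have pC: "i \<in> positions Closing ?t \<longleftrightarrow> i < length ?L \<and> ?L ! i \<notin> white M" for i
    unfolding positions_def walk_reading by auto
  have "?P \<subseteq> positions Opening ?t \<times> positions Closing ?t"
    using leaf_nth_darts opp_white by (auto simp: leaf_pairs_iff pO pC simp del: reading_simps(1))
  moreover have "\<exists>!j. (i, j) \<in> ?P" if i': "i \<in> positions Opening ?t" for i
  proof -
    have i: "i < length ?L" "?L ! i \<in> white M" using i' unfolding pO by auto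
    have "opp M (?L ! i) \<in> set ?L" using i leaf_opp nth_mem[of i ?L] by simp
    then obtain j where j: "j < length ?L" "?L ! j = opp M (?L ! i)" by (auto simp: in_set_conv_nth)
    show ?thesis
    proof (rule ex1I[of _ j])
      show "(i, j) \<in> ?P" using i j by (simp add: leaf_pairs_iff)
      fix k assume "(i, k) \<in> ?P"
      then have "k < length ?L" "?L ! k = ?L ! j" using j by (auto simp: leaf_pairs_iff)
      then show "k = j" using nth_eq_iff_index_eq[OF distinct_leaves] j(1) by blast
    qed
  qed
  moreover have "\<exists>!i. (i, j) \<in> ?P" if j: "j \<in> positions Closing ?t" for j
  proof -
    have jd: "?L ! j \<in> darts M" "?L ! j \<notin> white M" "j < length ?L" using j leaf_nth_darts unfolding pC by auto
    have "opp M (?L ! j) \<in> set ?L" using jd(3) leaf_opp nth_mem[of j ?L] by simp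
    then obtain i where i: "i < length ?L" "?L ! i = opp M (?L ! j)" by (auto simp: in_set_conv_nth)
    have "(i, j) \<in> ?P" using i jd opp_white opp_opp by (auto simp: leaf_pairs_iff)
    moreover have "k = i" if "(k, j) \<in> ?P" for k
    proof -
      have k: "k < length ?L" "?L ! j = opp M (?L ! k)" using that by (auto simp: leaf_pairs_iff)
      then have "?L ! i = ?L ! k" using i opp_opp leaf_nth_darts by simp
      then show ?thesis using nth_eq_iff_index_eq[OF distinct_leaves] i k by simp
    qed
    ultimately show ?thesis by blast
  qed
  ultimately show ?thesis unfolding perfect_matching_def by auto
qed

text \<open>A mark avoids the tree and is white, hence it is the opening leaf of a pair. The marks
  can therefore be rebuilt from the reading and the list of leaves, which is how an isomorphism of
  two openings is seen to respect them.\<close>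

lemma marks_marked_pairs:
  "marks M = (\<lambda>(i, j). full_leaves M ts ! i) ` marked_pairs (reading M ts)"
proof
  let ?L = "full_leaves M ts"
  show "marks M \<subseteq> (\<lambda>(i, j). ?L ! i) ` marked_pairs (reading M ts)"
  proof
    fix z assume z: "z \<in> marks M"
    then have "z \<in> set ?L" using marks_tree marks_darts by (auto simp: set_leaves)
    moreover have "opp M z \<in> set ?L" using leaf_opp calculation by blast
    ultimately obtain i j where "i < length ?L" "?L ! i = z" "j < length ?L" "?L ! j = opp M z"
      by (auto simp: in_set_conv_nth)
    then have "(i, j) \<in> marked_pairs (reading M ts)" "?L ! i = z"
      using z marks_white by (auto simp: leaf_pairs_iff)
    then show "z \<in> (\<lambda>(i, j). ?L ! i) ` marked_pairs (reading M ts)" by force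
  qed
qed auto

lemma card_marked_pairs: "card (marked_pairs (reading M ts)) = card (marks M)"
proof -
  let ?L = "full_leaves M ts"
  have "bij_betw (\<lambda>(i, j). ?L ! i) (marked_pairs (reading M ts)) (marks M)"
    unfolding bij_betw_def
  proof
    show "inj_on (\<lambda>(i, j). ?L ! i) (marked_pairs (reading M ts))"
    proof (rule inj_onI)
      fix p q assume pq: "p \<in> marked_pairs (reading M ts)" "q \<in> marked_pairs (reading M ts)"
        "(\<lambda>(i, j). ?L ! i) p = (\<lambda>(i, j). ?L ! i) q"
      obtain i j k l where ij: "p = (i, j)" "q = (k, l)" by fastforce
      then have "i < length ?L" "k < length ?L" "j < length ?L" "l < length ?L" "?L ! i = ?L ! k" "?L ! j = ?L ! l"
        using pq by (auto simp: leaf_pairs_iff)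
      then show "p = q" using nth_eq_iff_index_eq[OF distinct_leaves] ij by simp
    qed
    show "(\<lambda>(i, j). ?L ! i) ` marked_pairs (reading M ts) = marks M"
      by (rule marks_marked_pairs[symmetric])
  qed
  then show ?thesis by (rule bij_betw_same_card)
qed

lemma reading_tree_family: "reading M ts \<in> tree_family m (card (marks M))"
proof -
  let ?L = "full_leaves M ts"
  have "i < j" if ij: "(i, j) \<in> pairs (reading M ts) - marked_pairs (reading M ts)" for i j
  proof -
    have i: "i < length ?L" "j < length ?L" "?L ! i \<in> white M" "?L ! j = opp M (?L ! i)" "?L ! i \<notin> marks M"
      using ij by (auto simp: leaf_pairs_iff)
    have leaf: "?L ! i \<in> set ?L" "?L ! j \<in> set ?L" using nth_mem[OF i(1)] nth_mem[OF i(2)] .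
    have "before (full_tour M ts) (?L ! i) (?L ! j)"
      unfolding i(4) by (rule forward[OF i(3) leaf(1) i(5)])
    then have "before ?L (?L ! i) (?L ! j)"
      using before_filter[OF distinct_tour, of "?L ! i" "?L ! j" "\<lambda>z. z \<notin> E"] leaf
      by (simp add: full_leaves_filter[symmetric] set_leaves set_tour)
    then show ?thesis using before_nth[OF distinct_leaves i(1,2)] by simp
  qed
  moreover have "node_child_rightmost (tree (reading M ts))"
  proof -
    obtain d e us where l: "last ts = DNode d e us" using last_node by (auto simp: is_dnode_iff)
    have "map (shape M) ts = map (shape M) (butlast ts @ [last ts])" by simp
    then have "map (shape M) ts = map (shape M) (butlast ts) @ [Node (dart_color M e) (map (shape M) us)]"
      using l by simp
    then show ?thesis unfolding node_child_rightmost_def by (metis reading_simps(1))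
  qed
  ultimately show ?thesis
    unfolding tree_family_def marked_bipartite_tree_def
    using m_bipartite_tree_reading perfect_matching_reading card_marked_pairs by auto
qed

lemma in_map_family: "M \<in> map_family m (card (marks M))"
  unfolding map_family_def
  using marked_regular_bipartite_map admissible card_marked_edges[OF marks_white] by simp

end

section \<open>An opened map determines its spanning tree\<close>

text \<open>Once \<open>a\<close> lies in the prefix, its order relative to \<open>b\<close> is
  decided there. Two tours with a common prefix therefore agree on it.\<close>

lemma before_append_iff:
  assumes "distinct (p @ r)" "a \<in> set p" "b \<in> set (p @ r)" "a \<noteq> b"
  shows "before (p @ r) a b \<longleftrightarrow> b \<notin> set p \<or> before p a b"
proof (cases "b \<in> set p")
  case True
  have "distinct p" using assms(1) by simp
  then show ?thesis
    using True before_append[of p a b r] before_append[of p b a r] before_cases[of p a b] before_cases[of "p @ r" a b] assms by auto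
next
  case False
  then have "b \<in> set r" using assms by simp
  then show ?thesis using assms(2) False unfolding before_def by blast
qed

lemma before_prefix:
  assumes "distinct (p @ x # s)" "before (p @ x # s) a x"
  shows "a \<in> set p"
proof -
  obtain us vs where s: "p @ x # s = us @ vs" "a \<in> set us" "x \<in> set vs" using assms(2) by (auto simp: before_def)
  have "x \<notin> set us" using s assms(1) by auto
  then obtain w where "p = us @ w" using s(1) by (auto simp: append_eq_append_conv2 Cons_eq_append_conv)
  then show ?thesis using s(2) by simp
qed

text \<open>Entry \<open>i\<close> is the iterate \<open>f ^^ Suc i\<close> at \<open>e\<close>, so
  only the length is free; for the children of a node it is fixed by the degree.\<close>

lemma chain_unique:
  assumes "map f (e # xs) = xs @ [e]" "map f (e # ys) = ys @ [e]" "length xs = length ys"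
  shows "xs = ys"
proof -
  have *: "i < length zs \<Longrightarrow> zs ! i = (f ^^ Suc i) e" if "map f (e # zs) = zs @ [e]" for zs i
  proof (induction i)
    case 0
    then show ?case using that by (cases zs) auto
  next
    case (Suc i)
    have "zs ! Suc i = (zs @ [e]) ! Suc i" using Suc.prems by (simp add: nth_append)
    also have "\<dots> = f ((e # zs) ! Suc i)" using Suc.prems that by (metis Suc_lessD length_Cons less_SucI nth_map not_less_eq)
    finally show ?case using Suc by simp
  qed
  show ?thesis using assms *[of xs] *[of ys] by (intro nth_equalityI) auto
qed

context opened_map
begin

lemma node_before:
  assumes "(d, e, us) \<in> forest_nodes ts"
  shows "before (full_tour M ts) d e"
proof -
  obtain p q where "forest_tour ts = p @ tour (DNode d e us) @ q" using forest_nodes_split[OF assms] by blast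
  then have "full_tour M ts = (root_leaf M # p @ [d]) @ (forest_tour us @ e # q)" by (simp add: full_tour_def)
  moreover have "d \<in> set (root_leaf M # p @ [d])" "e \<in> set (forest_tour us @ e # q)" by auto
  ultimately show ?thesis unfolding before_def by blast
qed

text \<open>The upper dart of a tree edge comes first on the tour. So \<open>Y\<close> depends only
  on the tree darts and the order of the tour, data that two openings can share on a prefix.\<close>

lemma Y_iff:
  assumes "z \<in> white M"
  shows "z \<in> Y \<longleftrightarrow> z \<in> E \<and> before (full_tour M ts) z (opp M z)"
proof
  assume "z \<in> Y"
  then obtain e us where n: "(z, e, us) \<in> forest_nodes ts" unfolding Y_def by blast
  then show "z \<in> E \<and> before (full_tour M ts) z (opp M z)"
    using node_before[OF n] node_opp[OF n] node_tree_darts[OF n] by simp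
next
  assume z: "z \<in> E \<and> before (full_tour M ts) z (opp M z)"
  then have zE: "z \<in> E" by blast
  show "z \<in> Y"
    using zE
  proof (cases rule: tree_dart_cases)
    case (1 d e us)
    have "d \<in> darts M" using nodes_darts(1)[of d e us] 1 unfolding all_nodes_def by blast
    then have de: "e = opp M d" "d = opp M e" "d \<noteq> e"
      using node_opp[OF 1(1)] opp_opp[of d] opp_neq[of d] by metis+
    have "z \<noteq> e"
    proof
      assume "z = e"
      then have "before (full_tour M ts) e d" "before (full_tour M ts) d e"
        using z node_before[OF 1(1)] de(2)[symmetric] by simp_all
      moreover have "d \<in> set (full_tour M ts)" "e \<in> set (full_tour M ts)"
        using set_tour \<open>d \<in> darts M\<close> de(1) by auto
      ultimately show False using before_cases[OF distinct_tour, of e d] de(3) by blast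
    qed
    then show ?thesis using 1 assms unfolding Y_def by blast
  qed
qed

text \<open>
  Let \<open>d\<close> be the first dart at which a matching \<open>Z\<close> could leave the matching of the tree. The darts
  outside \<open>Y\<close> that \<open>Z\<close> uses after the subtree of \<open>d\<close> are permuted by following alternating paths,
  and such a path can never come back to the vertex of \<open>d\<close>.
\<close>

lemma Y_forced:
  assumes Z: "matching M Z" "Z \<inter> marks M = {}"
    and split: "full_tour M ts = p @ d # q" and d: "d \<in> Y"
    and agree: "\<And>z. z \<in> white M \<Longrightarrow> z \<in> set p \<or> opp M z \<in> set p \<Longrightarrow> z \<in> Z \<longleftrightarrow> z \<in> Y"
  shows "d \<in> Z"
proof (rule ccontr)
  assume dZ: "d \<notin> Z"
  obtain e us where n: "(d, e, us) \<in> forest_nodes ts" using d unfolding Y_def by blast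
  have dw: "d \<in> white M" "d \<in> darts M" using d white_darts unfolding Y_def by auto
  obtain p' q' where "forest_tour ts = p' @ tour (DNode d e us) @ q'" using forest_nodes_split[OF n] by blast
  then have W: "full_tour M ts = (root_leaf M # p') @ d # ((forest_tour us @ [e]) @ q')" by (simp add: full_tour_def)
  have "d \<notin> set (root_leaf M # p')" "d \<notin> set ((forest_tour us @ [e]) @ q')"
    using distinct_tour unfolding W by auto
  then have pq: "p = root_leaf M # p'" "q = (forest_tour us @ [e]) @ q'"
    using split unfolding W by (metis append_Cons_eq_iff)+
  \<comment> \<open>\<open>S\<close> is the subtree below \<open>d\<close> and \<open>A\<close> is
    everything later. The matchings agree on \<open>p\<close>; \<open>S\<close> is a union of whole
    vertices, closed under going down, and none of its darts lies at the vertex of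
    \<open>d\<close>.\<close>
  define S where "S = set (forest_tour us @ [e])"
  define A where "A = set q'"
  have darts: "darts M = set p \<union> {d} \<union> S \<union> A"
    unfolding set_tour[symmetric] W pq S_def A_def by auto
  have disj: "set p \<inter> S = {}" "set p \<inter> A = {}" "S \<inter> A = {}" "d \<notin> set p" "d \<notin> S" "d \<notin> A"
    using distinct_tour unfolding W pq S_def A_def by auto
  have eS: "e \<in> S" by (simp add: S_def)
  let ?N = "insert (d, e, us) (forest_nodes us)"
  have N: "?N \<subseteq> forest_nodes ts"
  proof -
    obtain t where t: "t \<in> set ts" "(d, e, us) \<in> dnodes t" using n by auto
    then have "dnodes (DNode d e us) \<subseteq> forest_nodes ts" using dnodes_trans[OF t(2)] by blast
    then show ?thesis by simp
  qed
  have S_nodes: "S = (\<Union>(d, e, us)\<in>?N. orbit (rot M) e)"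
  proof -
    have "S = (\<Union>(d, e, us)\<in>?N. insert e (pdart ` set us))"
      unfolding S_def set_append set_forest_tour_nodes by auto
    also have "\<dots> = (\<Union>(d, e, us)\<in>?N. orbit (rot M) e)"
    proof (rule SUP_cong[OF refl])
      fix n' assume "n' \<in> ?N"
      moreover obtain d' e' us' where "n' = (d', e', us')" by (cases n')
      ultimately have "n' = (d', e', us')" "(d', e', us') \<in> all_nodes M ts"
        using N unfolding all_nodes_def by blast+
      then show "(case n' of (d, e, us) \<Rightarrow> insert e (pdart ` set us)) = (case n' of (d, e, us) \<Rightarrow> orbit (rot M) e)"
        using node_orbit by simp
    qed
    finally show ?thesis .
  qed
  have S_closed: "y \<in> S" if "x \<in> S" "y \<in> orbit (rot M) x" for x y
  proof -
    obtain d' e' us' where "(d', e', us') \<in> ?N" "x \<in> orbit (rot M) e'" using \<open>x \<in> S\<close> unfolding S_nodes by blast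
    then show ?thesis using that(2) orbit_eq unfolding S_nodes by blast
  qed
  have S_sub: "e2 \<in> S" if n2: "(d2, e2, us2) \<in> forest_nodes ts" "d2 \<in> S" for d2 e2 us2
  proof -
    obtain d' e' us' where n': "(d', e', us') \<in> ?N" "d2 \<in> orbit (rot M) e'" using n2(2) unfolding S_nodes by blast
    then have n'f: "(d', e', us') \<in> forest_nodes ts" using N by blast
    then have n'a: "(d', e', us') \<in> all_nodes M ts" unfolding all_nodes_def by blast
    have "d2 \<noteq> e'" using forest_nodes_disjoint(1)[OF distinct_forest n2(1) n'f] .
    then obtain u where u: "u \<in> set us'" "d2 = pdart u" using n'(2) node_orbit[OF n'a] by auto
    have "is_dnode u" using child_tree_dart[OF n'a u(1)] node_tree_darts[OF n2(1)] u(2) by simp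
    then obtain e3 us3 where u': "u = DNode d2 e3 us3" using u(2) by (auto simp: is_dnode_iff)
    then have "(d2, e3, us3) \<in> forest_nodes ts" using child_node[OF n'a, of d2 e3 us3] u(1) by simp
    then have "e3 = e2" using node_opp n2(1) by metis
    moreover have "e3 \<in> S"
    proof -
      have "(d2, e3, us3) \<in> ?N"
        using n'(1) u(1) u' dnodes_trans[of d' e' us'] by (auto simp: subset_iff)
          (metis dnodes.simps(2) insertI1)+
      then show ?thesis unfolding S_nodes using orbit_self by blast
    qed
    ultimately show ?thesis by simp
  qed
  define A' where "A' = {x \<in> A. x \<in> Z \<and> x \<notin> Y}"
  have Zw: "Z \<subseteq> white M" using matchingD(1)[OF Z(1)] .
  have Yw: "Y \<subseteq> white M" using matchingD(1)[OF matching_Y] .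
  have step: "\<exists>z y. y \<in> Y \<and> y \<in> A \<and> opp M y \<in> orbit (rot M) (opp M x) \<and> z \<in> Z \<and> z \<in> orbit (rot M) y \<and> z \<in> A'"
    if x: "x \<in> A'" for x
  proof -
    have xA: "x \<in> A" "x \<in> Z" "x \<notin> Y" "x \<in> white M" "x \<in> darts M" using x Zw white_darts by (auto simp: A'_def)
    let ?b = "opp M x"
    have b: "?b \<in> darts M" "?b \<notin> white M" using xA opp_white by auto
    \<comment> \<open>An edge of \<open>Z\<close> that starts in \<open>A\<close> cannot end in
      \<open>S\<close>. As a tree edge outside \<open>Y\<close> with its upper end in the subtree it
      would lie there entirely; as an unmarked cut edge it would meet its black end first, against
      \<open>forward\<close>.\<close>
    have bA: "?b \<in> A"
    proof -
      have "?b \<notin> set p" using agree[of x] xA by blast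
      moreover have "?b \<noteq> d" using b dw by auto
      moreover have "?b \<notin> S"
      proof
        assume bS: "?b \<in> S"
        show False
        proof (cases "x \<in> E")
          case True
          then show False
          proof (cases rule: tree_dart_cases)
            case (1 d2 e2 us2)
            have "x \<noteq> d2" using 1 xA unfolding Y_def by blast
            then have "x = e2" using 1 by blast
            moreover have "d2 \<in> darts M" using nodes_darts(1)[of d2 e2 us2] 1(1) unfolding all_nodes_def by blast
            ultimately have "d2 = ?b" using node_opp[OF 1(1)] opp_opp by simp
            then have "x \<in> S" using S_sub[OF 1(1)] bS \<open>x = e2\<close> by simp
            then show False using xA disj by blast
          qed
        next
          case False
          then have "x \<in> set (full_leaves M ts)" using xA by (simp add: set_leaves)
          then have "before (full_tour M ts) x ?b" using forward[OF xA(4)] Z(2) xA(2) by blast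
          moreover have "before (full_tour M ts) ?b x"
          proof -
            have "full_tour M ts = (root_leaf M # p' @ d # forest_tour us @ [e]) @ q'" using W by simp
            moreover have "?b \<in> set (root_leaf M # p' @ d # forest_tour us @ [e])" using bS by (auto simp: S_def)
            moreover have "x \<in> set q'" using xA by (simp add: A_def)
            ultimately show ?thesis unfolding before_def by blast
          qed
          moreover have "x \<noteq> ?b" using b xA by auto
          ultimately show False using before_cases[OF distinct_tour, of x ?b] set_tour xA b by simp
        qed
      qed
      ultimately show ?thesis using darts b(1) by blast
    qed
    \<comment> \<open>The alternating path continues along the edge of \<open>Y\<close> at the black
      vertex, then turns to the edge of \<open>Z\<close> at the white vertex of \<open>y\<close>.
      Neither edge can return to \<open>p\<close>, where the matchings agree, nor enter
      \<open>S\<close>.\<close>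
    obtain y where y: "y \<in> Y" "opp M y \<in> orbit (rot M) ?b" using matchingD(3)[OF matching_Y b] by blast
    have yw: "y \<in> white M" "y \<in> darts M" "opp M y \<in> darts M" "opp M y \<notin> white M"
      using y Yw white_darts opp_white by auto
    have yZ: "y \<notin> Z"
    proof
      assume "y \<in> Z"
      then have "y = x" using matching_black_unique[OF Z(1) xA(2)] y(2) by blast
      then show False using y xA by blast
    qed
    have yp: "y \<notin> set p" "opp M y \<notin> set p" using agree[OF yw(1)] y(1) yZ by auto
    have "opp M y \<notin> S"
      using S_closed[of "opp M y" ?b] orbit_eq[OF y(2)] orbit_self[of ?b] bA disj by auto
    moreover have "opp M y \<noteq> d" using dw yw by auto
    ultimately have oyA: "opp M y \<in> A" using darts yp yw by blast
    obtain ey uy where ny: "(y, ey, uy) \<in> forest_nodes ts" using y(1) unfolding Y_def by blast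
    have "y \<notin> S" using S_sub[OF ny] node_opp[OF ny] oyA disj by blast
    moreover have "y \<noteq> d" using node_opp[OF n] oyA eS disj by auto
    ultimately have yA: "y \<in> A" using darts yp yw by blast
    obtain z where z: "z \<in> Z" "z \<in> orbit (rot M) y" using matchingD(2)[OF Z(1) yw(1)] by blast
    have zw: "z \<in> white M" "z \<in> darts M" using z Zw white_darts by auto
    have zY: "z \<notin> Y"
      using matching_white_unique[OF matching_Y y(1) _ z(2)] z(1) yZ by blast
    have "z \<notin> set p" using agree[OF zw(1)] z(1) zY by blast
    moreover have "z \<noteq> d" using z(1) dZ by blast
    moreover have "z \<notin> S" using S_closed[of z y] orbit_eq[OF z(2)] orbit_self[of y] yA disj by auto
    ultimately have "z \<in> A" using darts zw by blast
    then show ?thesis using y yA z zY unfolding A'_def by blast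
  qed
  then have "\<forall>x\<in>A'. \<exists>z y. y \<in> Y \<and> y \<in> A \<and> opp M y \<in> orbit (rot M) (opp M x) \<and> z \<in> Z \<and> z \<in> orbit (rot M) y \<and> z \<in> A'"
    by blast
  then obtain g h where gh: "\<And>x. x \<in> A' \<Longrightarrow> h x \<in> Y \<and> h x \<in> A \<and> opp M (h x) \<in> orbit (rot M) (opp M x) \<and>
      g x \<in> Z \<and> g x \<in> orbit (rot M) (h x) \<and> g x \<in> A'"
    by metis
  \<comment> \<open>Every step of the path can be undone, because an edge of a perfect matching is
    determined by either of its end vertices.\<close>
  have "inj_on g A'"
  proof (rule inj_onI)
    fix x1 x2 assume x: "x1 \<in> A'" "x2 \<in> A'" "g x1 = g x2"
    have "orbit (rot M) (h x1) = orbit (rot M) (h x2)" using gh[OF x(1)] gh[OF x(2)] x(3) orbit_eq by metis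
    then have "h x1 = h x2" using matching_white_unique[OF matching_Y] gh x(1,2) orbit_self by metis
    then have "orbit (rot M) (opp M x1) = orbit (rot M) (opp M x2)"
      using gh[OF x(1)] gh[OF x(2)] orbit_eq by metis
    then have "opp M x1 \<in> orbit (rot M) (opp M x2)" using orbit_self by metis
    then show "x1 = x2" using matching_black_unique[OF Z(1)] x(1,2) by (auto simp: A'_def)
  qed
  moreover have "finite A'" by (simp add: A'_def A_def)
  moreover have "g ` A' \<subseteq> A'" using gh by blast
  ultimately have surj: "g ` A' = A'" by (simp add: endo_inj_surj)
  \<comment> \<open>The edge of \<open>Z\<close> at the vertex of \<open>d\<close> lies in
    \<open>A'\<close>. Being a value of \<open>g\<close>, it makes some \<open>h x\<close> equal to
    \<open>d\<close>, although \<open>h x\<close> lies in \<open>A\<close>.\<close>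
  obtain d' where d': "d' \<in> Z" "d' \<in> orbit (rot M) d" using matchingD(2)[OF Z(1) dw(1)] by blast
  have d'w: "d' \<in> white M" "d' \<in> darts M" using d' Zw white_darts by auto
  have "d' \<notin> Y" using matching_white_unique[OF matching_Y d _ d'(2)] d'(1) dZ by blast
  moreover have "d' \<notin> set p" using agree[OF d'w(1)] d'(1) calculation by blast
  moreover have "d' \<noteq> d" using d' dZ by blast
  moreover have "d' \<notin> S" using S_closed[of d' d] orbit_eq[OF d'(2)] orbit_self[of d] disj by auto
  ultimately have "d' \<in> A'" using darts d'w d' unfolding A'_def by blast
  then obtain x where x: "x \<in> A'" "d' = g x" using surj by blast
  have "orbit (rot M) (h x) = orbit (rot M) d" using gh[OF x(1)] x(2) orbit_eq d'(2) by metis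
  then have "h x = d" using matching_white_unique[OF matching_Y d] gh[OF x(1)] orbit_self by metis
  then show False using gh[OF x(1)] disj by simp
qed

text \<open>What \<open>Y_forced\<close> asks of the past is thereby a property of the prefix and of
  the tree status of its darts, hence common to two openings that agree so far.\<close>

lemma Y_iff_prefix:
  assumes "full_tour M ts = p @ r" "z \<in> white M" "z \<in> set p \<or> opp M z \<in> set p"
  shows "z \<in> Y \<longleftrightarrow> z \<in> set p \<and> z \<in> E \<and> (opp M z \<notin> set p \<or> before p z (opp M z))"
proof -
  have zd: "z \<in> darts M" "opp M z \<in> darts M" using assms white_darts by auto
  then have ne: "z \<noteq> opp M z" using opp_neq by metis
  have dist: "distinct (p @ r)" using distinct_tour assms(1) by simp
  show ?thesis
  proof (cases "z \<in> set p")
    case True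
    have "opp M z \<in> set (p @ r)" using set_tour assms(1) zd by simp
    then show ?thesis
      using Y_iff[OF assms(2)] before_append_iff[OF dist True _ ne] True assms(1) by simp
  next
    case False
    then have o: "opp M z \<in> set p" "z \<in> set r" using assms set_tour zd(1) by auto
    then have "before (p @ r) (opp M z) z" unfolding before_def by blast
    then have "\<not> before (p @ r) z (opp M z)" using before_cases[OF dist, of "opp M z" z] o ne by auto
    then show ?thesis using Y_iff[OF assms(2)] False assms(1) by simp
  qed
qed

end

text \<open>One half of the induction step. If \<open>d\<close> is black and cut in
  \<open>ts\<close>, then \<open>forward\<close> puts its white end into the prefix, where the
  statuses agree. If \<open>d\<close> is white, it lies in the matching of \<open>ts'\<close>, and
  \<open>Y_forced\<close> applied to the matching of \<open>ts\<close> puts it there too.\<close>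

lemma opened_map_next_status:
  assumes "opened_map M m ts" "opened_map M m ts'"
    and W: "full_tour M ts = p @ d # q" "full_tour M ts' = p @ d # q'"
    and agree: "\<And>z. z \<in> set p \<Longrightarrow> z \<in> tree_darts ts \<longleftrightarrow> z \<in> tree_darts ts'"
    and d: "d \<in> tree_darts ts'"
  shows "d \<in> tree_darts ts"
proof (rule ccontr)
  assume dE: "d \<notin> tree_darts ts"
  interpret o1: opened_map M m ts by fact
  interpret o2: opened_map M m ts' by fact
  have dd: "d \<in> darts M" using d o2.tree_darts_darts by blast
  have "opp M d \<notin> set p"
    using agree[of "opp M d"] o1.tree_darts_opp[OF dd] o2.tree_darts_opp[OF dd] d dE by blast
  show False
  proof (cases "d \<in> white M")
    case False
    let ?z = "opp M d"
    have z: "?z \<in> white M" "?z \<notin> marks M" "?z \<in> set (full_leaves M ts)"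
      using o1.opp_white[OF dd] False o2.tree_darts_opp[OF dd] d o2.marks_tree o1.tree_darts_opp[OF dd] dE dd
      by (auto simp: o1.set_leaves)
    have "before (full_tour M ts) ?z d"
      using o1.forward[OF z(1,3,2)] o1.opp_opp[OF dd] by simp
    then have "?z \<in> set p"
      using before_prefix[of p d q ?z] o1.distinct_tour W(1) by simp
    then show False using \<open>opp M d \<notin> set p\<close> by blast
  next
    case True
    have dY: "d \<in> o2.Y"
      using d
    proof (cases rule: o2.tree_dart_cases)
      case (1 d2 e2 us2)
      have "d \<noteq> e2"
      proof
        assume "d = e2"
        then have "before (full_tour M ts') d2 d" using o2.node_before[OF 1(1)] by simp
        then have "d2 \<in> set p"
          using before_prefix[of p d q' d2] o2.distinct_tour W(2) by simp
        moreover have "d2 \<in> darts M" using o2.nodes_darts(1)[of d2 e2 us2] 1(1) unfolding all_nodes_def by blast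
        then have "d2 = opp M d" using o2.node_opp[OF 1(1)] \<open>d = e2\<close> o1.opp_opp by simp
        ultimately show False using \<open>opp M d \<notin> set p\<close> by blast
      qed
      then show ?thesis using 1 True unfolding o2.Y_def by blast
    qed
    have "d \<in> o1.Y"
    proof (rule o2.Y_forced[OF o1.matching_Y _ W(2) dY])
      show "o1.Y \<inter> marks M = {}" using o1.Y_tree o1.marks_tree by blast
      fix z assume z: "z \<in> white M" "z \<in> set p \<or> opp M z \<in> set p"
      show "z \<in> o1.Y \<longleftrightarrow> z \<in> o2.Y"
        unfolding o1.Y_iff_prefix[OF W(1) z] o2.Y_iff_prefix[OF W(2) z] using agree by blast
    qed
    then show False using o1.Y_tree dE by blast
  qed
qed

text \<open>Induction on the length of the common prefix: \<open>next_dart\<close> fixes the next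
  dart, and the previous lemma, used in both directions, fixes its status.\<close>

lemma opened_map_tour_unique:
  assumes o: "opened_map M m ts" "opened_map M m ts'"
  shows "tree_darts ts = tree_darts ts'"
proof -
  interpret o1: opened_map M m ts by fact
  interpret o2: opened_map M m ts' by fact
  let ?W = "full_tour M ts" and ?W' = "full_tour M ts'"
  have len: "length ?W = card (darts M)" "length ?W' = card (darts M)"
    using distinct_card[OF o1.distinct_tour] distinct_card[OF o2.distinct_tour] o1.set_tour o2.set_tour by auto
  have *: "take i ?W = take i ?W' \<and> (\<forall>z\<in>set (take i ?W). z \<in> tree_darts ts \<longleftrightarrow> z \<in> tree_darts ts')"
    if "i \<le> card (darts M)" for i
    using that
  proof (induction i)
    case (Suc i)
    then have IH: "take i ?W = take i ?W'" "\<And>z. z \<in> set (take i ?W) \<Longrightarrow> z \<in> tree_darts ts \<longleftrightarrow> z \<in> tree_darts ts'"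
      and i: "i < length ?W" "i < length ?W'" using len by auto
    have eq: "?W ! i = ?W' ! i"
    proof (cases i)
      case 0
      then show ?thesis by (simp add: full_tour_def)
    next
      case (Suc j)
      have j: "?W ! j = ?W' ! j" using IH(1) Suc by (metis lessI nth_take)
      have "?W ! j \<in> set (take i ?W)" using i Suc by (auto simp: in_set_conv_nth intro!: exI[of _ j])
      then have "next_dart M (tree_darts ts) (?W ! j) = next_dart M (tree_darts ts') (?W' ! j)"
        using IH(2) j by (auto simp: next_dart_def)
      moreover have "?W ! i = next_dart M (tree_darts ts) (?W ! j)"
        using successively_nth[OF o1.tour_next, of j] i Suc by simp
      moreover have "?W' ! i = next_dart M (tree_darts ts') (?W' ! j)"
        using successively_nth[OF o2.tour_next, of j] i Suc by simp
      ultimately show ?thesis by simp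
    qed
    have W: "?W = take i ?W @ ?W ! i # drop (Suc i) ?W" using i(1) by (rule id_take_nth_drop)
    have W': "?W' = take i ?W @ ?W ! i # drop (Suc i) ?W'" using id_take_nth_drop[OF i(2)] IH(1) eq by simp
    have "?W ! i \<in> tree_darts ts \<longleftrightarrow> ?W ! i \<in> tree_darts ts'"
    proof
      assume "?W ! i \<in> tree_darts ts'"
      then show "?W ! i \<in> tree_darts ts" using opened_map_next_status[OF o W W'] IH(2) by blast
    next
      assume "?W ! i \<in> tree_darts ts"
      then show "?W ! i \<in> tree_darts ts'"
        using opened_map_next_status[OF o(2,1) W' W] IH(2) by blast
    qed
    then show ?case using IH i eq by (auto simp: take_Suc_conv_app_nth)
  qed simp
  have "z \<in> tree_darts ts \<longleftrightarrow> z \<in> tree_darts ts'" if "z \<in> darts M" for z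
    using *[of "card (darts M)"] len that o1.set_tour by auto
  then show ?thesis using o1.tree_darts_darts o2.tree_darts_darts by blast
qed

text \<open>Equal tree darts leave no freedom: rotation lists the children of a node from its own
  dart on, and the status of their darts tells leaves from nodes.\<close>

lemma opened_map_unique:
  assumes o: "opened_map M m ts" "opened_map M m ts'"
  shows "ts = ts'"
proof -
  interpret o1: opened_map M m ts by fact
  interpret o2: opened_map M m ts' by fact
  note E = opened_map_tour_unique[OF o]
  have children: "us = us'" if n: "(d, e, us) \<in> all_nodes M ts" "(d', e, us') \<in> all_nodes M ts'"
    and IH: "\<And>u u'. u \<in> set us \<Longrightarrow> u' \<in> set us' \<Longrightarrow> pdart u = pdart u' \<Longrightarrow> u = u'" for d d' e us us'
  proof -
    have len: "length us = length us'" using o1.node_deg[OF n(1)] o2.node_deg[OF n(2)] by simp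
    then have eq: "map pdart us = map pdart us'"
      using chain_unique[OF o1.node_rot[OF n(1)] o2.node_rot[OF n(2)]] by simp
    have "us ! i = us' ! i" if "i < length us" for i
    proof (rule IH)
      show "us ! i \<in> set us" "us' ! i \<in> set us'" using that len by auto
      show "pdart (us ! i) = pdart (us' ! i)" using arg_cong[OF eq, of "\<lambda>xs. xs ! i"] that len by simp
    qed
    then show ?thesis using len by (simp add: nth_equalityI)
  qed
  have sub: "u = u'" if "(d, e, us) \<in> all_nodes M ts" "(d', e', us') \<in> all_nodes M ts'"
    "u \<in> set us" "u' \<in> set us'" "pdart u = pdart u'" for d e us d' e' us' u u'
    using that
  proof (induction u arbitrary: d e us d' e' us' u')
    case (DLeaf x)
    have "\<not> is_dnode u'"
      using o1.child_tree_dart[OF DLeaf(1,3)] o2.child_tree_dart[OF DLeaf(2,4)] E DLeaf(5) by simp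
    then show ?case using DLeaf(5) by (cases u') auto
  next
    case (DNode x y vs)
    have "is_dnode u'"
      using o1.child_tree_dart[OF DNode.prems(1,3)] o2.child_tree_dart[OF DNode.prems(2,4)] E DNode.prems(5) by simp
    then obtain y' vs' where u': "u' = DNode x y' vs'" using DNode.prems(5) by (cases u') auto
    have n: "(x, y, vs) \<in> forest_nodes ts" "(x, y', vs') \<in> forest_nodes ts'"
      using o1.child_node[OF DNode.prems(1,3)] o2.child_node[OF DNode.prems(2), of x y' vs'] DNode.prems(4) u'
      by blast+
    then have y: "y' = y" using o1.node_opp o2.node_opp by metis
    have na: "(x, y, vs) \<in> all_nodes M ts" "(x, y, vs') \<in> all_nodes M ts'"
      using n y unfolding all_nodes_def by blast+
    have "vs = vs'" by (rule children[OF na]) (use DNode.IH na in blast)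
    then show ?case using u' y by simp
  qed
  have root: "(root_leaf M, root_leaf M, ts) \<in> all_nodes M ts" "(root_leaf M, root_leaf M, ts') \<in> all_nodes M ts'"
    by (simp_all add: all_nodes_def)
  show ?thesis by (rule children[OF root]) (use sub root in blast)
qed

section \<open>Exploration of an admissible map\<close>

type_synonym frame = "nat \<times> nat \<times> nat dtree list"

abbreviation fown :: "frame \<Rightarrow> nat" where "fown f \<equiv> fst (snd f)"
abbreviation fsubs :: "frame \<Rightarrow> nat dtree list" where "fsubs f \<equiv> snd (snd f)"
abbreviation fdarts :: "frame \<Rightarrow> nat list" where "fdarts f \<equiv> fown f # map pdart (fsubs f)"

text \<open>The innermost node is at the head of the stack, whence the reversed order. The own dart
  of an open node other than the root is missing, as the walk meets it only on leaving.\<close>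

fun visited :: "frame list \<Rightarrow> nat list" where
  "visited [] = []"
| "visited (f # F) = visited F @ fst f # forest_tour (fsubs f)"

definition visited_leaves :: "marked_map \<Rightarrow> frame list \<Rightarrow> nat set" where
  "visited_leaves M F = insert (root_leaf M) (\<Union>f\<in>set F. set (forest_leaf_darts (fsubs f)))"

definition closed_nodes :: "frame list \<Rightarrow> frame set" where
  "closed_nodes F = (\<Union>f\<in>set F. forest_nodes (fsubs f))"

text \<open>Edges are named by their white darts. A leaf met at a black vertex adds nothing, because
  its edge is marked or was cut at the white end before.\<close>

definition cut_darts :: "marked_map \<Rightarrow> frame list \<Rightarrow> nat set" where
  "cut_darts M F = marks M \<union> (white M \<inter> visited_leaves M F)"

context bipartite_map
begin

lemma root_matching_mono: "root_matching M K' Y \<Longrightarrow> K \<subseteq> K' \<Longrightarrow> root_matching M K Y"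
proof -
  assume Y: "root_matching M K' Y" and K: "K \<subseteq> K'"
  have "reach M Y K' \<subseteq> reach M Y K" using K by (auto simp: reach_def)
  then have "(reach M Y K')\<^sup>* \<subseteq> (reach M Y K)\<^sup>*" by (rule rtrancl_mono)
  then show ?thesis using Y K unfolding root_matching_def by blast
qed

text \<open>Only paths through \<open>x\<close> are affected; such a path is followed until it meets
  \<open>x\<close> and then continued by the given one.\<close>

lemma root_matching_insert:
  assumes Y: "root_matching M K Y" and x: "x \<notin> Y" "(x, root_dart M) \<in> (reach M Y (insert x K))\<^sup>*"
  shows "root_matching M (insert x K) Y"
proof -
  let ?R' = "reach M Y (insert x K)"
  have "(z, root_dart M) \<in> ?R'\<^sup>*" if "(z, root_dart M) \<in> (reach M Y K)\<^sup>*" for z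
    using that
  proof (induction rule: converse_rtrancl_induct)
    case (step z z')
    show ?case
    proof (cases "z = x")
      case False
      then have "(z, z') \<in> ?R'" using step.hyps(1) unfolding reach_def by blast
      then show ?thesis using step.IH by (rule converse_rtrancl_into_rtrancl)
    qed (use x in simp)
  qed simp
  then show ?thesis using Y x(1) unfolding root_matching_def by blast
qed

end

text \<open>
  A partial tour is a stack of open nodes, innermost first, the last one being the root. Each frame
  carries the dart leading to the node, the dart of the node itself and the finished children.
\<close>

locale exploration = bipartite_map M for M +
  fixes F :: "frame list"
  assumes marks_white: "marks M \<subseteq> white M"
    and F_neq: "F \<noteq> []"
    and bottom: "fst (last F) = root_leaf M" "fown (last F) = root_leaf M"
    and link: "Suc i < length F \<Longrightarrow> fst (F ! i) = rot M (last (fdarts (F ! Suc i)))"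
    and own_opp: "Suc i < length F \<Longrightarrow> fown (F ! i) = opp M (fst (F ! i))"
    and chain: "f \<in> set F \<Longrightarrow> map (rot M) (butlast (fdarts f)) = map pdart (fsubs f)"
    and closed_opp: "n \<in> closed_nodes F \<Longrightarrow> fown n = opp M (fst n)"
    and closed_chain: "n \<in> closed_nodes F \<Longrightarrow> map (rot M) (fdarts n) = map pdart (fsubs n) @ [fown n]"
    and distinct_visited: "distinct (visited F @ map fown (butlast F))"
    and visited_darts: "set (visited F) \<subseteq> darts M"
    and own_darts: "f \<in> set F \<Longrightarrow> fown f \<in> darts M"
    and distinct_orbits: "distinct (map (\<lambda>f. orbit (rot M) (fown f)) F)"
    and ex_matching: "\<exists>Y. root_matching M (cut_darts M F) Y"
    and forced: "root_matching M (cut_darts M F) Y \<Longrightarrow> n \<in> closed_nodes F \<union> set (butlast F) \<Longrightarrow>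
           fst n \<in> white M \<Longrightarrow> fst n \<in> Y"
    and black_leaf: "z \<in> visited_leaves M F \<Longrightarrow> z \<notin> white M \<Longrightarrow>
           opp M z \<in> marks M \<or> opp M z \<in> visited_leaves M F \<and> before (visited F) (opp M z) z"
    and unmarked: "n \<in> closed_nodes F \<union> set (butlast F) \<Longrightarrow> fst n \<notin> marks M \<and> fown n \<notin> marks M"
begin

lemma frame_orbit:
  assumes "f \<in> set F"
  shows "set (fdarts f) \<subseteq> orbit (rot M) (fown f)"
proof -
  have "i < length (fdarts f) \<Longrightarrow> fdarts f ! i \<in> orbit (rot M) (fown f)" for i
  proof (induction i)
    case (Suc i)
    have "fdarts f ! Suc i = map (rot M) (butlast (fdarts f)) ! i" using chain[OF assms] by simp
    also have "\<dots> = rot M (fdarts f ! i)"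
    proof -
      have "i < length (butlast (fdarts f))" using Suc.prems by (simp only: length_butlast)
      then show ?thesis by (simp only: nth_map nth_butlast)
    qed
    finally show ?case using Suc by (metis Suc_lessD orbit.step)
  qed simp
  then show ?thesis by (metis in_set_conv_nth subsetI)
qed

lemma link_orbit: "Suc i < length F \<Longrightarrow> fst (F ! i) \<in> orbit (rot M) (fown (F ! Suc i))"
proof -
  assume i: "Suc i < length F"
  have "last (fdarts (F ! Suc i)) \<in> set (fdarts (F ! Suc i))" by (rule last_in_set) simp
  then have "last (fdarts (F ! Suc i)) \<in> orbit (rot M) (fown (F ! Suc i))"
    using frame_orbit[of "F ! Suc i"] i nth_mem by blast
  then show ?thesis unfolding link[OF i] by (rule orbit.step)
qed

lemma frame_index:
  assumes "i < length F" "j < length F" "fown (F ! i) \<in> orbit (rot M) (fown (F ! j))"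
  shows "i = j"
proof -
  have "orbit (rot M) (fown (F ! i)) = orbit (rot M) (fown (F ! j))" using orbit_eq[OF assms(3)] .
  then show ?thesis using nth_eq_iff_index_eq[OF distinct_orbits, of i j] assms by simp
qed

lemma frame_index_orbit:
  assumes "i < length F" "j < length F" "z \<in> orbit (rot M) (fown (F ! i))" "z \<in> orbit (rot M) (fown (F ! j))"
  shows "i = j"
proof -
  have "fown (F ! i) \<in> orbit (rot M) (fown (F ! j))"
    using orbit_eq[OF assms(3)] orbit_eq[OF assms(4)] orbit_self[of "fown (F ! i)"] by simp
  then show ?thesis by (rule frame_index[OF assms(1,2)])
qed

lemma frame_darts: "i < length F \<Longrightarrow> fown (F ! i) \<in> darts M"
  using own_darts nth_mem by blast

lemma butlast_nth: "Suc i < length F \<Longrightarrow> F ! i \<in> set (butlast F)"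
  using nth_mem[of i "butlast F"] by (simp add: nth_butlast)

lemma last_index: "i < length F \<Longrightarrow> \<not> Suc i < length F \<Longrightarrow> F ! i = last F"
  using F_neq by (subst last_conv_nth) (auto intro: arg_cong[of _ _ "nth F"])

lemma fst_visited: "f \<in> set G \<Longrightarrow> fst f \<in> set (visited G)"
  by (induction G) auto

lemma fst_darts: "i < length F \<Longrightarrow> fst (F ! i) \<in> darts M"
  using fst_visited nth_mem visited_darts by blast

lemma opp_own: "Suc i < length F \<Longrightarrow> opp M (fown (F ! i)) = fst (F ! i)"
  using own_opp[of i] opp_opp fst_darts[of i] by simp

lemma own_color: "Suc i < length F \<Longrightarrow> fown (F ! i) \<in> white M \<longleftrightarrow> fst (F ! i) \<notin> white M"
  using own_opp[of i] opp_white fst_darts[of i] by simp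

lemma color_alternates:
  assumes "Suc i < length F"
  shows "fown (F ! Suc i) \<in> white M \<longleftrightarrow> fown (F ! i) \<notin> white M"
  using own_color[OF assms] orbit_white[OF frame_darts[OF assms] link_orbit[OF assms]] by simp

lemma body_visited: "f \<in> set G \<Longrightarrow> set (forest_tour (fsubs f)) \<subseteq> set (visited G)"
  by (induction G) auto

lemma leaves_visited: "visited_leaves M F \<subseteq> set (visited F)"
proof -
  have "set (forest_leaf_darts (fsubs f)) \<subseteq> set (visited F)" if "f \<in> set F" for f
    using body_visited[OF that] unfolding set_forest_tour by blast
  moreover have "root_leaf M \<in> set (visited F)"
    using fst_visited[OF last_in_set[OF F_neq]] bottom(1) by simp
  ultimately show ?thesis unfolding visited_leaves_def by blast
qed

lemma own_not_visited:
  assumes "Suc i < length F"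
  shows "fown (F ! i) \<notin> set (visited F)"
proof -
  have "fown (F ! i) \<in> set (map fown (butlast F))" using butlast_nth[OF assms] by simp
  then show ?thesis using distinct_visited unfolding distinct_append by blast
qed

lemma own_not_cut:
  assumes "Suc i < length F"
  shows "fown (F ! i) \<notin> cut_darts M F"
proof -
  have "fown (F ! i) \<notin> marks M" using unmarked[of "F ! i"] butlast_nth[OF assms] by blast
  moreover have "fown (F ! i) \<notin> visited_leaves M F" using own_not_visited[OF assms] leaves_visited by blast
  ultimately show ?thesis by (simp add: cut_darts_def)
qed

lemma distinct_visited_body:
  "distinct (visited G) \<Longrightarrow> f \<in> set G \<Longrightarrow> g \<in> set G \<Longrightarrow> fst f \<notin> set (forest_tour (fsubs g))"
proof (induction G arbitrary: f g)
  case (Cons h G)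
  have "fst h \<notin> set (forest_tour (fsubs g))" if "g \<in> set G" for g
    using that Cons.prems(1) body_visited[OF that] by auto
  moreover have "fst f \<notin> set (forest_tour (fsubs h))" if "f \<in> set G" for f
    using that Cons.prems(1) fst_visited[OF that] by auto
  moreover have "fst h \<notin> set (forest_tour (fsubs h))" "distinct (visited G)" using Cons.prems(1) by simp_all
  ultimately show ?case using Cons.IH Cons.prems(2,3) by (metis set_ConsD)
qed simp

lemma body_own: "f \<in> set F \<Longrightarrow> g \<in> set F \<Longrightarrow> fown f \<notin> set (forest_tour (fsubs g))"
proof -
  assume f: "f \<in> set F" and g: "g \<in> set F"
  obtain i where i: "i < length F" "f = F ! i" using f by (auto simp: in_set_conv_nth)
  show ?thesis
  proof (cases "Suc i < length F")
    case True
    then show ?thesis using own_not_visited[OF True] body_visited[OF g] i by auto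
  next
    case False
    then have "f = last F" using i last_index by simp
    then have "fown f = fst f" using bottom by simp
    moreover have "distinct (visited F)" using distinct_visited by simp
    ultimately show ?thesis using distinct_visited_body[OF _ f g] by simp
  qed
qed

lemma distinct_body: "distinct (visited G) \<Longrightarrow> f \<in> set G \<Longrightarrow> distinct (forest_tour (fsubs f))"
  by (induction G) auto

lemma frame_distinct: "f \<in> set F \<Longrightarrow> distinct (fdarts f)"
proof -
  assume f: "f \<in> set F"
  have "distinct (visited F)" using distinct_visited by simp
  then have "distinct (map pdart (fsubs f))" using distinct_map_pdart distinct_body[OF _ f] by blast
  moreover have "set (map pdart (fsubs f)) \<subseteq> set (forest_tour (fsubs f))" by auto
  then have "fown f \<notin> set (map pdart (fsubs f))" using body_own[OF f f] by blast
  ultimately show ?thesis by simp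
qed

lemma closed_orbit: "n \<in> closed_nodes F \<Longrightarrow> orbit (rot M) (fown n) = set (fdarts n)"
  using orbit_chain[OF closed_chain] by simp

lemma closed_body:
  assumes "n \<in> closed_nodes F"
  shows "\<exists>f\<in>set F. set (fdarts n) \<subseteq> set (forest_tour (fsubs f)) \<and> fst n \<in> set (forest_tour (fsubs f))"
proof -
  obtain f where f: "f \<in> set F" "n \<in> forest_nodes (fsubs f)" using assms unfolding closed_nodes_def by blast
  then have "(fst n, fown n, fsubs n) \<in> forest_nodes (fsubs f)" by simp
  from dnode_darts[OF this] show ?thesis using f(1) by (intro bexI[of _ f]) auto
qed

lemma closed_visited: "n \<in> closed_nodes F \<Longrightarrow> set (fdarts n) \<subseteq> set (visited F) \<and> fst n \<in> set (visited F)"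
  using closed_body[of n] body_visited by blast

text \<open>Locates a visited dart at a closed or an open node. The upper dart of an open node lies
  at the next node of the stack, which accounts for the last alternative.\<close>

lemma visited_cases:
  assumes "z \<in> set (visited F)"
  shows "(\<exists>n\<in>closed_nodes F. z \<in> orbit (rot M) (fown n)) \<or>
     (\<exists>f\<in>set F. z \<in> set (fdarts f)) \<or> (\<exists>f\<in>set (tl F). z \<in> orbit (rot M) (fown f))"
proof -
  have "(\<exists>f\<in>set G. z \<in> set (forest_tour (fsubs f)) \<or> z = fst f)" if "z \<in> set (visited G)" for G
    using that by (induction G) auto
  then obtain f where f: "f \<in> set F" "z \<in> set (forest_tour (fsubs f)) \<or> z = fst f" using assms by blast
  show ?thesis
    using f(2)
  proof
    assume "z \<in> set (forest_tour (fsubs f))"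
    then consider "z \<in> pdart ` set (fsubs f)"
      | n where "n \<in> forest_nodes (fsubs f)" "z \<in> set (fdarts n)"
      unfolding set_forest_tour_nodes by fastforce
    then show ?thesis
    proof cases
      case 2
      then have "n \<in> closed_nodes F" using f(1) unfolding closed_nodes_def by blast
      then show ?thesis using 2 closed_orbit by blast
    qed (use f in auto)
  next
    assume z: "z = fst f"
    obtain i where i: "i < length F" "f = F ! i" using f by (auto simp: in_set_conv_nth)
    show ?thesis
    proof (cases "Suc i < length F")
      case True
      moreover have "F ! Suc i \<in> set (tl F)" using True by (metis Suc_less_eq2 length_tl nth_mem nth_tl diff_Suc_1)
      ultimately show ?thesis using link_orbit[OF True] z i by blast
    next
      case False
      then have "f = last F" using i last_index by simp
      then have "z \<in> set (fdarts f)" using z bottom by simp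
      then show ?thesis using f by blast
    qed
  qed
qed

lemma not_touched:
  assumes "\<And>n. n \<in> closed_nodes F \<union> set F \<Longrightarrow> z \<notin> orbit (rot M) (fown n)"
  shows "z \<notin> set (visited F)" "z \<notin> fown ` set F"
proof -
  have "set (tl F) \<subseteq> set F" by (cases F) auto
  then show "z \<notin> set (visited F)"
    using visited_cases[of z] assms frame_orbit by blast
  show "z \<notin> fown ` set F" using assms orbit_self by blast
qed

section \<open>The next dart of the walk\<close>

definition next_x where "next_x = rot M (last (fdarts (hd F)))"

lemma hd_in [simp]: "hd F \<in> set F"
  using F_neq by simp

lemma next_orbit: "next_x \<in> orbit (rot M) (fown (hd F))"
proof -
  have "last (fdarts (hd F)) \<in> set (fdarts (hd F))" by (rule last_in_set) simp
  then have "last (fdarts (hd F)) \<in> orbit (rot M) (fown (hd F))" using frame_orbit[OF hd_in] by blast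
  then show ?thesis unfolding next_x_def by (rule orbit.step)
qed

lemma next_darts: "next_x \<in> darts M"
  using next_orbit orbit_darts own_darts[OF hd_in] by blast

lemma next_color: "next_x \<in> white M \<longleftrightarrow> fown (hd F) \<in> white M"
  using orbit_white[OF own_darts[OF hd_in] next_orbit] .

lemma hd_orbit_unique:
  assumes "f \<in> set F" "z \<in> orbit (rot M) (fown f)" "z \<in> orbit (rot M) (fown (hd F))"
  shows "f = hd F"
proof -
  obtain i where i: "i < length F" "f = F ! i" using assms by (auto simp: in_set_conv_nth)
  have "hd F = F ! 0" "0 < length F" using F_neq by (auto simp: hd_conv_nth)
  then show ?thesis using frame_index_orbit[of i 0 z] i assms by simp
qed

text \<open>No other node shares the current vertex, so its visited darts are those of the top
  frame. Rotation is injective, hence the dart after the last of them is new unless the turn is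
  complete.\<close>

lemma next_new:
  assumes "next_x \<noteq> fown (hd F)"
  shows "next_x \<notin> set (visited F)" "next_x \<notin> fown ` set F"
proof -
  have hd_case: "False" if "next_x \<in> set (fdarts (hd F))"
  proof -
    have "next_x \<in> set (map pdart (fsubs (hd F)))" using that assms by simp
    then have "next_x \<in> rot M ` set (butlast (fdarts (hd F)))"
      using chain[OF hd_in] by (metis list.set_map)
    then have "last (fdarts (hd F)) \<in> set (butlast (fdarts (hd F)))" by (auto simp: next_x_def)
    moreover have "distinct (butlast (fdarts (hd F)) @ [last (fdarts (hd F))])"
      using frame_distinct[OF hd_in] append_butlast_last_id[of "fdarts (hd F)"] by simp
    ultimately show False by simp
  qed
  show "next_x \<notin> fown ` set F"
  proof
    assume "next_x \<in> fown ` set F"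
    then obtain f where f: "f \<in> set F" "next_x = fown f" by blast
    then have "f = hd F" using hd_orbit_unique[OF f(1) _ next_orbit] by simp
    then show False using f assms by simp
  qed
  show "next_x \<notin> set (visited F)"
  proof
    assume "next_x \<in> set (visited F)"
    then consider n where "n \<in> closed_nodes F" "next_x \<in> orbit (rot M) (fown n)"
      | f where "f \<in> set F" "next_x \<in> set (fdarts f)"
      | f where "f \<in> set (tl F)" "next_x \<in> orbit (rot M) (fown f)"
      using visited_cases by blast
    then show False
    proof cases
      case 1
      then have "fown (hd F) \<in> orbit (rot M) (fown n)"
        using orbit_eq[OF next_orbit] orbit_eq[OF 1(2)] orbit_self[of "fown (hd F)"] by simp
      then have "fown (hd F) \<in> set (fdarts n)" using closed_orbit[OF 1(1)] by simp
      then show False using closed_body[OF 1(1)] body_own[OF hd_in] by blast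
    next
      case 2
      then have "f = hd F" using hd_orbit_unique[OF 2(1) _ next_orbit] frame_orbit[OF 2(1)] by blast
      then show False using 2 hd_case by simp
    next
      case 3
      have "f \<in> set F" using 3 by (meson list.set_sel(2) F_neq)
      then have "f = hd F" using hd_orbit_unique[OF _ 3(2) next_orbit] by blast
      moreover have "hd F \<notin> set (tl F)"
      proof -
        have "distinct F" using distinct_orbits by (simp add: distinct_map)
        then show ?thesis using F_neq by (cases F) auto
      qed
      ultimately show False using 3 by simp
    qed
  qed
qed

text \<open>The parent of such a node is black, hence not the root, and its own upper edge is
  already forced into every remaining matching. It cannot be matched a second time.\<close>

lemma own_not_matched:
  assumes Y: "root_matching M (cut_darts M F) Y" and i: "Suc i < length F" and w: "fown (F ! i) \<in> white M"
  shows "fown (F ! i) \<notin> Y"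
proof
  assume own: "fown (F ! i) \<in> Y"
  have b: "fown (F ! Suc i) \<notin> white M" using color_alternates[OF i] w by simp
  have i2: "Suc (Suc i) < length F"
  proof (rule ccontr)
    assume "\<not> Suc (Suc i) < length F"
    then have "F ! Suc i = last F" using i last_index by simp
    then show False using b bottom by simp
  qed
  have "fst (F ! Suc i) \<in> white M" using own_color[OF i2] b by simp
  then have "fst (F ! Suc i) \<in> Y" using forced[OF Y, of "F ! Suc i"] butlast_nth[OF i2] by blast
  moreover have "opp M (fown (F ! i)) \<in> orbit (rot M) (opp M (fst (F ! Suc i)))"
    using link_orbit[OF i] opp_own[OF i] own_opp[OF i2] by simp
  ultimately have "fown (F ! i) = fst (F ! Suc i)"
    using matching_black_unique own Y unfolding root_matching_def by blast
  then show False using own_not_visited[OF i] fst_visited nth_mem[OF i] by metis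
qed

text \<open>The edges of the stack lead to the root: from a white node by an uncut edge outside
  \<open>Y\<close>, from a black node by its forced edge. The relation \<open>R\<close> is left
  open, since the path is needed after a cut and after a reversal; in the latter case only the
  frames from \<open>k\<close> to the bottom are intact.\<close>

lemma stack_reach:
  assumes Y: "root_matching M (cut_darts M F) Y"
    and R: "\<And>z. z \<in> darts M \<Longrightarrow> (z, rot M z) \<in> R"
      "\<And>i. k \<le> i \<Longrightarrow> Suc i < length F \<Longrightarrow> fown (F ! i) \<in> white M - Y - cut_darts M F \<Longrightarrow> (fown (F ! i), fst (F ! i)) \<in> R"
      "\<And>i. k \<le> i \<Longrightarrow> Suc i < length F \<Longrightarrow> fst (F ! i) \<in> Y \<Longrightarrow> (fown (F ! i), fst (F ! i)) \<in> R"
    and k: "k < length F"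
  shows "(fown (F ! k), root_dart M) \<in> R\<^sup>*"
  using k R(2,3)
proof (induction "length F - k" arbitrary: k)
  case (Suc n)
  show ?case
  proof (cases "Suc k < length F")
    case True
    have IH: "(fown (F ! Suc k), root_dart M) \<in> R\<^sup>*" using Suc True by (intro Suc.hyps(1)) auto
    have "(fown (F ! k), fst (F ! k)) \<in> R"
    proof (cases "fown (F ! k) \<in> white M")
      case w: True
      then have "fown (F ! k) \<in> white M - Y - cut_darts M F"
        using own_not_matched[OF Y True w] own_not_cut[OF True] by simp
      then show ?thesis using Suc.prems(2)[OF _ True] by simp
    next
      case False
      then have "fst (F ! k) \<in> Y" using forced[OF Y, of "F ! k"] butlast_nth[OF True] own_color[OF True] by blast
      then show ?thesis using Suc.prems(3)[OF _ True] by simp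
    qed
    moreover have "(fst (F ! k), fown (F ! Suc k)) \<in> R\<^sup>*"
      using orbit_rtrancl[of R "fown (F ! Suc k)" "fst (F ! k)"] R(1) fst_darts[of k] Suc.prems(1)
        orbit_eq[OF link_orbit[OF True]] orbit_self by blast
    ultimately show ?thesis using IH by (meson converse_rtrancl_into_rtrancl rtrancl_trans)
  next
    case False
    then have "F ! k = last F" using Suc.prems(1) last_index by simp
    moreover have "root_dart M \<in> orbit (rot M) (root_leaf M)" by (simp add: root_leaf_def)
    ultimately show ?thesis using orbit_rtrancl[of R "root_dart M" "root_leaf M"] R(1) bottom by simp
  qed
qed simp

text \<open>Cutting an edge that \<open>Y\<close> avoids does not harm accessibility: the current
  vertex still reaches the root along the stack, which does not use this edge.\<close>

lemma matching_cut:
  assumes Y: "root_matching M (cut_darts M F) Y" and x: "next_x \<notin> fown ` set F" "next_x \<notin> Y"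
  shows "root_matching M (insert next_x (cut_darts M F)) Y"
proof -
  let ?K = "cut_darts M F" and ?x = next_x
  let ?R = "reach M Y ?K" and ?R' = "reach M Y (insert ?x ?K)"
  have rot': "(z, rot M z) \<in> ?R'" if "z \<in> darts M" for z using that by (auto simp: reach_def)
  have "(fown (F ! 0), root_dart M) \<in> ?R'\<^sup>*"
  proof (rule stack_reach[OF Y rot'])
    fix i assume i: "Suc i < length F" "fown (F ! i) \<in> white M - Y - ?K"
    have "fown (F ! i) \<noteq> ?x" using x(1) i(1) nth_mem by (metis Suc_lessD image_eqI)
    then show "(fown (F ! i), fst (F ! i)) \<in> ?R'" using i opp_own[OF i(1)] unfolding reach_def by force
  next
    fix i assume i: "Suc i < length F" "fst (F ! i) \<in> Y"
    then show "(fown (F ! i), fst (F ! i)) \<in> ?R'" using own_opp[OF i(1)] unfolding reach_def by blast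
  qed (use F_neq in auto)
  moreover have "(?x, fown (hd F)) \<in> ?R'\<^sup>*"
    using orbit_rtrancl[of ?R' "fown (hd F)" ?x] rot' next_darts orbit_eq[OF next_orbit] orbit_self by blast
  ultimately have "(?x, root_dart M) \<in> ?R'\<^sup>*" using F_neq by (simp add: hd_conv_nth)
  then show ?thesis using root_matching_insert[OF Y x(2)] by blast
qed

text \<open>
  An edge from the current black node back to an open white node would close a directed cycle
  through the stack. Reversing that cycle gives another matching, which avoids a tree edge that all
  matchings use.
\<close>

lemma no_back_edge:
  assumes x: "next_x \<notin> white M" "next_x \<notin> set (visited F)"
    and opp: "opp M next_x \<notin> cut_darts M F" "opp M next_x \<notin> set (visited F)"
    and k: "k < length F" "opp M next_x \<in> orbit (rot M) (fown (F ! k))"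
  shows False
proof -
  let ?x = next_x and ?y = "opp M next_x" and ?K = "cut_darts M F"
  obtain Y where Y: "root_matching M ?K Y" using ex_matching by blast
  have mY: "matching M Y" "Y \<inter> ?K = {}" "root_dart M \<in> Y" "Y \<subseteq> white M"
    using Y matchingD(1) unfolding root_matching_def by auto
  have F0: "hd F = F ! 0" "0 < length F" using F_neq by (auto simp: hd_conv_nth)
  have e0: "fown (F ! 0) \<notin> white M" using next_color x(1) F0 by simp
  have yw: "?y \<in> white M" "?y \<in> darts M" using x(1) next_darts opp_white by auto
  have oy: "opp M ?y = ?x" using opp_opp next_darts by blast
  have ek: "fown (F ! k) \<in> white M" using orbit_white[OF frame_darts[OF k(1)] k(2)] yw by simp
  have k0: "k > 0" using e0 ek by (cases k) auto
  have x0: "?x \<in> orbit (rot M) (fown (F ! 0))" using next_orbit F0 by simp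
  \<comment> \<open>Reversing the cycle through the frames \<open>0\<close> to \<open>k\<close> and
    the edge of \<open>next_x\<close> drops \<open>D\<close>, the stack edges from black nodes to
    white parents. It takes in \<open>C\<close>, the stack edges from white nodes to black parents
    together with the closing edge.\<close>
  define D where "D = {fst (F ! i) | i. i < k \<and> fst (F ! i) \<in> white M}"
  define C where "C = insert ?y {fown (F ! i) | i. i < k \<and> fown (F ! i) \<in> white M}"
  define Z where "Z = (Y - D) \<union> C"
  have D_Y: "fst (F ! i) \<in> Y" if "i < k" "fst (F ! i) \<in> white M" for i
    using forced[OF Y, of "F ! i"] butlast_nth[of i] that k(1) by simp
  have Cw: "C \<subseteq> white M" using yw by (auto simp: C_def)
  have d_orbit: "fst (F ! i) \<in> orbit (rot M) (fown (F ! Suc i))" if "i < k" for i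
    using link_orbit that k(1) by simp
  have mZ: "matching M Z"
    unfolding matching_def
  proof (intro conjI ballI)
    show "Z \<subseteq> white M" using mY(4) Cw by (auto simp: Z_def)
  next
    fix z assume z: "z \<in> white M"
    show "\<exists>!y. y \<in> Z \<and> y \<in> orbit (rot M) z"
    proof (cases "\<exists>j\<le>k. orbit (rot M) z = orbit (rot M) (fown (F ! j))")
      case True
      then obtain j where j: "j \<le> k" "orbit (rot M) z = orbit (rot M) (fown (F ! j))" by blast
      have jF: "j < length F" using j k by simp
      have "z \<in> orbit (rot M) (fown (F ! j))" using j(2) orbit_self[of z] by simp
      then have ejw: "fown (F ! j) \<in> white M" using orbit_white[OF frame_darts[OF jF]] z by blast
      then have "j \<noteq> 0" using e0 by metis
      then obtain l where l: "j = Suc l" using not0_implies_Suc by blast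
      have lk: "l < k" using j(1) l by simp
      have lo: "fst (F ! l) \<in> orbit (rot M) (fown (F ! j))" using d_orbit[OF lk] l by simp
      have dl: "fst (F ! l) \<in> white M" "l < k" "fst (F ! l) \<in> orbit (rot M) z"
        using orbit_white[OF frame_darts[OF jF] lo] ejw lk lo unfolding j(2) by blast+
      \<comment> \<open>A white node of the cycle gives up the edge to its child on the stack for
        the edge to its parent; frame \<open>k\<close> takes the closing edge instead.\<close>
      let ?c = "if j = k then ?y else fown (F ! j)"
      show ?thesis
      proof (rule ex1I[of _ ?c])
        show "?c \<in> Z \<and> ?c \<in> orbit (rot M) z" using j k ejw by (auto simp: Z_def C_def)
        fix y assume y: "y \<in> Z \<and> y \<in> orbit (rot M) z"
        have "y \<notin> Y - D"
        proof
          assume yY: "y \<in> Y - D"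
          have "y \<in> orbit (rot M) (fst (F ! l))" using y orbit_eq[OF dl(3)] by simp
          then have "y = fst (F ! l)" using matching_white_unique[OF mY(1) D_Y[OF dl(2,1)]] yY by blast
          then show False using yY dl by (auto simp: D_def)
        qed
        then have "y \<in> C" using y unfolding Z_def by blast
        then consider "y = ?y" | i where "i < k" "y = fown (F ! i)" by (auto simp: C_def)
        then show "y = ?c"
        proof cases
          case 1
          then have "k = j" using frame_index_orbit[OF k(1) jF k(2)] y j(2) by simp
          then show ?thesis using 1 by simp
        next
          case 2
          then have "i = j" using frame_index[of i j] y j(2) jF k(1) by simp
          then show ?thesis using 2 by simp
        qed
      qed
    next
      case False
      have "y \<in> Z \<longleftrightarrow> y \<in> Y" if y: "y \<in> orbit (rot M) z" for y
      proof -
        have *: "y \<notin> orbit (rot M) (fown (F ! j))" if "j \<le> k" for j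
          using False that orbit_eq[OF y] orbit_eq[of y "fown (F ! j)"] by metis
        have "y \<notin> D" using d_orbit * by (fastforce simp: D_def)
        moreover have "y \<notin> C"
        proof
          assume "y \<in> C"
          then consider "y = ?y" | i where "i < k" "y = fown (F ! i)" by (auto simp: C_def)
          then show False
          proof cases
            case 1
            then show False using k(2) *[of k] by simp
          next
            case 2
            then show False using *[of i] by simp
          qed
        qed
        ultimately show ?thesis by (simp add: Z_def)
      qed
      then show ?thesis using matchingD(2)[OF mY(1) z] by (metis (no_types))
    qed
  next
    fix z assume z: "z \<in> darts M - white M"
    show "\<exists>!y. y \<in> Z \<and> opp M y \<in> orbit (rot M) z"
    proof (cases "\<exists>j\<le>k. orbit (rot M) z = orbit (rot M) (fown (F ! j))")
      case True
      then obtain j where j: "j \<le> k" "orbit (rot M) z = orbit (rot M) (fown (F ! j))" by blast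
      have jF: "j < length F" using j k by simp
      have "z \<in> orbit (rot M) (fown (F ! j))" using j(2) orbit_self[of z] by simp
      then have ejb: "fown (F ! j) \<notin> white M" using orbit_white[OF frame_darts[OF jF]] z by blast
      then have jk: "j < k" using ek j(1) by (metis le_neq_implies_less)
      then have SjF: "Suc j < length F" using k(1) by simp
      have djw: "fst (F ! j) \<in> white M" using own_color[OF SjF] ejb by simp
      \<comment> \<open>A black node gives up the edge to its parent for the edge to its child on
        the stack; the innermost node has no such child and takes the closing edge.\<close>
      let ?c = "if j = 0 then ?y else fown (F ! (j - 1))"
      show ?thesis
      proof (rule ex1I[of _ ?c])
        show "?c \<in> Z \<and> opp M ?c \<in> orbit (rot M) z"
        proof (cases j)
          case 0
          then show ?thesis using x0 j oy by (simp add: Z_def C_def)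
        next
          case (Suc l)
          then have "fown (F ! l) \<in> white M" "l < k" "Suc l < length F" using color_alternates[of l] jF ejb jk by auto
          then show ?thesis using Suc link_orbit[of l] opp_own[of l] j by (auto simp: Z_def C_def)
        qed
        fix y assume y: "y \<in> Z \<and> opp M y \<in> orbit (rot M) z"
        have "y \<notin> Y - D"
        proof
          assume yY: "y \<in> Y - D"
          have "opp M y \<in> orbit (rot M) (opp M (fst (F ! j)))" using y j own_opp[OF SjF] by simp
          then have "y = fst (F ! j)" using matching_black_unique[OF mY(1) D_Y[OF jk djw]] yY by blast
          then show False using yY djw jk by (auto simp: D_def)
        qed
        then have "y \<in> C" using y unfolding Z_def by blast
        then consider "y = ?y" | i where "i < k" "y = fown (F ! i)" by (auto simp: C_def)
        then show "y = ?c"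
        proof cases
          case 1
          then have "j = 0" using frame_index_orbit[OF jF F0(2) _ x0] y j(2) oy by simp
          then show ?thesis using 1 by simp
        next
          case 2
          then have i: "Suc i < length F" using k(1) by simp
          then have "Suc i = j" using frame_index_orbit[OF i jF link_orbit[OF i]] y j(2) opp_own[OF i] 2 by simp
          then show ?thesis using 2 by auto
        qed
      qed
    next
      case False
      have "y \<in> Z \<longleftrightarrow> y \<in> Y" if y: "opp M y \<in> orbit (rot M) z" for y
      proof -
        have *: "opp M y \<notin> orbit (rot M) (fown (F ! j))" if "j \<le> k" for j
          using False that orbit_eq[OF y] orbit_eq[of "opp M y" "fown (F ! j)"] by metis
        have "y \<notin> D"
        proof
          assume "y \<in> D"
          then obtain i where i: "i < k" "y = fst (F ! i)" by (auto simp: D_def)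
          then have "opp M y = fown (F ! i)" using own_opp[of i] k(1) by simp
          then show False using *[of i] i by simp
        qed
        moreover have "y \<notin> C"
        proof
          assume "y \<in> C"
          then consider "y = ?y" | i where "i < k" "y = fown (F ! i)" by (auto simp: C_def)
          then show False
          proof cases
            case 1
            then show False using *[of 0] x0 oy by simp
          next
            case 2
            then have "opp M y = fst (F ! i)" using opp_own[of i] k(1) by simp
            then show False using *[of "Suc i"] d_orbit[of i] 2 by simp
          qed
        qed
        ultimately show ?thesis by (simp add: Z_def)
      qed
      then show ?thesis using matchingD(3)[OF mY(1), of z] z by (metis (no_types) DiffD1 DiffD2)
    qed
  qed
  have ZK: "Z \<inter> ?K = {}"
  proof -
    have "fown (F ! i) \<notin> ?K" if "i < k" for i using own_not_cut[of i] that k(1) by simp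
    then have "C \<inter> ?K = {}" using opp(1) by (auto simp: C_def)
    then show ?thesis using mY(2) by (auto simp: Z_def)
  qed
  \<comment> \<open>The root edge could be dropped only if the stack had left the root by
    \<open>root_dart M\<close>, the last dart around it. Then \<open>k\<close> is the bottom frame
    and every dart of the root vertex has been visited, so \<open>opp M next_x\<close> cannot be one
    of them.\<close>
  have rootZ: "root_dart M \<in> Z"
  proof -
    have "root_dart M \<notin> D"
    proof
      assume "root_dart M \<in> D"
      then obtain i where i: "i < k" "root_dart M = fst (F ! i)" by (auto simp: D_def)
      have Si: "Suc i < length F" using i k by simp
      let ?l = "length F - 1"
      have l: "?l < length F" "F ! ?l = last F" using F_neq by (auto simp: last_conv_nth)
      have "root_dart M \<in> orbit (rot M) (fown (F ! ?l))" using l bottom by (simp add: root_leaf_def)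
      then have Sil: "Suc i = ?l"
        using frame_index_orbit[OF Si l(1)] link_orbit[OF Si] i(2) by simp
      then have "k = ?l" using i k(1) by simp
      let ?f = "last F"
      have fin: "?f \<in> set F" using F_neq by simp
      have r: "rot M (last (fdarts ?f)) = root_dart M" using link[OF Si] i(2) Sil l(2) by simp
      have "map (rot M) (fown ?f # map pdart (fsubs ?f) @ [root_dart M]) = (map pdart (fsubs ?f) @ [root_dart M]) @ [fown ?f]"
      proof -
        have "map (rot M) (butlast (fdarts ?f) @ [last (fdarts ?f)]) = map pdart (fsubs ?f) @ [root_dart M]"
          using chain[OF fin] r by simp
        then have "map (rot M) (fdarts ?f) = map pdart (fsubs ?f) @ [root_dart M]"
          by (metis append_butlast_last_id list.distinct(1))
        then show ?thesis using bottom(2) by (simp add: root_leaf_def)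
      qed
      from orbit_chain[OF this] have "orbit (rot M) (fown ?f) = insert (fown ?f) (set (map pdart (fsubs ?f) @ [root_dart M]))" .
      moreover have "?y \<in> orbit (rot M) (fown ?f)" using k(2) \<open>k = ?l\<close> l(2) by simp
      ultimately consider "?y = fown ?f" | "?y \<in> pdart ` set (fsubs ?f)" | "?y = root_dart M" by auto
      then show False
      proof cases
        case 1
        then show False using opp(2) fst_visited[OF fin] bottom by simp
      next
        case 2
        then have "?y \<in> set (forest_tour (fsubs ?f))" unfolding set_forest_tour_nodes by blast
        then show False using opp(2) body_visited[OF fin] by blast
      next
        case 3
        then show False using opp(2) fst_visited[of "F ! i"] i(2) Si by (metis Suc_lessD nth_mem)
      qed
    qed
    then show ?thesis using mY(3) by (simp add: Z_def)
  qed
  have "(z, root_dart M) \<in> (reach M Z ?K)\<^sup>*" if "z \<in> darts M" for z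
  proof -
    let ?R = "reach M Y ?K" and ?S = "reach M Z ?K"
    have rotS: "(z, rot M z) \<in> ?S" if "z \<in> darts M" for z using that by (auto simp: reach_def)
    have D_vis: "d \<in> set (visited F)" if d: "d \<in> D" for d
    proof -
      obtain i where "i < k" "d = fst (F ! i)" using d by (auto simp: D_def)
      then show ?thesis using fst_visited[of "F ! i" F] k(1) by simp
    qed
    have C_vis: "c \<notin> set (visited F)" if "c \<in> C" for c
      using that own_not_visited k(1) opp(2) by (auto simp: C_def)
    have DZ: "d \<notin> Z" if "d \<in> D" for d using that D_vis C_vis by (auto simp: Z_def)
    have within: "(u, v) \<in> ?S\<^sup>*" if "u \<in> orbit (rot M) (fown (F ! i))" "v \<in> orbit (rot M) (fown (F ! i))" "i < length F" for u v i
      using orbit_rtrancl[of ?S v u] rotS that orbit_darts[OF frame_darts[OF that(3)]] orbit_eq[OF that(1)]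
      by blast
    have wk: "(fown (F ! k), root_dart M) \<in> ?S\<^sup>*"
    proof (rule stack_reach[OF Y rotS _ _ k(1)])
      fix i assume i: "k \<le> i" "Suc i < length F" "fown (F ! i) \<in> white M - Y - ?K"
      have "fown (F ! i) \<notin> C"
      proof
        assume "fown (F ! i) \<in> C"
        then consider "fown (F ! i) = ?y" | l where "l < k" "fown (F ! i) = fown (F ! l)" by (auto simp: C_def)
        then show False
        proof cases
          case 1
          then have "?x = fst (F ! i)" using opp_own[OF i(2)] oy by simp
          then show False using x(2) fst_visited[of "F ! i" F] i(2) by simp
        next
          case 2
          then show False using frame_index[of i l] i k(1) by simp
        qed
      qed
      then show "(fown (F ! i), fst (F ! i)) \<in> ?S" using i opp_own[OF i(2)] by (force simp: reach_def Z_def)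
    next
      fix i assume i: "k \<le> i" "Suc i < length F" "fst (F ! i) \<in> Y"
      have "fst (F ! i) \<notin> D"
      proof
        assume "fst (F ! i) \<in> D"
        then obtain l where l: "l < k" "fst (F ! i) = fst (F ! l)" by (auto simp: D_def)
        then have "Suc i = Suc l" using frame_index_orbit[of "Suc i" "Suc l"] link_orbit[OF i(2)] d_orbit[OF l(1)] i(2) k(1) by simp
        then show False using l i by simp
      qed
      then have "fst (F ! i) \<in> Z" using i by (simp add: Z_def)
      then show "(fown (F ! i), fst (F ! i)) \<in> ?S" using own_opp[OF i(2)] by (auto simp: reach_def)
    qed
    \<comment> \<open>The reversed cycle leads from each frame inwards to frame \<open>0\<close> and
      across the closing edge to frame \<open>k\<close>; from there the untouched part of the stack
      leads to the root.\<close>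
    have stack: "(fown (F ! j), root_dart M) \<in> ?S\<^sup>*" if "j \<le> k" for j
      using that
    proof (induction j)
      case 0
      have "?y \<in> Z" by (simp add: Z_def C_def)
      then have "(?x, ?y) \<in> ?S" using oy by (auto simp: reach_def)
      moreover have "(fown (F ! 0), ?x) \<in> ?S\<^sup>*" using within[OF _ x0 F0(2)] by simp
      moreover have "(?y, fown (F ! k)) \<in> ?S\<^sup>*" using within[OF k(2) _ k(1)] by simp
      ultimately show ?case using wk by (meson converse_rtrancl_into_rtrancl rtrancl_trans)
    next
      case (Suc j)
      then have j: "j < k" "Suc j < length F" using k(1) by auto
      have "(fst (F ! j), fown (F ! j)) \<in> ?S"
      proof (cases "fst (F ! j) \<in> white M")
        case True
        then have "fst (F ! j) \<in> D" using j by (auto simp: D_def)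
        then have "fst (F ! j) \<notin> Z" using DZ by blast
        moreover have "fst (F ! j) \<notin> ?K" using D_Y[OF j(1) True] mY(2) by blast
        ultimately show ?thesis using True own_opp[OF j(2)] by (auto simp: reach_def)
      next
        case False
        then have "fown (F ! j) \<in> Z" using own_color[OF j(2)] j(1) by (auto simp: Z_def C_def)
        then show ?thesis using opp_own[OF j(2)] by (force simp: reach_def)
      qed
      moreover have "(fown (F ! Suc j), fst (F ! j)) \<in> ?S\<^sup>*" using within[OF _ link_orbit[OF j(2)] j(2)] by simp
      ultimately show ?case using Suc by (meson converse_rtrancl_into_rtrancl rtrancl_trans Suc_leD)
    qed
    have near: "(u, root_dart M) \<in> ?S\<^sup>*" if "u \<in> orbit (rot M) (fown (F ! j))" "j \<le> k" for u j
    proof -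
      have "(u, fown (F ! j)) \<in> ?S\<^sup>*" using within[OF that(1)] that(2) k(1) by simp
      then show ?thesis using stack[OF that(2)] by simp
    qed
    have "(z, root_dart M) \<in> ?R\<^sup>*" using Y \<open>z \<in> darts M\<close> by (simp add: root_matching_def)
    then show "(z, root_dart M) \<in> ?S\<^sup>*"
    proof (induction rule: converse_rtrancl_induct)
      case (step u v)
      show ?case
      proof (cases "(u, v) \<in> ?S")
        case True
        then show ?thesis using step.IH by (rule converse_rtrancl_into_rtrancl)
      next
        case False
        then consider "u \<in> C" | d where "d \<in> D" "u = opp M d"
          using step.hyps(1) unfolding reach_def Z_def by blast
        then show ?thesis
        proof cases
          case 1
          then consider "u = ?y" | i where "i < k" "u = fown (F ! i)" by (auto simp: C_def)
          then show ?thesis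
          proof cases
            case 1
            then show ?thesis using near[OF _ le_refl] k(2) by simp
          next
            case 2
            then show ?thesis using near[of u i] by simp
          qed
        next
          case 2
          then obtain i where i: "i < k" "u = opp M (fst (F ! i))" by (auto simp: D_def)
          then have "u = fown (F ! i)" using own_opp[of i] k(1) by simp
          then show ?thesis using near[of u i] i by simp
        qed
      qed
    qed simp
  qed
  then have Zr: "root_matching M ?K Z" using mZ ZK rootZ by (simp add: root_matching_def)
  \<comment> \<open>\<open>Z\<close> has lost the edge above the current black node, which every
    remaining matching must contain. It was not taken back, since the darts of \<open>D\<close> are
    visited and those of \<open>C\<close> are not.\<close>
  have S0: "Suc 0 < length F" using k0 k(1) by simp
  have "fst (F ! 0) \<in> white M" using own_color[OF S0] e0 by simp
  then have "fst (F ! 0) \<in> Z" "fst (F ! 0) \<in> D"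
    using forced[OF Zr, of "F ! 0"] butlast_nth[OF S0] k0 by (auto simp: D_def)
  then have "fst (F ! 0) \<in> C" by (auto simp: Z_def)
  then have "fst (F ! 0) \<notin> set (visited F)"
    using own_not_visited k(1) opp(2) by (auto simp: C_def)
  then show False using fst_visited[of "F ! 0" F] F0 by simp
qed

end

lemma butlast_Cons_own: "n \<in> set (butlast ((d, e, us') # G)) \<Longrightarrow>
    \<exists>n'\<in>set (butlast ((d, e, us) # G)). fst n' = fst n \<and> fown n' = fown n"
  by (cases "G = []") auto

lemma map_own_butlast: "map fown (butlast ((d, e, us') # G)) = map fown (butlast ((d, e, us) # G))"
  by (cases "G = []") auto

text \<open>Cutting the root leaf at the start is harmless: its vertex is matched by
  \<open>root_dart M\<close>, a different dart by the last hypothesis, and rotation alone leads from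
  one to the other.\<close>

lemma (in bipartite_map) exploration_init:
  assumes "marks M \<subseteq> white M" "root_matching M (marks M) Y" "rot M (root_dart M) \<noteq> root_dart M"
  shows "exploration M [(root_leaf M, root_leaf M, [])]"
proof -
  let ?F = "[(root_leaf M, root_leaf M, [])] :: frame list"
  have cut: "cut_darts M ?F = insert (root_leaf M) (marks M)"
    by (auto simp: cut_darts_def visited_leaves_def)
  have "root_matching M (insert (root_leaf M) (marks M)) Y"
  proof (rule root_matching_insert[OF assms(2)])
    have "root_dart M \<in> orbit (rot M) (root_leaf M)" by (simp add: root_leaf_def)
    then show "(root_leaf M, root_dart M) \<in> (reach M Y (insert (root_leaf M) (marks M)))\<^sup>*"
      by (intro orbit_rtrancl) (auto simp: reach_def)
    have Y: "matching M Y" "root_dart M \<in> Y" using assms(2) by (auto simp: root_matching_def)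
    show "root_leaf M \<notin> Y"
    proof
      assume "root_leaf M \<in> Y"
      moreover have "root_leaf M \<in> orbit (rot M) (root_dart M)" by (simp add: root_leaf_def orbit.base)
      ultimately have "root_leaf M = root_dart M" using matching_white_unique[OF Y] by blast
      then show False using assms(3) by (simp add: root_leaf_def)
    qed
  qed
  then show ?thesis
    using assms(1)
    by unfold_locales (auto simp: cut, auto simp: closed_nodes_def visited_leaves_def)
qed

section \<open>The moves of the walk\<close>

context exploration
begin

lemma chain_next: "f \<in> set F \<Longrightarrow> map (rot M) (fdarts f) = map pdart (fsubs f) @ [rot M (last (fdarts f))]"
proof -
  assume f: "f \<in> set F"
  have "map (rot M) (butlast (fdarts f) @ [last (fdarts f)]) = map pdart (fsubs f) @ [rot M (last (fdarts f))]"
    using chain[OF f] by simp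
  then show ?thesis by (metis append_butlast_last_id list.distinct(1))
qed

text \<open>More cuts leave fewer matchings, so edges forced so far stay forced; only the existence
  of a matching has to be supplied.\<close>

lemma leaf_step:
  assumes F: "F = (d, e, us) # G" and x: "next_x \<noteq> e"
    and ex: "\<exists>Y. root_matching M (cut_darts M ((d, e, us @ [DLeaf next_x]) # G)) Y"
    and black: "next_x \<notin> white M \<Longrightarrow> opp M next_x \<in> marks M \<or> opp M next_x \<in> visited_leaves M F"
  shows "exploration M ((d, e, us @ [DLeaf next_x]) # G)"
proof -
  let ?F = "(d, e, us @ [DLeaf next_x]) # G"
  have hd: "hd F = (d, e, us)" using F by simp
  have new: "next_x \<notin> set (visited F)" "next_x \<notin> fown ` set F" using next_new x hd by auto
  have vis: "visited ?F = visited F @ [next_x]" by (simp add: F)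
  have own: "map fown (butlast ?F) = map fown (butlast F)" unfolding F by (rule map_own_butlast)
  have closed: "closed_nodes ?F = closed_nodes F" by (simp add: closed_nodes_def F)
  have leaves: "visited_leaves M ?F = insert next_x (visited_leaves M F)" by (auto simp: visited_leaves_def F)
  have cut: "cut_darts M F \<subseteq> cut_darts M ?F" by (auto simp: cut_darts_def leaves)
  have len: "length ?F = length F" by (simp add: F)
  have nth: "fst (?F ! i) = fst (F ! i)" "fown (?F ! i) = fown (F ! i)" "?F ! Suc i = F ! Suc i" for i
    by (cases i; simp add: F)+
  have bl: "\<exists>n'\<in>set (butlast F). fst n' = fst n \<and> fown n' = fown n" if "n \<in> set (butlast ?F)" for n
    using that unfolding F by (rule butlast_Cons_own)
  show ?thesis
  proof unfold_locales
    show "marks M \<subseteq> white M" by (rule marks_white)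
    show "?F \<noteq> []" by simp
    show "fst (last ?F) = root_leaf M" "fown (last ?F) = root_leaf M"
      using bottom by (auto simp: F split: if_splits)
    show "fst (?F ! i) = rot M (last (fdarts (?F ! Suc i)))" if "Suc i < length ?F" for i
      unfolding nth by (rule link) (use that len in simp)
    show "fown (?F ! i) = opp M (fst (?F ! i))" if "Suc i < length ?F" for i
      unfolding nth by (rule own_opp) (use that len in simp)
    show "map (rot M) (butlast (fdarts f)) = map pdart (fsubs f)" if f: "f \<in> set ?F" for f
    proof (cases "f \<in> set F")
      case False
      then have fe: "f = (d, e, us @ [DLeaf next_x])" using f by (auto simp: F)
      have bl: "butlast (fdarts f) = fdarts (d, e, us)" unfolding fe by (simp add: butlast_append)
      have "rot M (last (fdarts (d, e, us))) = next_x" unfolding next_x_def hd ..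
      then show ?thesis unfolding bl using chain_next[of "(d, e, us)"] F by (simp add: fe)
    qed (rule chain)
    show "fown n = opp M (fst n)" if "n \<in> closed_nodes ?F" for n
      using closed_opp that unfolding closed by blast
    show "map (rot M) (fdarts n) = map pdart (fsubs n) @ [fown n]" if "n \<in> closed_nodes ?F" for n
      using closed_chain that unfolding closed by blast
    have "next_x \<notin> set (map fown (butlast F))" using new(2) by (auto dest: in_set_butlastD)
    then show "distinct (visited ?F @ map fown (butlast ?F))"
      unfolding vis own using distinct_visited new by auto
    show "set (visited ?F) \<subseteq> darts M" unfolding vis using visited_darts next_darts by simp
    show "fown f \<in> darts M" if f: "f \<in> set ?F" for f
    proof -
      have "fown f \<in> fown ` set F" using f unfolding F by auto
      then obtain g where g: "g \<in> set F" "fown f = fown g" by blast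
      show ?thesis unfolding g(2) by (rule own_darts[OF g(1)])
    qed
    show "distinct (map (\<lambda>f. orbit (rot M) (fown f)) ?F)" using distinct_orbits unfolding F by simp
    show "\<exists>Y. root_matching M (cut_darts M ?F) Y" by (rule ex)
    show "fst n \<in> Y" if Y: "root_matching M (cut_darts M ?F) Y" and n: "n \<in> closed_nodes ?F \<union> set (butlast ?F)" "fst n \<in> white M" for Y n
    proof -
      have "\<exists>n'\<in>closed_nodes F \<union> set (butlast F). fst n' = fst n" using n bl unfolding closed by blast
      then show ?thesis using forced[OF root_matching_mono[OF Y cut]] n(2) by metis
    qed
    show "opp M z \<in> marks M \<or> opp M z \<in> visited_leaves M ?F \<and> before (visited ?F) (opp M z) z"
      if z: "z \<in> visited_leaves M ?F" "z \<notin> white M" for z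
    proof (cases "z = next_x")
      case True
      then have "opp M z \<in> marks M \<or> opp M z \<in> visited_leaves M F" using black z by blast
      moreover have "before (visited ?F) y next_x" if "y \<in> visited_leaves M F" for y
        unfolding vis before_def using that leaves_visited by (intro exI[of _ "visited F"] exI[of _ "[next_x]"]) auto
      ultimately show ?thesis using True leaves by auto
    next
      case False
      then show ?thesis using black_leaf[of z] z before_append[of "visited F" _ _ "[next_x]"] unfolding leaves vis by auto
    qed
    show "fst n \<notin> marks M \<and> fown n \<notin> marks M" if n: "n \<in> closed_nodes ?F \<union> set (butlast ?F)" for n
    proof -
      have "\<exists>n'\<in>closed_nodes F \<union> set (butlast F). fst n' = fst n \<and> fown n' = fown n" using n bl unfolding closed by blast
      then show ?thesis using unmarked by metis
    qed
  qed
qed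

text \<open>The cuts do not change. What has to be supplied is that the vertex ahead was never met
  and, for an edge leaving a white vertex, that all remaining matchings contain it.\<close>

lemma push_step:
  assumes x: "next_x \<noteq> fown (hd F)"
    and free: "\<And>n. n \<in> closed_nodes F \<union> set F \<Longrightarrow> opp M next_x \<notin> orbit (rot M) (fown n)"
    and um: "next_x \<notin> marks M" "opp M next_x \<notin> marks M"
    and must: "\<And>Y. root_matching M (cut_darts M F) Y \<Longrightarrow> next_x \<in> white M \<Longrightarrow> next_x \<in> Y"
  shows "exploration M ((next_x, opp M next_x, []) # F)"
proof -
  let ?f = "(next_x, opp M next_x, []) :: frame"
  let ?F = "?f # F"
  have new: "next_x \<notin> set (visited F)" "next_x \<notin> fown ` set F" using next_new x by auto
  have new': "opp M next_x \<notin> set (visited F)" "opp M next_x \<notin> fown ` set F" using not_touched[OF free] by auto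
  have vis: "visited ?F = visited F @ [next_x]" by simp
  have closed: "closed_nodes ?F = closed_nodes F" by (simp add: closed_nodes_def)
  have leaves: "visited_leaves M ?F = visited_leaves M F" by (simp add: visited_leaves_def)
  have cut: "cut_darts M ?F = cut_darts M F" by (simp add: cut_darts_def leaves)
  have bl: "butlast ?F = ?f # butlast F" using F_neq by simp
  show ?thesis
  proof unfold_locales
    show "marks M \<subseteq> white M" by (rule marks_white)
    show "?F \<noteq> []" by simp
    show "fst (last ?F) = root_leaf M" "fown (last ?F) = root_leaf M" using bottom F_neq by simp_all
    show "fst (?F ! i) = rot M (last (fdarts (?F ! Suc i)))" if "Suc i < length ?F" for i
    proof (cases i)
      case 0
      have "fst (?F ! i) = next_x" "?F ! Suc i = hd F" using 0 F_neq by (simp_all add: hd_conv_nth)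
      then show ?thesis by (simp only: next_x_def)
    next
      case (Suc j)
      then have "?F ! i = F ! j" "?F ! Suc i = F ! Suc j" "Suc j < length F" using that by auto
      then show ?thesis using link by simp
    qed
    show "fown (?F ! i) = opp M (fst (?F ! i))" if "Suc i < length ?F" for i
      using that own_opp by (cases i) auto
    show "map (rot M) (butlast (fdarts f)) = map pdart (fsubs f)" if "f \<in> set ?F" for f
    proof (cases "f = ?f")
      case False
      show ?thesis by (rule chain) (use that False in simp)
    qed simp
    show "fown n = opp M (fst n)" if "n \<in> closed_nodes ?F" for n
      using closed_opp that unfolding closed by blast
    show "map (rot M) (fdarts n) = map pdart (fsubs n) @ [fown n]" if "n \<in> closed_nodes ?F" for n
      using closed_chain that unfolding closed by blast
    have "next_x \<notin> set (map fown (butlast F))" "opp M next_x \<notin> set (map fown (butlast F))"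
      using new(2) new'(2) by (auto dest: in_set_butlastD)
    then show "distinct (visited ?F @ map fown (butlast ?F))"
      unfolding vis bl using distinct_visited new new' opp_neq[OF next_darts] by auto
    show "set (visited ?F) \<subseteq> darts M" unfolding vis using visited_darts next_darts by simp
    show "fown f \<in> darts M" if "f \<in> set ?F" for f
      using own_darts[of f] next_darts that by (cases "f = ?f") simp_all
    have "orbit (rot M) (opp M next_x) \<noteq> orbit (rot M) (fown f)" if "f \<in> set F" for f
      using free[of f] that orbit_self[of "opp M next_x"] by auto
    then show "distinct (map (\<lambda>f. orbit (rot M) (fown f)) ?F)" using distinct_orbits by auto
    show "\<exists>Y. root_matching M (cut_darts M ?F) Y" unfolding cut by (rule ex_matching)
    show "fst n \<in> Y" if Y: "root_matching M (cut_darts M ?F) Y" and n: "n \<in> closed_nodes ?F \<union> set (butlast ?F)" "fst n \<in> white M" for Y n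
    proof (cases "n = ?f")
      case True
      then show ?thesis using must Y n unfolding cut by simp
    next
      case False
      then have "n \<in> closed_nodes F \<union> set (butlast F)" using n(1) unfolding closed bl by auto
      then show ?thesis using forced[OF Y[unfolded cut]] n(2) by blast
    qed
    show "opp M z \<in> marks M \<or> opp M z \<in> visited_leaves M ?F \<and> before (visited ?F) (opp M z) z"
      if z: "z \<in> visited_leaves M ?F" "z \<notin> white M" for z
      using black_leaf[of z] z before_append[of "visited F" _ _ "[next_x]"] unfolding leaves vis by auto
    show "fst n \<notin> marks M \<and> fown n \<notin> marks M" if n: "n \<in> closed_nodes ?F \<union> set (butlast ?F)" for n
    proof (cases "n = ?f")
      case False
      then have "n \<in> closed_nodes F \<union> set (butlast F)" using n unfolding closed bl by auto
      then show ?thesis by (rule unmarked)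
    qed (use um in simp)
  qed
qed

text \<open>The turn around the node is complete, so its open chain of darts closes up to the cyclic
  one required of a finished node.\<close>

lemma pop_step:
  assumes F: "F = (d, e, us) # (d', e', us') # G" and x: "next_x = e"
  shows "exploration M ((d', e', us' @ [DNode d e us]) # G)"
proof -
  let ?F = "(d', e', us' @ [DNode d e us]) # G" and ?F1 = "(d', e', us') # G"
  have hd: "hd F = (d, e, us)" using F by simp
  have vis: "visited ?F = visited F @ [e]" by (simp add: F)
  have own: "map fown (butlast F) = e # map fown (butlast ?F)"
    using map_own_butlast[of d' e' us' G "us' @ [DNode d e us]"] by (simp add: F)
  have closed: "closed_nodes ?F = insert (d, e, us) (closed_nodes F)" by (auto simp: closed_nodes_def F)
  have leaves: "visited_leaves M ?F = visited_leaves M F" by (auto simp: visited_leaves_def F)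
  have cut: "cut_darts M ?F = cut_darts M F" by (simp add: cut_darts_def leaves)
  have len: "length F = Suc (length ?F)" by (simp add: F)
  have nth: "fst (?F ! i) = fst (F ! Suc i)" "fown (?F ! i) = fown (F ! Suc i)" "?F ! Suc i = F ! Suc (Suc i)" for i
    by (cases i; simp add: F)+
  have bl: "\<exists>n'\<in>set (butlast F). fst n' = fst n \<and> fown n' = fown n" if "n \<in> set (butlast ?F)" for n
    using butlast_Cons_own[OF that, of us'] unfolding F by auto
  have d: "(d, e, us) \<in> set (butlast F)" by (simp add: F)
  show ?thesis
  proof unfold_locales
    show "marks M \<subseteq> white M" by (rule marks_white)
    show "?F \<noteq> []" by simp
    show "fst (last ?F) = root_leaf M" "fown (last ?F) = root_leaf M"
      using bottom by (auto simp: F split: if_splits)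
    show "fst (?F ! i) = rot M (last (fdarts (?F ! Suc i)))" if "Suc i < length ?F" for i
      unfolding nth by (rule link) (use that len in simp)
    show "fown (?F ! i) = opp M (fst (?F ! i))" if "Suc i < length ?F" for i
      unfolding nth by (rule own_opp) (use that len in simp)
    show "map (rot M) (butlast (fdarts f)) = map pdart (fsubs f)" if f: "f \<in> set ?F" for f
    proof (cases "f \<in> set F")
      case False
      then have fe: "f = (d', e', us' @ [DNode d e us])" using f by (auto simp: F)
      have bl: "butlast (fdarts f) = fdarts (d', e', us')" unfolding fe by (simp add: butlast_append)
      have "fst (F ! 0) = rot M (last (fdarts (F ! Suc 0)))" by (rule link) (simp add: F)
      then have "rot M (last (fdarts (d', e', us'))) = d" by (simp only: F nth_Cons_0 nth_Cons_Suc fst_conv)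
      then show ?thesis unfolding bl using chain_next[of "(d', e', us')"] F by (simp add: fe)
    qed (rule chain)
    show "fown n = opp M (fst n)" if n: "n \<in> closed_nodes ?F" for n
    proof (cases "n = (d, e, us)")
      case True
      then show ?thesis using own_opp[of 0] by (simp add: F)
    qed (use n closed_opp in \<open>auto simp: closed\<close>)
    show "map (rot M) (fdarts n) = map pdart (fsubs n) @ [fown n]" if n: "n \<in> closed_nodes ?F" for n
    proof (cases "n = (d, e, us)")
      case True
      then show ?thesis using chain_next[of n] x unfolding next_x_def hd by (simp add: F)
    qed (use n closed_chain in \<open>auto simp: closed\<close>)
    show "distinct (visited ?F @ map fown (butlast ?F))"
      using distinct_visited unfolding vis own by auto
    have "e \<in> darts M" using next_darts x by simp
    then show "set (visited ?F) \<subseteq> darts M" unfolding vis using visited_darts by simp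
    show "fown f \<in> darts M" if f: "f \<in> set ?F" for f
    proof -
      have "fown f \<in> fown ` set F" using f unfolding F by auto
      then obtain g where g: "g \<in> set F" "fown f = fown g" by blast
      show ?thesis unfolding g(2) by (rule own_darts[OF g(1)])
    qed
    show "distinct (map (\<lambda>f. orbit (rot M) (fown f)) ?F)" using distinct_orbits unfolding F by simp
    show "\<exists>Y. root_matching M (cut_darts M ?F) Y" unfolding cut by (rule ex_matching)
    show "fst n \<in> Y" if Y: "root_matching M (cut_darts M ?F) Y" and n: "n \<in> closed_nodes ?F \<union> set (butlast ?F)" "fst n \<in> white M" for Y n
    proof -
      have "\<exists>n'\<in>closed_nodes F \<union> set (butlast F). fst n' = fst n" using n bl d unfolding closed by blast
      then show ?thesis using forced[OF Y[unfolded cut]] n(2) by metis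
    qed
    show "opp M z \<in> marks M \<or> opp M z \<in> visited_leaves M ?F \<and> before (visited ?F) (opp M z) z"
      if z: "z \<in> visited_leaves M ?F" "z \<notin> white M" for z
      using black_leaf[of z] z before_append[of "visited F" _ _ "[e]"] unfolding leaves vis by auto
    show "fst n \<notin> marks M \<and> fown n \<notin> marks M" if n: "n \<in> closed_nodes ?F \<union> set (butlast ?F)" for n
    proof -
      have "\<exists>n'\<in>closed_nodes F \<union> set (butlast F). fst n' = fst n \<and> fown n' = fown n" using n bl d unfolding closed by blast
      then show ?thesis using unmarked by metis
    qed
  qed
qed

lemma visited_edge_cases:
  assumes "z \<in> set (visited F)"
  shows "z \<in> visited_leaves M F \<or> (\<exists>n\<in>closed_nodes F. z = fst n \<or> z = fown n) \<or> (\<exists>i. Suc i < length F \<and> z = fst (F ! i))"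
proof -
  have "(\<exists>f\<in>set G. z \<in> set (forest_tour (fsubs f)) \<or> z = fst f)" if "z \<in> set (visited G)" for G
    using that by (induction G) auto
  then obtain f where f: "f \<in> set F" "z \<in> set (forest_tour (fsubs f)) \<or> z = fst f" using assms by blast
  show ?thesis
    using f(2)
  proof
    assume "z \<in> set (forest_tour (fsubs f))"
    then consider "z \<in> set (forest_leaf_darts (fsubs f))" | "z \<in> set (forest_edge_darts (fsubs f))"
      unfolding set_forest_tour by blast
    then show ?thesis
    proof cases
      case 1
      then show ?thesis using f(1) unfolding visited_leaves_def by blast
    next
      case 2
      then obtain n where "n \<in> forest_nodes (fsubs f)" "z = fst n \<or> z = fown n" by (force simp: set_edge_darts)
      then show ?thesis using f(1) unfolding closed_nodes_def by blast
    qed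
  next
    assume z: "z = fst f"
    obtain i where i: "i < length F" "f = F ! i" using f by (auto simp: in_set_conv_nth)
    show ?thesis
    proof (cases "Suc i < length F")
      case False
      then have "z = root_leaf M" using last_index i bottom z by simp
      then show ?thesis by (simp add: visited_leaves_def)
    qed (use z i in blast)
  qed
qed

text \<open>The point is that a traversed edge leads to a new vertex. From a white vertex this holds
  because every black vertex met so far is already matched by a forced edge; from a black vertex the
  open nodes are excluded by \<open>no_back_edge\<close>.\<close>

lemma progress:
  assumes nfin: "\<not> (next_x = fown (hd F) \<and> tl F = [])"
  shows "\<exists>F'. exploration M F' \<and> length (visited F') > length (visited F)"
proof (cases "next_x = fown (hd F)")
  case True
  then have "tl F \<noteq> []" using nfin by blast
  \<comment> \<open>\<open>remdups_adj.cases\<close> serves to split lists into empty, singleton and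
    longer ones.\<close>
  then obtain d e us d' e' us' G where F: "F = (d, e, us) # (d', e', us') # G"
    by (cases F rule: remdups_adj.cases) auto
  have "exploration M ((d', e', us' @ [DNode d e us]) # G)"
    by (rule pop_step[OF F]) (use True F in simp)
  moreover have "length (visited ((d', e', us' @ [DNode d e us]) # G)) > length (visited F)" by (simp add: F)
  ultimately show ?thesis by blast
next
  case False
  obtain d e us G where F: "F = (d, e, us) # G" using F_neq by (cases F) auto
  have xe: "next_x \<noteq> e" using False F by simp
  have new: "next_x \<notin> set (visited F)" "next_x \<notin> fown ` set F" using next_new[OF False] by auto
  let ?L = "(d, e, us @ [DLeaf next_x]) # G" and ?P = "(next_x, opp M next_x, []) # F"
  have len: "length (visited ?L) > length (visited F)" "length (visited ?P) > length (visited F)" by (simp_all add: F)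
  have leaves: "visited_leaves M ?L = insert next_x (visited_leaves M F)" by (auto simp: visited_leaves_def F)
  have leaf: ?thesis if "\<exists>Y. root_matching M (cut_darts M ?L) Y"
    "next_x \<notin> white M \<Longrightarrow> opp M next_x \<in> marks M \<or> opp M next_x \<in> visited_leaves M F"
    using leaf_step[OF F xe that] len by blast
  show ?thesis
  proof (cases "next_x \<in> white M")
    case w: True
    then have ob: "opp M next_x \<in> darts M" "opp M next_x \<notin> white M" using next_darts opp_white by auto
    then have om: "opp M next_x \<notin> marks M" using marks_white by blast
    show ?thesis
    proof (cases "next_x \<in> marks M \<or> (\<exists>Y. root_matching M (insert next_x (cut_darts M F)) Y)")
      case True
      have "\<exists>Y. root_matching M (cut_darts M ?L) Y"
      proof (cases "next_x \<in> marks M")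
        case True
        then have "cut_darts M ?L = cut_darts M F" by (auto simp: cut_darts_def leaves)
        then show ?thesis using ex_matching by simp
      next
        case False
        moreover have "cut_darts M ?L = insert next_x (cut_darts M F)" using w by (auto simp: cut_darts_def leaves)
        ultimately show ?thesis using True by simp
      qed
      then show ?thesis by (rule leaf) (use w in simp)
    next
      case cut: False
      have must: "next_x \<in> Y" if "root_matching M (cut_darts M F) Y" for Y
        using matching_cut[OF that new(2)] cut by blast
      have "exploration M ?P"
      proof (rule push_step[OF False _ _ om])
        show "next_x \<notin> marks M" using cut by blast
        show "next_x \<in> Y" if "root_matching M (cut_darts M F) Y" for Y by (rule must[OF that])
        fix n assume n: "n \<in> closed_nodes F \<union> set F"
        show "opp M next_x \<notin> orbit (rot M) (fown n)"
        proof
          assume o: "opp M next_x \<in> orbit (rot M) (fown n)"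
          have nd: "fown n \<in> darts M"
            using n own_darts closed_visited visited_darts by fastforce
          then have nb: "fown n \<notin> white M" using orbit_white[OF nd o] ob by simp
          \<comment> \<open>A black node is not the root, so the edge above it was traversed, and
            its upper dart is a visited white dart.\<close>
          have nn: "n \<in> closed_nodes F \<union> set (butlast F) \<and> fown n = opp M (fst n) \<and> fst n \<in> set (visited F)"
          proof (cases "n \<in> closed_nodes F")
            case True
            then show ?thesis using closed_opp closed_visited by blast
          next
            case False
            then obtain i where i: "i < length F" "n = F ! i" using n by (auto simp: in_set_conv_nth)
            have "Suc i < length F"
            proof (rule ccontr)
              assume "\<not> Suc i < length F"
              then have "n = last F" using i last_index by simp
              then show False using nb bottom by simp
            qed
            then show ?thesis using i own_opp butlast_nth fst_visited[of n F] by auto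
          qed
          then have "fst n \<in> darts M" using visited_darts by blast
          then have fw: "fst n \<in> white M" using nn nb opp_white by auto
          obtain Y where Y: "root_matching M (cut_darts M F) Y" using ex_matching by blast
          have "fst n \<in> Y" using forced[OF Y] nn fw by blast
          moreover have "opp M next_x \<in> orbit (rot M) (opp M (fst n))" using o nn by simp
          ultimately have "next_x = fst n"
            using matching_black_unique must[OF Y] Y unfolding root_matching_def by blast
          then show False using new nn by simp
        qed
      qed
      then show ?thesis using len by blast
    qed
  next
    case b: False
    then have ow: "opp M next_x \<in> white M" "opp M next_x \<in> darts M" using next_darts opp_white by auto
    have oo: "opp M (opp M next_x) = next_x" using opp_opp next_darts by blast
    show ?thesis
    proof (cases "opp M next_x \<in> marks M \<or> opp M next_x \<in> visited_leaves M F")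
      case True
      have "cut_darts M ?L = cut_darts M F" using b by (auto simp: cut_darts_def leaves)
      then show ?thesis using ex_matching True by (intro leaf) auto
    next
      case cut: False
      have onv: "opp M next_x \<notin> set (visited F)"
      proof
        assume "opp M next_x \<in> set (visited F)"
        then consider n where "n \<in> closed_nodes F" "opp M next_x = fst n \<or> opp M next_x = fown n"
          | i where "Suc i < length F" "opp M next_x = fst (F ! i)"
          using visited_edge_cases cut by blast
        then show False
        proof cases
          case 1
          have n: "fown n = opp M (fst n)" "fst n \<in> set (visited F)" "fown n \<in> set (visited F)"
            using closed_opp closed_visited 1(1) by auto
          have "opp M (fown n) = fst n" using n visited_darts opp_opp[of "fst n"] by auto
          then have "next_x = fown n \<or> next_x = fst n" using 1(2) n(1) oo by metis
          then show False using n new by auto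
        next
          case 2
          then have "next_x = fown (F ! i)" using own_opp oo by metis
          then show False using new(2) 2(1) nth_mem[of i F] by auto
        qed
      qed
      have nc: "opp M next_x \<notin> cut_darts M F" using cut by (simp add: cut_darts_def)
      have "exploration M ?P"
      proof (rule push_step[OF False])
        show "next_x \<notin> marks M" using b marks_white by blast
        show "opp M next_x \<notin> marks M" using cut by blast
        fix n assume n: "n \<in> closed_nodes F \<union> set F"
        show "opp M next_x \<notin> orbit (rot M) (fown n)"
        proof
          assume o: "opp M next_x \<in> orbit (rot M) (fown n)"
          show False
          \<comment> \<open>A closed vertex has visited darts only; an open one would close a
            directed cycle.\<close>
          proof (cases "n \<in> closed_nodes F")
            case True
            then show False using closed_orbit closed_visited o onv by blast
          next
            case False
            then obtain i where "i < length F" "n = F ! i" using n by (auto simp: in_set_conv_nth)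
            then show False using no_back_edge[OF b new(1) nc onv] o by blast
          qed
        qed
      qed (use b in simp)
      then show ?thesis using len by blast
    qed
  qed
qed

end

text \<open>Some matching \<open>Y\<close> has survived: cut white darts avoid it and traversed
  downward white darts lie in it. This gives the node children, while accessibility gives that all
  darts were visited.\<close>

lemma exploration_finished:
  assumes expl: "exploration M [f]" and fin: "exploration.next_x M [f] = fown f"
    and reg: "regular m M" and m: "m \<ge> 3"
  shows "opened_map M m (fsubs f)"
proof -
  interpret exploration M "[f]" by fact
  define ts where "ts = fsubs f"
  have f: "f = (root_leaf M, root_leaf M, ts)" using bottom by (cases f) (simp add: ts_def)
  have vis: "visited [f] = full_tour M ts" by (simp add: f full_tour_def)
  have leaves: "visited_leaves M [f] = set (full_leaves M ts)" by (simp add: f visited_leaves_def full_leaves_def)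
  have closed: "closed_nodes [f] = forest_nodes ts" by (simp add: f closed_nodes_def)
  have dist: "distinct (full_tour M ts)" using distinct_visited unfolding vis distinct_append by blast
  then have distf: "distinct (forest_tour ts)" by (simp add: full_tour_def)
  have chain_all: "map (rot M) (e # map pdart us) = map pdart us @ [e]" if n: "(d, e, us) \<in> all_nodes M ts" for d e us
  proof (cases "(d, e, us) = (root_leaf M, root_leaf M, ts)")
    case True
    have "rot M (last (fdarts f)) = root_leaf M"
      using fin bottom unfolding next_x_def by (simp only: list.sel last_ConsL)
    then have "map (rot M) (fdarts f) = map pdart (fsubs f) @ [root_leaf M]" using chain_next[of f] by simp
    then show ?thesis using True f by simp
  next
    case False
    then have "(d, e, us) \<in> closed_nodes [f]" using n unfolding closed all_nodes_def by blast
    then show ?thesis using closed_chain by fastforce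
  qed
  have orb: "orbit (rot M) e = insert e (pdart ` set us)" if "(d, e, us) \<in> all_nodes M ts" for d e us
    using orbit_chain[OF chain_all[OF that]] by simp
  have node_dist: "distinct (e # map pdart us)" if n: "(d, e, us) \<in> all_nodes M ts" for d e us
  proof (cases "(d, e, us) = (root_leaf M, root_leaf M, ts)")
    case True
    then show ?thesis using frame_distinct[of f] f by simp
  next
    case False
    then have "(d, e, us) \<in> forest_nodes ts" using n unfolding all_nodes_def by blast
    then show ?thesis by (rule node_distinct_darts[OF distf])
  qed
  have sub: "set (full_tour M ts) \<subseteq> darts M" using visited_darts unfolding vis .
  have own_d: "e \<in> darts M \<and> insert e (pdart ` set us) \<subseteq> set (full_tour M ts)" if n: "(d, e, us) \<in> all_nodes M ts" for d e us
  proof -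
    have "insert e (pdart ` set us) \<subseteq> set (full_tour M ts)"
    proof (cases "(d, e, us) = (root_leaf M, root_leaf M, ts)")
      case True
      then show ?thesis by (auto simp: full_tour_def)
    next
      case False
      then have "(d, e, us) \<in> forest_nodes ts" using n unfolding all_nodes_def by blast
      from dnode_darts(4,5)[OF this] show ?thesis by (auto simp: full_tour_def)
    qed
    then show ?thesis using sub by blast
  qed
  have in_node: "\<exists>(d, e, us)\<in>all_nodes M ts. z \<in> insert e (pdart ` set us)" if "z \<in> set (full_tour M ts)" for z
  proof -
    have "z = root_leaf M \<or> z \<in> set (forest_tour ts)" using that by (auto simp: full_tour_def)
    then show ?thesis unfolding set_forest_tour_nodes all_nodes_def by blast
  qed
  obtain Y where Y: "root_matching M (cut_darts M [f]) Y" using ex_matching by blast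
  have mY: "matching M Y" "Y \<inter> cut_darts M [f] = {}" "root_dart M \<in> Y" "Y \<subseteq> white M"
    using Y matchingD(1) unfolding root_matching_def by auto
  have node_opp: "e = opp M d" if "(d, e, us) \<in> forest_nodes ts" for d e us
    using closed_opp[of "(d, e, us)"] that closed by simp
  have leaf_Y: "z \<notin> Y" if "z \<in> set (full_leaves M ts)" for z
    using that mY(2,4) unfolding cut_darts_def leaves by blast
  have tree_Y: "d \<in> Y" if "(d, e, us) \<in> forest_nodes ts" "d \<in> white M" for d e us
    using forced[OF Y, of "(d, e, us)"] that closed by simp
  have tree_opp: "opp M z \<in> tree_darts ts" if z: "z \<in> tree_darts ts" for z
  proof -
    obtain d e us where n: "(d, e, us) \<in> forest_nodes ts" "z = d \<or> z = e"
      using z unfolding tree_darts_def by (rule forest_edge_dartE)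
    have dd: "d \<in> darts M" using dnode_darts(3)[OF n(1)] sub by (auto simp: full_tour_def)
    have "opp M e = d" "opp M d = e" using node_opp[OF n(1)] opp_opp[OF dd] by simp_all
    then show ?thesis using n(2) dnode_darts(1,2)[OF n(1)] unfolding tree_darts_def by metis
  qed
  have tour_cases: "z \<in> set (full_leaves M ts) \<or> z \<in> tree_darts ts" if "z \<in> set (full_tour M ts)" for z
    using that unfolding full_tour_def full_leaves_def tree_darts_def list.set(2) set_forest_tour by blast
  have tree_tour: "tree_darts ts \<subseteq> set (full_tour M ts)"
    unfolding full_tour_def tree_darts_def list.set(2) set_forest_tour by blast
  \<comment> \<open>A path to the root is followed backwards. An uncut white dart leading to a
    visited black dart is visited too, since a black leaf has its edge cut or marked. A visited dart
    of \<open>Y\<close> is no leaf, so both ends of its edge are visited.\<close>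
  have cover: "z \<in> set (full_tour M ts)" if "(z, root_dart M) \<in> (reach M Y (cut_darts M [f]))\<^sup>*" for z
    using that
  proof (induction rule: converse_rtrancl_induct)
    case base
    have "(root_leaf M, root_leaf M, ts) \<in> all_nodes M ts" by (simp add: all_nodes_def)
    from orb[OF this] own_d[OF this] have "orbit (rot M) (root_leaf M) \<subseteq> set (full_tour M ts)" by simp
    moreover have "root_dart M \<in> orbit (rot M) (root_leaf M)" by (simp add: root_leaf_def)
    ultimately show ?case by blast
  next
    case (step z z')
    from step.hyps(1) consider "z' = rot M z" | "z \<in> white M - Y - cut_darts M [f]" "z' = opp M z"
      | "z = opp M z'" "z' \<in> Y"
      by (auto simp: reach_def)
    then show ?case
    proof cases
      case 1
      obtain d e us where n: "(d, e, us) \<in> all_nodes M ts" "z' \<in> insert e (pdart ` set us)" using in_node[OF step.IH] by blast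
      then have "orbit (rot M) z' = insert e (pdart ` set us)" using orb[OF n(1)] orbit_eq[of z' e] by simp
      moreover have "z \<in> orbit (rot M) z'" using 1 by simp
      ultimately show ?thesis using own_d[OF n(1)] by blast
    next
      case 2
      have zd: "z \<in> darts M" using 2 white_darts by blast
      have z': "z' \<notin> white M" "opp M z' = z" using 2 opp_white opp_opp zd by auto
      show ?thesis
      proof (cases "z' \<in> tree_darts ts")
        case True
        then show ?thesis using tree_opp[OF True] z' tree_tour by auto
      next
        case False
        then have "z' \<in> visited_leaves M [f]" using tour_cases[OF step.IH] leaves by blast
        then have "z \<in> cut_darts M [f]" using black_leaf[of z'] z' 2(1) unfolding cut_darts_def by auto
        then show ?thesis using 2 by blast
      qed
    next
      case 3
      then have "z' \<in> tree_darts ts" using tour_cases[OF step.IH] leaf_Y by blast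
      then show ?thesis using tree_opp 3 tree_tour by blast
    qed
  qed
  have set_tour: "set (full_tour M ts) = darts M"
    using sub cover Y unfolding root_matching_def by blast
  have disj: "set (full_leaves M ts) \<inter> tree_darts ts = {}"
  proof -
    have "root_leaf M \<notin> set (forest_tour ts)" using dist by (simp add: full_tour_def)
    then have "root_leaf M \<notin> set (forest_edge_darts ts)" unfolding set_forest_tour by blast
    then show ?thesis
      using distf unfolding distinct_forest_tour distinct_append full_leaves_def tree_darts_def list.set(2) by blast
  qed
  have child: "(d', e', us') \<in> forest_nodes ts" if n: "(d, e, us) \<in> all_nodes M ts" "DNode d' e' us' \<in> set us" for d e us d' e' us'
    by (rule forest_nodes_child[OF _ n(2)]) (use n(1) in \<open>simp add: all_nodes_def\<close>)
  have child_iff: "pdart u \<in> tree_darts ts \<longleftrightarrow> is_dnode u" if "(d, e, us) \<in> all_nodes M ts" "u \<in> set us" for d e us u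
  proof -
    have "u \<in> set ts \<or> (\<exists>d e us. (d, e, us) \<in> forest_nodes ts \<and> u \<in> set us)"
      using that by (auto simp: all_nodes_def)
    from pdart_edge_iff[OF distf this] show ?thesis by (simp add: tree_darts_def is_dnode_iff)
  qed
  \<comment> \<open>A white node with its own dart in \<open>Y\<close> would be matched to its black
    parent, which is matched to its own parent already.\<close>
  have own_Y: "e \<notin> Y" if n: "(d, e, us) \<in> all_nodes M ts" for d e us
  proof
    assume eY: "e \<in> Y"
    have nf: "(d, e, us) \<in> forest_nodes ts"
      using n eY leaf_Y[of "root_leaf M"] unfolding all_nodes_def full_leaves_def by auto
    have dd: "d \<in> darts M" using dnode_darts(3)[OF nf] sub by (auto simp: full_tour_def)
    have d: "d \<in> darts M" "opp M d = e" "opp M e = d"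
      using node_opp[OF nf] opp_opp[OF dd] dd by simp_all
    have db: "d \<notin> white M" using eY mY(4) d opp_white by blast
    obtain d' e' us' where n': "(d', e', us') \<in> all_nodes M ts" "d \<in> insert e' (pdart ` set us')"
      using in_node set_tour d(1) by blast
    have d_orb: "d \<in> orbit (rot M) e'" using n'(2) orb[OF n'(1)] by simp
    have e'b: "e' \<notin> white M" using orbit_white[OF _ d_orb] own_d[OF n'(1)] db by blast
    then have n'f: "(d', e', us') \<in> forest_nodes ts" using n'(1) by (auto simp: all_nodes_def)
    have d': "d' \<in> darts M" "opp M d' = e'"
      using dnode_darts(3)[OF n'f] sub node_opp[OF n'f, symmetric] by (auto simp: full_tour_def)
    then have "d' \<in> Y" using tree_Y[OF n'f] e'b opp_white by auto
    then have "e = d'" using matching_black_unique[OF mY(1) _ eY] d_orb d d' by simp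
    then show False using forest_nodes_disjoint(1)[OF distf n'f nf] by simp
  qed
  show ?thesis
    unfolding ts_def[symmetric]
  proof unfold_locales
    show "3 \<le> m" by (rule m)
    show "distinct (full_tour M ts)" by (rule dist)
    show "set (full_tour M ts) = darts M" by (rule set_tour)
    show "e = opp M d" if "(d, e, us) \<in> forest_nodes ts" for d e us by (rule node_opp[OF that])
    show "map (rot M) (e # map pdart us) = map pdart us @ [e]" if "(d, e, us) \<in> all_nodes M ts" for d e us
      by (rule chain_all[OF that])
    show "Suc (length us) = m" if n: "(d, e, us) \<in> all_nodes M ts" for d e us
    proof -
      have "card (orbit (rot M) e) = m" using reg own_d[OF n] unfolding regular_def vertices_def by blast
      then show ?thesis using orb[OF n] distinct_card[OF node_dist[OF n]] by simp
    qed
    \<comment> \<open>The dart of \<open>Y\<close> at a white node is not the own dart, and it was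
      not cut, so it is the upper dart of a child node. Every other child node would give a second
      dart of \<open>Y\<close> at the same vertex.\<close>
    show "length (filter is_dnode us) = 1" if n: "(d, e, us) \<in> all_nodes M ts" and w: "e \<in> white M" for d e us
    proof -
      obtain y where y: "y \<in> Y" "y \<in> orbit (rot M) e" using matchingD(2)[OF mY(1) w] by blast
      then have "y \<noteq> e" using own_Y[OF n] by blast
      then obtain u where u: "u \<in> set us" "y = pdart u" using y(2) orb[OF n] by auto
      have "pdart u \<in> set (full_tour M ts)" using own_d[OF n] u by blast
      then have "pdart u \<in> tree_darts ts" using tour_cases leaf_Y y(1) u(2) by blast
      then have du: "is_dnode u" using child_iff[OF n u(1)] by blast
      have uniq: "v = u" if v: "v \<in> set us" "is_dnode v" for v
      proof -
        obtain d' e' us' where v': "v = DNode d' e' us'" using v(2) by (auto simp: is_dnode_iff)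
        then have n': "(d', e', us') \<in> forest_nodes ts" using child[OF n] v(1) by simp
        have o: "d' \<in> orbit (rot M) e" using orb[OF n] v v' by force
        then have "d' \<in> white M" using orbit_white[OF _ o] own_d[OF n] w by blast
        then have "d' \<in> Y" using tree_Y[OF n'] by blast
        moreover have "d' \<in> orbit (rot M) y" using o orbit_eq[OF y(2)] by simp
        ultimately have "pdart v = pdart u" using matching_white_unique[OF mY(1) y(1)] u v' by simp
        moreover have "inj_on pdart (set us)" using node_dist[OF n] by (simp add: distinct_map)
        ultimately show ?thesis using v(1) u(1) by (auto dest: inj_onD)
      qed
      have "set (filter is_dnode us) = {u}" unfolding set_filter using uniq u(1) du by blast
      moreover have "distinct (filter is_dnode us)" using node_dist[OF n] by (simp add: distinct_map)
      ultimately show ?thesis using distinct_card[of "filter is_dnode us"] by simp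
    qed
    show "marks M \<subseteq> white M" by (rule marks_white)
    show "marks M \<inter> tree_darts ts = {}"
    proof -
      have "z \<notin> marks M" if z: "z \<in> tree_darts ts" for z
      proof -
        obtain d e us where n: "(d, e, us) \<in> forest_nodes ts" "z = d \<or> z = e"
          using z unfolding tree_darts_def by (rule forest_edge_dartE)
        then show ?thesis using unmarked[of "(d, e, us)"] closed by auto
      qed
      then show ?thesis by blast
    qed
    show "before (full_tour M ts) z (opp M z)"
      if z: "z \<in> white M" "z \<in> set (full_leaves M ts)" "z \<notin> marks M" for z
    proof -
      have zd: "z \<in> darts M" using z white_darts by blast
      have "opp M z \<notin> tree_darts ts" using tree_opp[of "opp M z"] opp_opp[OF zd] z(2) disj by auto
      then have "opp M z \<in> visited_leaves M [f]" using tour_cases[of "opp M z"] set_tour zd leaves by simp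
      moreover have "opp M z \<notin> white M" using z zd opp_white by blast
      ultimately show ?thesis using black_leaf[of "opp M z"] opp_opp[OF zd] z(3) vis by simp
    qed
    \<comment> \<open>The last dart around the root is \<open>root_dart M\<close>, which lies in
      \<open>Y\<close> and so was not cut.\<close>
    show "is_dnode (last ts)"
    proof -
      have root: "(root_leaf M, root_leaf M, ts) \<in> all_nodes M ts" by (simp add: all_nodes_def)
      have rr: "root_leaf M \<noteq> root_dart M" using leaf_Y[of "root_leaf M"] mY(3) by (auto simp: full_leaves_def)
      have ne: "ts \<noteq> []"
      proof
        assume "ts = []"
        then have "rot M (root_leaf M) = rot M (root_dart M)" using chain_all[OF root] by (simp add: root_leaf_def)
        then show False using rr by simp
      qed
      have "rot M (pdart (last ts)) = rot M (root_dart M)"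
        using arg_cong[OF chain_all[OF root], of last] ne by (simp add: last_map root_leaf_def)
      then have "pdart (last ts) = root_dart M" by simp
      moreover have "last ts \<in> set ts" using ne by simp
      moreover have "pdart (last ts) \<in> tree_darts ts"
      proof -
        have "pdart (last ts) \<in> set (full_tour M ts)" using own_d[OF root] \<open>last ts \<in> set ts\<close> by blast
        then show ?thesis using tour_cases leaf_Y mY(3) calculation(1) by metis
      qed
      ultimately show ?thesis using child_iff[OF root] by blast
    qed
  qed
qed

text \<open>Every move lengthens the list of visited darts, whose length is bounded by the number of
  darts. An exploration with a longest list is therefore finished.\<close>

lemma (in bipartite_map) opened_map_exists:
  assumes reg: "regular m M" and m: "m \<ge> 3" and mw: "marks M \<subseteq> white M"
    and Y: "root_matching M (marks M) Y"
  shows "\<exists>ts. opened_map M m ts"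
proof -
  have "rot M (root_dart M) \<noteq> root_dart M"
  proof
    assume "rot M (root_dart M) = root_dart M"
    then have "orbit (rot M) (root_dart M) = {root_dart M}" by (simp add: orbit_eq_singleton_iff)
    moreover have "card (orbit (rot M) (root_dart M)) = m" using reg unfolding regular_def vertices_def by simp
    ultimately show False using m by simp
  qed
  then have init: "exploration M [(root_leaf M, root_leaf M, [])]" by (rule exploration_init[OF mw Y])
  have "length (visited F) \<le> card (darts M)" if "exploration M F" for F
  proof -
    interpret e: exploration M F by fact
    have "distinct (visited F)" using e.distinct_visited by simp
    then show ?thesis using card_mono[OF finite_darts e.visited_darts] by (simp add: distinct_card)
  qed
  then have "\<exists>F. exploration M F \<and> (\<forall>F'. exploration M F' \<longrightarrow> length (visited F') \<le> length (visited F))"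
    using init
    by (intro ex_has_greatest_nat[where P = "exploration M" and b = "Suc (card (darts M))"
          and f = "\<lambda>F. length (visited F)"]) (auto simp: le_imp_less_Suc)
  then obtain F where F: "exploration M F" "\<forall>F'. exploration M F' \<longrightarrow> length (visited F') \<le> length (visited F)"
    by (elim exE conjE)
  interpret e: exploration M F by fact
  have "\<not> (\<exists>F'. exploration M F' \<and> length (visited F') > length (visited F))"
    using F(2) by (simp add: not_less)
  then have fin: "e.next_x = fown (hd F)" "tl F = []"
    using e.progress by argo+
  then obtain f where f: "F = [f]" using e.F_neq by (cases F) auto
  have "opened_map M m (fsubs f)"
    by (rule exploration_finished[OF _ _ reg m]) (use F(1) fin f in auto)
  then show ?thesis by blast
qed

section \<open>Gluing a marked tree\<close>

text \<open>The length of the tour once darts are attached: a node counts for the two darts of the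
  edge above it.\<close>

fun psize :: "ptree \<Rightarrow> nat" where
  "psize (Leaf k) = 1"
| "psize (Node c ts) = Suc (Suc (sum_list (map psize ts)))"

text \<open>The dart at position \<open>n\<close> of the walk gets a number whose parity is the color of its vertex.\<close>

definition dart_code :: "node_color \<Rightarrow> nat \<Rightarrow> nat" where
  "dart_code p n = 2 * n + (if p = White then 1 else 0)"

lemma dart_code_simps [simp]: "dart_code p n div 2 = n" "odd (dart_code p n) \<longleftrightarrow> p = White"
  "even (dart_code p n) \<longleftrightarrow> p \<noteq> White"
  by (auto simp: dart_code_def)

text \<open>\<open>n\<close> is the position of the upper dart on the tour and \<open>p\<close> the
  color of the vertex it belongs to. The own dart closes the subtree, so its position is shifted by
  the sizes of the children.\<close>

fun label :: "node_color \<Rightarrow> nat \<Rightarrow> ptree \<Rightarrow> nat dtree"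
  and labels :: "node_color \<Rightarrow> nat \<Rightarrow> ptree list \<Rightarrow> nat dtree list" where
  "label p n (Leaf k) = DLeaf (dart_code p n)"
| "label p n (Node c ts) =
     DNode (dart_code p n) (dart_code c (Suc n + sum_list (map psize ts))) (labels c (Suc n) ts)"
| "labels c n [] = []"
| "labels c n (t # ts) = label c n t # labels c (n + psize t) ts"

lemma tour_label:
  "map (\<lambda>z. z div 2) (tour (label p n t)) = [n..<n + psize t]"
  "map (\<lambda>z. z div 2) (forest_tour (labels c n ts)) = [n..<n + sum_list (map psize ts)]"
proof (induction p n t and c n ts rule: label_labels.induct)
  case (2 p n c ts)
  have "[n..<n + psize (Node c ts)] = n # [Suc n..<Suc (Suc n + sum_list (map psize ts))]"
    by (simp add: upt_conv_Cons del: upt_Suc)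
  then show ?case using 2 by simp
next
  case (4 c n t ts)
  then show ?case using upt_add_eq_append[of n "n + psize t" "sum_list (map psize ts)"] by (simp add: add.assoc)
qed simp_all

lemma pdart_label: "pdart (label p n t) = dart_code p n"
  by (cases t) auto

lemma labels_elem: "u \<in> set (labels c n ts) \<Longrightarrow> \<exists>t\<in>set ts. \<exists>k. u = label c k t"
  by (induction ts arbitrary: n) auto

lemma labels_append:
  "labels c n (xs @ ys) = labels c n xs @ labels c (n + sum_list (map psize xs)) ys"
  by (induction xs arbitrary: n) (auto simp: add.assoc)

lemma length_labels: "length (labels c n ts) = length ts"
  by (induction ts arbitrary: n) auto

lemma filter_labels:
  assumes "\<And>t k. t \<in> set ts \<Longrightarrow> P (label c k t) \<longleftrightarrow> Q t"
  shows "length (filter P (labels c n ts)) = length (filter Q ts)"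
  using assms by (induction ts arbitrary: n) auto

text \<open>The condition, relative to the color \<open>p\<close> of the parent, under which leaf
  kinds and node colors agree with the parity of the dart numbers.\<close>

fun colored :: "node_color \<Rightarrow> ptree \<Rightarrow> bool" where
  "colored p (Leaf k) \<longleftrightarrow> (k = Opening \<longleftrightarrow> p = White)"
| "colored p (Node c ts) \<longleftrightarrow> c \<noteq> p \<and> (\<forall>t\<in>set ts. colored c t)"

lemma subtrees_self [simp]: "t \<in> subtrees t"
  by (cases t) auto

lemma good_node_colored:
  assumes "\<And>c us. Node c us \<in> subtrees t \<Longrightarrow> good_node m c us" "\<not> is_node p t"
    "\<And>k. t = Leaf k \<Longrightarrow> k = (case p of White \<Rightarrow> Opening | Black \<Rightarrow> Closing)"
  shows "colored p t"
  using assms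
proof (induction t arbitrary: p)
  case (Leaf k)
  then show ?case by (cases p) auto
next
  case (Node c us)
  have g: "good_node m c us" using Node.prems(1) by simp
  have "colored c u" if u: "u \<in> set us" for u
  proof (rule Node.IH[OF u])
    show "good_node m c' us'" if "Node c' us' \<in> subtrees u" for c' us'
      using that u Node.prems(1) by auto
    show "\<not> is_node c u" using g u by (auto simp: good_node_def)
    show "k = (case c of White \<Rightarrow> Opening | Black \<Rightarrow> Closing)" if "u = Leaf k" for k
      using g u that by (auto simp: good_node_def)
  qed
  then show ?case using Node.prems(2) by auto
qed

lemma label_nodes:
  assumes "(d, e, us) \<in> dnodes (label p n t)" "colored p t"
  shows "\<exists>c ts k. Node c ts \<in> subtrees t \<and> us = labels c k ts \<and> (odd e \<longleftrightarrow> c = White) \<and> (odd d \<longleftrightarrow> c \<noteq> White)"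
  using assms
proof (induction t arbitrary: p n)
  case (Node c ts)
  show ?case
  proof (cases "(d, e, us) = (dart_code p n, dart_code c (Suc n + sum_list (map psize ts)), labels c (Suc n) ts)")
    case True
    then show ?thesis using Node.prems(2) by (cases c; cases p) auto
  next
    case False
    then obtain u where u: "u \<in> set (labels c (Suc n) ts)" "(d, e, us) \<in> dnodes u" using Node.prems(1) by auto
    then obtain t k where t: "t \<in> set ts" "u = label c k t" using labels_elem by blast
    show ?thesis using Node.IH[OF t(1), of c k] u t Node.prems(2) by auto
  qed
qed simp

lemma shape_labels:
  assumes "\<And>z. z \<in> set (forest_tour (labels c k ts)) \<Longrightarrow> z \<in> white M \<longleftrightarrow> odd z"
    "\<And>t. t \<in> set ts \<Longrightarrow> colored c t"
  shows "map (shape M) (labels c k ts) = ts"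
proof -
  have "(\<forall>z\<in>set (tour (label p n t)). z \<in> white M \<longleftrightarrow> odd z) \<longrightarrow> colored p t \<longrightarrow> shape M (label p n t) = t"
    and "(\<forall>z\<in>set (forest_tour (labels c k ts)). z \<in> white M \<longleftrightarrow> odd z) \<longrightarrow> (\<forall>t\<in>set ts. colored c t) \<longrightarrow>
      map (shape M) (labels c k ts) = ts" for p n t
  proof (induction p n t and c k ts rule: label_labels.induct)
    case (1 p n k)
    then show ?case by (cases k) (auto simp: dart_kind_def)
  next
    case (2 p n c ts)
    then show ?case by (cases c) (auto simp: dart_color_def)
  qed auto
  then show ?thesis using assms by blast
qed

text \<open>Allows \<open>opp\<close> to be obtained from a symmetric relation that collects tree
  edges and matched pairs.\<close>

lemma involution_exists:
  assumes "R \<subseteq> A \<times> A" "\<And>x. x \<in> A \<Longrightarrow> \<exists>y. (x, y) \<in> R" "\<And>x y z. (x, y) \<in> R \<Longrightarrow> (x, z) \<in> R \<Longrightarrow> y = z"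
    "\<And>x y. (x, y) \<in> R \<Longrightarrow> (y, x) \<in> R"
  shows "\<exists>f. f permutes A \<and> (\<forall>x\<in>A. f (f x) = x) \<and> (\<forall>x y. (x, y) \<in> R \<longrightarrow> f x = y)"
proof -
  define f where "f x = (if x \<in> A then (THE y. (x, y) \<in> R) else x)" for x
  have f: "f x = y" if "(x, y) \<in> R" for x y
    using that assms(1,3) by (auto simp: f_def intro!: the_equality)
  have ff: "f (f x) = x" if "x \<in> A" for x
    using assms(2)[OF that] assms(4) f by metis
  have fA: "f x \<in> A" if "x \<in> A" for x using assms(1,2) that f by blast
  have "bij_betw f A A" by (rule bij_betw_byWitness[of A f f]) (use ff fA in auto)
  then have "f permutes A" by (rule bij_imp_permutes) (simp add: f_def)
  then show ?thesis using f ff by blast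
qed

text \<open>\<open>opp\<close> joins the two darts of a tree edge and the two leaves of a pair. The
  rotation is then forced by inverting \<open>next_dart\<close>: it sends a leaf to its successor on
  the cyclic tour, and a dart of a tree edge to the successor of the opposite dart.\<close>

lemma tree_family_opened_map:
  assumes T: "T \<in> tree_family m a" and m: "m \<ge> 3"
  shows "\<exists>M ts. opened_map M m ts \<and> reading M ts = T"
proof -
  have mb: "m_bipartite_tree m (tree T)" and pm: "perfect_matching (tree T) (pairs T)"
    and mp: "marked_pairs T \<subseteq> pairs T" and fw: "\<And>i j. (i, j) \<in> pairs T - marked_pairs T \<Longrightarrow> i < j"
    and right: "node_child_rightmost (tree T)"
    using T unfolding tree_family_def marked_bipartite_tree_def by auto
  obtain c0 ps where Tn: "tree T = Node c0 ps" using right unfolding node_child_rightmost_def by auto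
  then have c0: "c0 = White" and good: "\<And>c us. Node c us \<in> subtrees (Node c0 ps) \<Longrightarrow> good_node m c us"
    using mb unfolding m_bipartite_tree_def by auto
  have gr: "good_node m White ps" using good[of c0 ps] c0 by simp
  have col: "colored White p" if p: "p \<in> set ps" for p
  proof (rule good_node_colored[of _ m])
    show "good_node m c us" if "Node c us \<in> subtrees p" for c us using that p good by auto
    show "\<not> is_node White p" using gr p by (auto simp: good_node_def)
    show "k = (case White of White \<Rightarrow> Opening | Black \<Rightarrow> Closing)" if "p = Leaf k" for k
      using gr p that unfolding good_node_def by blast
  qed
  define ts where "ts = labels White 1 ps"
  define r where "r = dart_code White 0"
  define W where "W = r # forest_tour ts"
  define N where "N = length W"
  have Wdiv: "map (\<lambda>z. z div 2) W = [0..<N]"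
  proof -
    have "map (\<lambda>z. z div 2) W = 0 # [1..<1 + sum_list (map psize ps)]"
      unfolding W_def r_def ts_def by (simp add: tour_label)
    then have "map (\<lambda>z. z div 2) W = [0..<Suc (sum_list (map psize ps))]"
      by (simp add: upt_conv_Cons del: upt_Suc)
    moreover from arg_cong[OF this, of length] have "N = Suc (sum_list (map psize ps))" by (simp add: N_def)
    ultimately show ?thesis by simp
  qed
  have distW: "distinct W" using Wdiv by (metis distinct_map distinct_upt)
  have pos: "W ! i div 2 = i" if "i < N" for i
    using arg_cong[OF Wdiv, of "\<lambda>xs. xs ! i"] that by (simp add: N_def)
  have N0: "N > 0" by (simp add: N_def W_def)
  have distf: "distinct (forest_tour ts)" using distW by (simp add: W_def)
  define E where "E = set (forest_edge_darts ts)"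
  have EW: "E \<subseteq> set (forest_tour ts)" unfolding E_def set_forest_tour by blast
  have rE: "r \<notin> E" using distW EW by (auto simp: W_def)
  define L where "L = r # forest_leaf_darts ts"
  have LW: "L = filter (\<lambda>z. z \<notin> E) W"
    using forest_leaf_darts_filter[OF distf] rE by (simp add: L_def W_def E_def)
  have distL: "distinct L" using distW by (simp add: LW)
  have setL: "set L = set W - E" by (auto simp: LW)
  have nodes: "\<exists>c us' k. Node c us' \<in> subtrees (Node c0 ps) \<and> us = labels c k us' \<and> (odd e \<longleftrightarrow> c = White) \<and> (odd d \<longleftrightarrow> c \<noteq> White)"
    if n: "(d, e, us) \<in> forest_nodes ts" for d e us
  proof -
    obtain u where u: "u \<in> set ts" "(d, e, us) \<in> dnodes u" using n by auto
    obtain p k where p: "p \<in> set ps" "u = label White k p" using labels_elem u(1) unfolding ts_def by blast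
    show ?thesis using label_nodes[of d e us White k p] u p col[OF p(1)] by auto
  qed
  define all where "all = insert (r, r, ts) (forest_nodes ts)"
  have all_nodes': "\<exists>c us' k. Node c us' \<in> subtrees (Node c0 ps) \<and> us = labels c k us' \<and> (odd e \<longleftrightarrow> c = White)"
    if "(d, e, us) \<in> all" for d e us
  proof (cases "(d, e, us) = (r, r, ts)")
    case True
    then show ?thesis using c0 by (intro exI[of _ White] exI[of _ ps] exI[of _ 1]) (auto simp: ts_def r_def)
  next
    case False
    then have "(d, e, us) \<in> forest_nodes ts" using that unfolding all_def by blast
    then show ?thesis using nodes by blast
  qed
  have in_all: "\<exists>(d, e, us)\<in>all. z \<in> insert e (pdart ` set us)" if "z \<in> set W" for z
  proof -
    have "z = r \<or> z \<in> set (forest_tour ts)" using that by (auto simp: W_def)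
    then show ?thesis unfolding set_forest_tour_nodes all_def by blast
  qed
  have kinds: "map (\<lambda>z. if odd z then Opening else Closing) L = walk (tree T)"
  proof -
    \<comment> \<open>A stand-in whose white darts are the odd numbers, so that
      \<open>shape_labels\<close> and \<open>leaves_forest\<close> apply before the glued map is
      built.\<close>
    let ?M = "\<lparr>darts = {}, rot = id, opp = id, white = {z. odd z}, root_dart = 0, marks = {}\<rparr> :: marked_map"
    have wM: "z \<in> white ?M \<longleftrightarrow> odd z" for z by simp
    have "map (shape ?M) ts = ps" unfolding ts_def by (rule shape_labels[OF wM col])
    then have "concat (map leaves ps) = map (dart_kind ?M) (forest_leaf_darts ts)"
      using leaves_forest[where M = ?M and ts = ts] by (simp only:)
    moreover have "dart_kind ?M = (\<lambda>z. if odd z then Opening else Closing)"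
      by (rule ext) (simp add: dart_kind_def)
    moreover have "odd r" by (simp add: r_def)
    ultimately show ?thesis unfolding walk_def Tn L_def leaves.simps by (simp only: list.map if_True not_False_eq_True)
  qed
  have posO: "i \<in> positions Opening (tree T) \<longleftrightarrow> i < length L \<and> odd (L ! i)" for i
    unfolding positions_def kinds[symmetric] by (auto split: if_splits)
  have posC: "i \<in> positions Closing (tree T) \<longleftrightarrow> i < length L \<and> even (L ! i)" for i
    unfolding positions_def kinds[symmetric] by (auto split: if_splits)
  let ?P = "pairs T"
  note pm' = pm[unfolded perfect_matching_def]
  have P1: "?P \<subseteq> positions Opening (tree T) \<times> positions Closing (tree T)" using pm' by (rule conjunct1)
  have P2: "\<exists>!j. (i, j) \<in> ?P" if "i \<in> positions Opening (tree T)" for i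
    by (rule bspec[OF conjunct1[OF conjunct2[OF pm']] that])
  have P3: "\<exists>!i. (i, j) \<in> ?P" if "j \<in> positions Closing (tree T)" for j
    by (rule bspec[OF conjunct2[OF conjunct2[OF pm']] that])
  note P = P1 P2 P3
  have P': "i < length L \<and> j < length L \<and> odd (L ! i) \<and> even (L ! j)" if "(i, j) \<in> ?P" for i j
    using subsetD[OF P(1) that] posO[of i] posC[of j] by simp
  \<comment> \<open>\<open>R1\<close> joins the darts of a tree edge, \<open>R2\<close> the leaves
    of a pair. They live on disjoint sets of darts, so their symmetric union matches every dart with
    exactly one other, of opposite parity.\<close>
  define R1 where "R1 = {(d, e) | d e. \<exists>us. (d, e, us) \<in> forest_nodes ts}"
  define R2 where "R2 = {(L ! i, L ! j) | i j. (i, j) \<in> ?P}"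
  define R where "R = R1 \<union> R1\<inverse> \<union> R2 \<union> R2\<inverse>"
  have R1: "x \<in> E" "y \<in> E" "odd x \<longleftrightarrow> even y" if xy: "(x, y) \<in> R1" for x y
  proof -
    obtain us where n: "(x, y, us) \<in> forest_nodes ts" using xy unfolding R1_def by blast
    then show "x \<in> E" "y \<in> E" using dnode_darts(1,2)[OF n] by (auto simp: E_def)
    show "odd x \<longleftrightarrow> even y" using nodes[OF n] by blast
  qed
  have R2: "x \<in> set L" "y \<in> set L" "odd x" "even y" if "(x, y) \<in> R2" for x y
    using that P' unfolding R2_def by auto
  have R1_inj: "x = x' \<and> y = y'" if "(x, y) \<in> R1" "(x', y') \<in> R1" "x = x' \<or> y = y'" for x y x' y'
    using that forest_nodes_disjoint(2)[OF distf] unfolding R1_def by blast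
  have R1_ne: "x \<noteq> y'" if "(x, y) \<in> R1" "(x', y') \<in> R1" for x y x' y'
    using that forest_nodes_disjoint(1)[OF distf] unfolding R1_def by blast
  have R2_inj: "x = x' \<and> y = y'" if "(x, y) \<in> R2" "(x', y') \<in> R2" "x = x' \<or> y = y'" for x y x' y'
  proof -
    obtain i j i' j' where ij: "(i, j) \<in> ?P" "x = L ! i" "y = L ! j" "(i', j') \<in> ?P" "x' = L ! i'" "y' = L ! j'"
      using \<open>(x, y) \<in> R2\<close> \<open>(x', y') \<in> R2\<close> unfolding R2_def by blast
    have "i = i' \<or> j = j'" using that(3) ij P'[OF ij(1)] P'[OF ij(4)] nth_eq_iff_index_eq[OF distL] by simp
    then have "i = i' \<and> j = j'" using ij(1,4) P by blast
    then show ?thesis using ij by simp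
  qed
  have disj: "x \<notin> E" if "x \<in> set L" for x using that setL by blast
  have RI1: "(d, e) \<in> R \<and> (e, d) \<in> R" if n: "(d, e, us) \<in> forest_nodes ts" for d e us
  proof -
    have "(d, e) \<in> R1" unfolding R1_def mem_Collect_eq using n by (intro exI[of _ d] exI[of _ e] conjI exI[of _ us] refl)
    then show ?thesis unfolding R_def by simp
  qed
  have RI2: "(L ! i, L ! j) \<in> R \<and> (L ! j, L ! i) \<in> R" if ij: "(i, j) \<in> ?P" for i j
  proof -
    have "(L ! i, L ! j) \<in> R2" unfolding R2_def using ij by blast
    then show ?thesis unfolding R_def by simp
  qed
  have RE: "(x, y) \<in> R1 \<or> (y, x) \<in> R1 \<or> (x, y) \<in> R2 \<or> (y, x) \<in> R2" if "(x, y) \<in> R" for x y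
    using that unfolding R_def by simp
  have EWs: "E \<subseteq> set W" using EW unfolding W_def list.set(2) by blast
  have LWs: "set L \<subseteq> set W" using setL by blast
  have Rsub: "R \<subseteq> set W \<times> set W"
  proof (rule subrelI)
    fix x y assume "(x, y) \<in> R"
    from RE[OF this] show "(x, y) \<in> set W \<times> set W"
      by (elim disjE) (use R1(1,2) R2(1,2) EWs LWs in \<open>auto simp only: mem_Sigma_iff subset_iff\<close>)
  qed
  have Rtot: "\<exists>y. (x, y) \<in> R" if x: "x \<in> set W" for x
  proof (cases "x \<in> E")
    case True
    then obtain d e us where n: "(d, e, us) \<in> forest_nodes ts" "x = d \<or> x = e"
      unfolding E_def by (rule forest_edge_dartE)
    then show ?thesis using RI1[OF n(1)] by blast
  next
    case False
    then have "x \<in> set L" using x setL by blast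
    then obtain i where i: "i < length L" "x = L ! i" by (auto simp: in_set_conv_nth)
    show ?thesis
    proof (cases "odd x")
      case True
      then have "\<exists>j. (i, j) \<in> ?P" using P2[of i] posO[of i] i by (blast elim: ex1E)
      then show ?thesis using RI2 i(2) by blast
    next
      case False
      then have "\<exists>j. (j, i) \<in> ?P" using P3[of i] posC[of i] i by (blast elim: ex1E)
      then show ?thesis using RI2 i(2) by blast
    qed
  qed
  have Rsym: "(y, x) \<in> R" if "(x, y) \<in> R" for x y
    using RE[OF that] unfolding R_def by auto
  have Rfun: "y = z" if xy: "(x, y) \<in> R" "(x, z) \<in> R" for x y z
  proof (cases "x \<in> E")
    case True
    then have "x \<notin> set L" using disj by blast
    then have "(x, y) \<in> R1 \<or> (y, x) \<in> R1" "(x, z) \<in> R1 \<or> (z, x) \<in> R1"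
      using RE[OF xy(1)] RE[OF xy(2)] R2(1,2) by blast+
    then show ?thesis using R1_inj R1_ne by metis
  next
    case False
    then have "(x, y) \<in> R2 \<or> (y, x) \<in> R2" "(x, z) \<in> R2 \<or> (z, x) \<in> R2"
      using RE[OF xy(1)] RE[OF xy(2)] R1(1,2) by blast+
    then show ?thesis using R2_inj R2(3,4) by metis
  qed
  have "\<exists>f. f permutes set W \<and> (\<forall>x\<in>set W. f (f x) = x) \<and> (\<forall>x y. (x, y) \<in> R \<longrightarrow> f x = y)"
  proof (rule involution_exists)
    show "R \<subseteq> set W \<times> set W" by (rule Rsub)
    show "\<exists>y. (x, y) \<in> R" if "x \<in> set W" for x by (rule Rtot[OF that])
    show "y = z" if "(x, y) \<in> R" "(x, z) \<in> R" for x y z by (rule Rfun[OF that])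
    show "(y, x) \<in> R" if "(x, y) \<in> R" for x y by (rule Rsym[OF that])
  qed
  then obtain op where op': "op permutes set W" "\<forall>x\<in>set W. op (op x) = x" "\<forall>x y. (x, y) \<in> R \<longrightarrow> op x = y"
    by (elim exE conjE)
  have op: "op permutes set W" "\<And>x. x \<in> set W \<Longrightarrow> op (op x) = x" "\<And>x y. (x, y) \<in> R \<Longrightarrow> op x = y"
    using op' by simp_all
  have opR: "(x, op x) \<in> R" if x: "x \<in> set W" for x
  proof -
    obtain y where "(x, y) \<in> R" using Rtot[OF x] by (elim exE)
    then show ?thesis using op(3)[of x y] by simp
  qed
  have op_odd: "odd (op x) \<longleftrightarrow> even x" if "x \<in> set W" for x
    using RE[OF opR[OF that]] R1(3) R2(3,4) by metis
  have op_E: "op x \<in> E \<longleftrightarrow> x \<in> E" if "x \<in> set W" for x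
    using RE[OF opR[OF that]] R1(1,2) R2(1,2) disj by metis
  have op_node: "op d = e" "op e = d" if "(d, e, us) \<in> forest_nodes ts" for d e us
    using RI1[OF that] op(3) by blast+
  have opW: "op x \<in> set W \<longleftrightarrow> x \<in> set W" for x using permutes_in_image[OF op(1)] .
  \<comment> \<open>Position \<open>n\<close> of \<open>W\<close> holds the dart whose half is
    \<open>n\<close>, so this is the cyclic successor; \<open>mod N\<close> leads from the last dart
    back to the root leaf.\<close>
  define succ where "succ z = W ! (Suc (z div 2) mod N)" for z
  define ro where "ro z = (if z \<in> set W then succ (if z \<in> E then op z else z) else z)" for z
  have succ_W: "succ z \<in> set W" for z
    unfolding succ_def N_def by (rule nth_mem) (use N0 N_def in simp)
  have succ_inj: "x = y" if xy: "x \<in> set W" "y \<in> set W" "succ x = succ y" for x y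
  proof -
    obtain i j where i: "i < N" "x = W ! i" "j < N" "y = W ! j" using xy(1,2) by (auto simp: in_set_conv_nth N_def)
    have "Suc i mod N < N" "Suc j mod N < N" using N0 by auto
    moreover have "W ! (Suc i mod N) = W ! (Suc j mod N)" using xy(3) i pos by (simp add: succ_def)
    ultimately have "Suc i mod N = Suc j mod N" using nth_eq_iff_index_eq[OF distW] by (simp add: N_def)
    then have "i = j" using i(1,3) by (auto simp: mod_Suc split: if_splits)
    then show ?thesis using i by simp
  qed
  have ro_perm: "ro permutes set W"
  proof (rule bij_imp_permutes)
    have "inj_on ro (set W)"
    proof (rule inj_onI)
      fix x y assume xy: "x \<in> set W" "y \<in> set W" "ro x = ro y"
      let ?f = "\<lambda>x. if x \<in> E then op x else x"
      have "?f x \<in> set W" "?f y \<in> set W" using xy opW by simp_all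
      moreover have "succ (?f x) = succ (?f y)" using xy unfolding ro_def by simp
      ultimately have eq: "?f x = ?f y" by (rule succ_inj)
      have "x \<in> E \<longleftrightarrow> y \<in> E" using eq op_E[OF xy(1)] op_E[OF xy(2)] by (cases "x \<in> E"; cases "y \<in> E") simp_all
      then show "x = y" using eq op(2)[OF xy(1)] op(2)[OF xy(2)] by (cases "x \<in> E") (metis, simp)
    qed
    moreover have "ro ` set W \<subseteq> set W" using succ_W by (auto simp: ro_def)
    ultimately show "bij_betw ro (set W) (set W)" unfolding bij_betw_def by (simp add: endo_inj_surj)
  qed (simp add: ro_def)
  \<comment> \<open>Appending \<open>r\<close> once more turns the cyclic wrap into an ordinary pair
    of neighbours.\<close>
  have succ_next: "succ x = y" if W': "W @ [r] = p @ x # y # q" for x y p q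
  proof -
    have len: "length p < N" using arg_cong[OF W', of length] by (simp add: N_def)
    have "x = (W @ [r]) ! length p" using W' by simp
    then have x: "x = W ! length p" using len by (simp add: nth_append N_def)
    have "y = (W @ [r]) ! Suc (length p)" using W' by (simp add: nth_append)
    moreover have "(W @ [r]) ! Suc (length p) = W ! (Suc (length p) mod N)"
    proof (cases "Suc (length p) = N")
      case True
      then show ?thesis by (simp add: nth_append N_def W_def)
    next
      case False
      then show ?thesis using len by (simp add: nth_append N_def)
    qed
    ultimately show ?thesis using x pos[OF len] by (simp add: succ_def)
  qed
  have chain_aux: "succ x # map (\<lambda>u. succ (last (tour u))) vs = map pdart vs @ [e]"
    if "W @ [r] = p @ x # forest_tour vs @ e # q" for p x vs e q
    using that
  proof (induction vs arbitrary: p x)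
    case Nil
    then show ?case using succ_next by simp
  next
    case (Cons v vs)
    have "succ x = pdart v"
    proof -
      obtain w where w: "tour v = pdart v # w"
        using hd_tour[of v] tour_neq_Nil[of v] by (cases "tour v") auto
      have "W @ [r] = p @ x # pdart v # (w @ forest_tour vs @ e # q)"
        using Cons.prems w by simp
      then show ?thesis by (rule succ_next)
    qed
    moreover have "succ (last (tour v)) # map (\<lambda>u. succ (last (tour u))) vs = map pdart vs @ [e]"
    proof (rule Cons.IH)
      have "tour v @ zs = butlast (tour v) @ last (tour v) # zs" for zs
        using arg_cong[OF append_butlast_last_id[OF tour_neq_Nil[of v]], of "\<lambda>xs. xs @ zs"] by simp
      then show "W @ [r] = (p @ x # butlast (tour v)) @ last (tour v) # forest_tour vs @ e # q"
        using Cons.prems by simp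
    qed
    ultimately show ?case by simp
  qed
  have all_W: "e \<in> set W \<and> pdart ` set us \<subseteq> set W" if "(d, e, us) \<in> all" for d e us
  proof (cases "(d, e, us) = (r, r, ts)")
    case True
    then show ?thesis by (auto simp: W_def)
  next
    case False
    then have "(d, e, us) \<in> forest_nodes ts" using that unfolding all_def by blast
    from dnode_darts(4,5)[OF this] show ?thesis by (auto simp: W_def)
  qed
  have child: "(d', e', us') \<in> forest_nodes ts" if n: "(d, e, us) \<in> all" "DNode d' e' us' \<in> set us" for d e us d' e' us'
    by (rule forest_nodes_child[OF _ n(2)]) (use n(1) in \<open>simp add: all_def\<close>)
  have ro_chain: "map ro (e # map pdart us) = map pdart us @ [e]" if n: "(d, e, us) \<in> all" for d e us
  proof -
    have rou: "ro (pdart u) = succ (last (tour u))" if u: "u \<in> set us" for u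
    proof -
      have uW: "pdart u \<in> set W" using all_W[OF n] u by blast
      have iff: "pdart u \<in> E \<longleftrightarrow> is_dnode u"
      proof -
        have "u \<in> set ts \<or> (\<exists>d e us. (d, e, us) \<in> forest_nodes ts \<and> u \<in> set us)"
          using n u by (auto simp: all_def)
        from pdart_edge_iff[OF distf this] show ?thesis by (simp add: E_def is_dnode_iff)
      qed
      show ?thesis
      proof (cases u)
        case (DLeaf z)
        then show ?thesis using iff uW by (simp add: ro_def)
      next
        case (DNode d' e' us')
        then have "DNode d' e' us' \<in> set us" using u by simp
        from child[OF n this] have "op d' = e'" by (rule op_node(1))
        then show ?thesis using iff uW DNode by (simp add: ro_def)
      qed
    qed
    have "ro e # map (\<lambda>u. succ (last (tour u))) us = map pdart us @ [e]"
    proof (cases "(d, e, us) = (r, r, ts)")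
      case True
      have "ro r = succ r" using rE by (simp add: ro_def W_def)
      moreover have "W @ [r] = [] @ r # forest_tour ts @ r # []" by (simp add: W_def)
      from chain_aux[OF this] have "succ r # map (\<lambda>u. succ (last (tour u))) ts = map pdart ts @ [r]" .
      ultimately show ?thesis using True by simp
    next
      case False
      then have nf: "(d, e, us) \<in> forest_nodes ts" using n unfolding all_def by blast
      obtain p q where "forest_tour ts = p @ tour (DNode d e us) @ q" using forest_nodes_split[OF nf] by blast
      then have "W @ [r] = (r # p) @ d # forest_tour us @ e # (q @ [r])" by (simp add: W_def)
      from chain_aux[OF this] have "succ d # map (\<lambda>u. succ (last (tour u))) us = map pdart us @ [e]" .
      moreover have "ro e = succ d" using op_node(2)[OF nf] dnode_darts(2)[OF nf] all_W[OF n] by (simp add: ro_def E_def)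
      ultimately show ?thesis by simp
    qed
    moreover have "map (\<lambda>u. succ (last (tour u))) us = map ro (map pdart us)" using rou by simp
    ultimately show ?thesis by simp
  qed
  define Mk where "Mk = (\<lambda>(i, j). L ! i) ` marked_pairs T"
  \<comment> \<open>The root dart is the dart of the last child of the root, because rotation sends
    that dart to \<open>r\<close>, which thereby becomes the root leaf.\<close>
  define M where "M = \<lparr>darts = set W, rot = ro, opp = op, white = {z \<in> set W. odd z},
      root_dart = pdart (last ts), marks = Mk\<rparr>"
  have M [simp]: "darts M = set W" "rot M = ro" "opp M = op" "white M = {z \<in> set W. odd z}"
    "root_dart M = pdart (last ts)" "marks M = Mk" by (simp_all add: M_def)
  have "Suc (length ps) = m" using gr unfolding good_node_def by (rule conjunct1)
  then have "ps \<noteq> []" using m by auto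
  then have tsne: "ts \<noteq> []" unfolding ts_def by (cases ps) auto
  have root_all: "(r, r, ts) \<in> all" by (simp add: all_def)
  have ro_last: "ro (pdart (last ts)) = r"
    using arg_cong[OF ro_chain[OF root_all], of last] tsne by (simp add: last_map)
  have rl: "root_leaf M = r" by (simp add: root_leaf_def ro_last)
  have ft: "full_tour M ts = W" by (simp add: full_tour_def rl W_def)
  have fl: "full_leaves M ts = L" by (simp add: full_leaves_def rl L_def)
  have an: "all_nodes M ts = all" by (simp add: all_nodes_def rl all_def)
  have td: "tree_darts ts = E" by (simp add: tree_darts_def E_def)
  have pd_odd: "odd (pdart u) \<longleftrightarrow> odd e" if n: "(d, e, us) \<in> all" "u \<in> set us" for d e us u
  proof -
    obtain c us' k where c: "us = labels c k us'" "odd e \<longleftrightarrow> c = White" using all_nodes'[OF n(1)] by blast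
    obtain t k' where "u = label c k' t" using labels_elem n(2) c(1) by blast
    then show ?thesis using c(2) by (simp add: pdart_label)
  qed
  have MkL: "z \<in> set L \<and> odd z" if "z \<in> Mk" for z
    using that mp P' unfolding Mk_def by (auto dest!: subsetD)
  have opened: "opened_map M m ts"
  proof unfold_locales
    show "finite (darts M)" by simp
    show "rot M permutes darts M" using ro_perm by simp
    show "opp M permutes darts M" using op(1) by simp
    show "opp M d \<noteq> d" if "d \<in> darts M" for d using op_odd[of d] that by auto
    show "opp M (opp M d) = d" if "d \<in> darts M" for d using op(2) that by simp
    show "white M \<subseteq> darts M" by auto
    show "rot M d \<in> white M \<longleftrightarrow> d \<in> white M" if d: "d \<in> darts M" for d
    proof -
      obtain d' e us where n: "(d', e, us) \<in> all" "d \<in> insert e (pdart ` set us)" 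
      proof -
        have "d \<in> set W" using d by simp
        from in_all[OF this] show ?thesis using that by blast
      qed
      have cl: "odd z \<longleftrightarrow> odd e" if "z \<in> insert e (pdart ` set us)" for z using that pd_odd[OF n(1)] by auto
      have "ro d \<in> set (map ro (e # map pdart us))" using n(2) by auto
      then have "ro d \<in> insert e (pdart ` set us)" unfolding ro_chain[OF n(1)] by auto
      then show ?thesis using cl[OF n(2)] cl[of "ro d"] d permutes_in_image[OF ro_perm] by simp
    qed
    show "opp M d \<in> white M \<longleftrightarrow> d \<notin> white M" if "d \<in> darts M" for d
      using op_odd[of d] opW that by simp
    show "root_dart M \<in> white M"
      using pd_odd[OF root_all, of "last ts"] all_W[OF root_all] tsne by (auto simp: r_def)
    show "marks M \<subseteq> darts M" using MkL setL by auto
    show "opp M d \<notin> marks M" if "d \<in> marks M" for d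
      using that MkL op_odd[of d] setL by auto
    show "3 \<le> m" by (rule m)
    show "distinct (full_tour M ts)" using distW ft by simp
    show "set (full_tour M ts) = darts M" using ft by simp
    show "e = opp M d" if "(d, e, us) \<in> forest_nodes ts" for d e us using op_node(1)[OF that] by simp
    show "map (rot M) (e # map pdart us) = map pdart us @ [e]" if "(d, e, us) \<in> all_nodes M ts" for d e us
      using ro_chain[of d e us] that unfolding an by simp
    show "Suc (length us) = m" if n: "(d, e, us) \<in> all_nodes M ts" for d e us
    proof -
      obtain c us' k where "Node c us' \<in> subtrees (Node c0 ps)" "us = labels c k us'"
        using all_nodes'[of d e us] n unfolding an by blast
      then show ?thesis using good[of c us'] by (simp add: length_labels good_node_def)
    qed
    show "length (filter is_dnode us) = 1" if n: "(d, e, us) \<in> all_nodes M ts" and w: "e \<in> white M" for d e us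
    proof -
      obtain c us' k where c: "Node c us' \<in> subtrees (Node c0 ps)" "us = labels c k us'" "odd e \<longleftrightarrow> c = White"
        using all_nodes'[of d e us] n unfolding an by blast
      have g: "good_node m White us'" using good[OF c(1)] c(3) w by simp
      have "length (filter is_dnode us) = length (filter (is_node Black) us')"
        unfolding c(2)
      proof (rule filter_labels)
        fix t k assume "t \<in> set us'"
        then have "\<not> is_node White t" using g by (auto simp: good_node_def)
        then show "is_dnode (label c k t) \<longleftrightarrow> is_node Black t"
          by (cases t) (auto intro: node_color.exhaust)
      qed
      then show ?thesis using g by (simp add: good_node_def)
    qed
    show "marks M \<subseteq> white M" using MkL setL by auto
    show "marks M \<inter> tree_darts ts = {}" using MkL disj td by auto
    show "before (full_tour M ts) z (opp M z)"
      if z: "z \<in> white M" "z \<in> set (full_leaves M ts)" "z \<notin> marks M" for z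
    proof -
      obtain i where i: "i < length L" "z = L ! i" using z(2) fl by (auto simp: in_set_conv_nth)
      then have "\<exists>j. (i, j) \<in> ?P" using P2[of i] posO[of i] z(1) by (auto elim: ex1E)
      then obtain j where j: "(i, j) \<in> ?P" by (elim exE)
      have oz: "opp M z = L ! j" using op(3)[of z "L ! j"] RI2[OF j] i by simp
      have "(i, j) \<notin> marked_pairs T" using z(3) i unfolding M Mk_def by force
      then have "i < j" using fw j by blast
      moreover have jL: "j < length L" using P'[OF j] by simp
      ultimately have "before L (L ! i) (L ! j)" using before_nth[OF distL i(1)] by simp
      then have "before W (L ! i) (L ! j)"
        using before_filter[OF distW, of "L ! i" "L ! j" "\<lambda>z. z \<notin> E"] nth_mem[OF i(1)] nth_mem[OF jL] setL
        unfolding LW[symmetric] by blast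
      then show ?thesis unfolding ft oz using i(2) by simp
    qed
    show "is_dnode (last ts)"
    proof -
      obtain xs c' us where "ps = xs @ [Node c' us]" using right Tn unfolding node_child_rightmost_def by auto
      then show ?thesis unfolding ts_def by (simp add: labels_append)
    qed
  qed
  have "tree (reading M ts) = tree T"
  proof -
    have "map (shape M) ts = ps" unfolding ts_def
      by (rule shape_labels[OF _ col]) (simp_all add: W_def ts_def)
    then show ?thesis using Tn c0 by simp
  qed
  moreover have prs: "pairs (reading M ts) = ?P"
  proof -
    have "(i, j) \<in> leaf_pairs M L \<longleftrightarrow> (i, j) \<in> ?P" for i j
    proof
      assume ij: "(i, j) \<in> leaf_pairs M L"
      then have i: "i < length L" "j < length L" "odd (L ! i)" "L ! j = op (L ! i)" by (auto simp: leaf_pairs_def)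
      then have "\<exists>j'. (i, j') \<in> ?P" using P2[of i] posO[of i] by (blast elim: ex1E)
      then obtain j' where j': "(i, j') \<in> ?P" by (elim exE)
      then have "op (L ! i) = L ! j'" using op(3) RI2 by blast
      then have "j = j'" using i P'[OF j'] nth_eq_iff_index_eq[OF distL] by simp
      then show "(i, j) \<in> ?P" using j' by simp
    next
      assume ij: "(i, j) \<in> ?P"
      then have "op (L ! i) = L ! j" using op(3) RI2 by blast
      moreover have "L ! i \<in> set W" using P'[OF ij] setL nth_mem by blast
      ultimately show "(i, j) \<in> leaf_pairs M L" using P'[OF ij] by (simp add: leaf_pairs_def)
    qed
    then show ?thesis using fl by auto
  qed
  moreover have "marked_pairs (reading M ts) = marked_pairs T"
  proof -
    have "(i, j) \<in> marked_pairs T" if ij: "(i, j) \<in> ?P" "L ! i \<in> Mk" for i j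
    proof -
      obtain i' j' where i': "(i', j') \<in> marked_pairs T" "L ! i = L ! i'" using ij(2) unfolding Mk_def by auto
      then have "(i', j') \<in> ?P" using mp by blast
      then have "i = i'" using i'(2) P'[OF ij(1)] P'[of i' j'] nth_eq_iff_index_eq[OF distL] by simp
      then have "op (L ! i) = L ! j" "op (L ! i) = L ! j'" using op(3) RI2 ij(1) \<open>(i', j') \<in> ?P\<close> by blast+
      then have "j = j'" using P'[OF ij(1)] P'[OF \<open>(i', j') \<in> ?P\<close>] nth_eq_iff_index_eq[OF distL] by simp
      then show ?thesis using i' \<open>i = i'\<close> by simp
    qed
    moreover have "L ! i \<in> Mk" if "(i, j) \<in> marked_pairs T" for i j using that unfolding Mk_def by force
    moreover have "marked_pairs (reading M ts) = {(i, j) \<in> ?P. L ! i \<in> Mk}"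
      using prs fl by simp
    ultimately show ?thesis using mp by auto
  qed
  ultimately have "reading M ts = T" by (intro marked_tree.equality) simp_all
  then show ?thesis using opened by blast
qed

section \<open>Isomorphisms\<close>

lemma marked_regular_bipartite_mapD:
  "marked_regular_bipartite_map m M \<Longrightarrow> bipartite_map M"
  "marked_regular_bipartite_map m M \<Longrightarrow> regular m M"
  unfolding marked_regular_bipartite_map_def bicolored_def is_comb_map_def bipartite_map_def by blast+

section \<open>Relabelling the darts of a tree\<close>

lemma pdart_map_dtree [simp]: "pdart (map_dtree f t) = f (pdart t)"
  by (cases t) auto

lemma is_dnode_map_dtree [simp]: "is_dnode (map_dtree f t) \<longleftrightarrow> is_dnode t"
  by (cases t) auto

lemma tour_map_dtree: "tour (map_dtree f t) = map f (tour t)"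
proof (induction t)
  case (DNode d e ts)
  then have "map (\<lambda>t. tour (map_dtree f t)) ts = map (\<lambda>t. map f (tour t)) ts" by simp
  then show ?case by (simp add: map_concat comp_def del: map_eq_conv)
qed simp

lemma leaf_darts_map_dtree: "leaf_darts (map_dtree f t) = map f (leaf_darts t)"
proof (induction t)
  case (DNode d e ts)
  then have "map (\<lambda>t. leaf_darts (map_dtree f t)) ts = map (\<lambda>t. map f (leaf_darts t)) ts" by simp
  then show ?case by (simp add: map_concat comp_def del: map_eq_conv)
qed simp

lemma dnodes_map_dtree:
  "dnodes (map_dtree f t) = (\<lambda>(d, e, us). (f d, f e, map (map_dtree f) us)) ` dnodes t"
proof (induction t)
  case (DNode d e ts)
  then have "(\<Union>t\<in>set ts. dnodes (map_dtree f t)) =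
      (\<Union>t\<in>set ts. (\<lambda>(d, e, us). (f d, f e, map (map_dtree f) us)) ` dnodes t)"
    by (intro SUP_cong) auto
  then show ?case by (simp add: image_UN)
qed simp

lemma forest_map_dtree:
  "forest_tour (map (map_dtree f) ts) = map f (forest_tour ts)"
  "forest_leaf_darts (map (map_dtree f) ts) = map f (forest_leaf_darts ts)"
  "forest_nodes (map (map_dtree f) ts) = (\<lambda>(d, e, us). (f d, f e, map (map_dtree f) us)) ` forest_nodes ts"
  by (simp_all add: map_concat comp_def tour_map_dtree leaf_darts_map_dtree dnodes_map_dtree image_UN)

lemma before_map: "before xs a b \<Longrightarrow> before (map f xs) (f a) (f b)"
proof -
  assume "before xs a b"
  then obtain us vs where "xs = us @ vs" "a \<in> set us" "b \<in> set vs" by (auto simp: before_def)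
  then have "map f xs = map f us @ map f vs" "f a \<in> set (map f us)" "f b \<in> set (map f vs)" by auto
  then show ?thesis unfolding before_def by blast
qed

lemma shape_map_dtree:
  assumes "\<And>z. z \<in> set (tour t) \<Longrightarrow> f z \<in> white N \<longleftrightarrow> z \<in> white M"
  shows "shape N (map_dtree f t) = shape M t"
  using assms
proof (induction t)
  case (DNode d e ts)
  have "shape N (map_dtree f t) = shape M t" if t: "t \<in> set ts" for t
    by (rule DNode.IH[OF t]) (rule DNode.prems, use t in auto)
  moreover have "f e \<in> white N \<longleftrightarrow> e \<in> white M" by (rule DNode.prems) simp
  ultimately show ?case by (simp add: dart_color_def)
qed (simp add: dart_kind_def)

lemma all_nodes_map:
  assumes "root_leaf N = f (root_leaf M)"
  shows "all_nodes N (map (map_dtree f) ts) = (\<lambda>(d, e, us). (f d, f e, map (map_dtree f) us)) ` all_nodes M ts"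
  unfolding all_nodes_def forest_map_dtree(3) assms by simp

lemma (in opened_map) full_tour_darts: "z \<in> set (forest_tour ts) \<Longrightarrow> z \<in> darts M"
  using set_tour by (auto simp: full_tour_def)

text \<open>An opening is stated through rotation, \<open>opp\<close>, colors, root and marks, all
  preserved by an isomorphism; the reading records positions, which relabelling does not
  move.\<close>

lemma (in opened_map) opened_map_transport:
  assumes iso: "map_isomorphism f M N" and N: "marked_regular_bipartite_map m N"
  shows "opened_map N m (map (map_dtree f) ts)" "reading N (map (map_dtree f) ts) = reading M ts"
proof -
  interpret N: bipartite_map N using marked_regular_bipartite_mapD(1)[OF N] .
  let ?ts = "map (map_dtree f) ts"
  have bij: "bij_betw f (darts M) (darts N)" and rotf: "\<And>d. d \<in> darts M \<Longrightarrow> f (rot M d) = rot N (f d)"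
    and oppf: "\<And>d. d \<in> darts M \<Longrightarrow> f (opp M d) = opp N (f d)"
    and wf: "f ` white M = white N" and rf: "f (root_dart M) = root_dart N" and mf: "f ` marks M = marks N"
    using iso unfolding map_isomorphism_def by auto
  have inj: "inj_on f (darts M)" and img: "f ` darts M = darts N" using bij by (auto simp: bij_betw_def)
  have mem: "f z \<in> f ` A \<longleftrightarrow> z \<in> A" if "z \<in> darts M" "A \<subseteq> darts M" for z A
    using inj_on_image_mem_iff[OF inj that] .
  have white: "f z \<in> white N \<longleftrightarrow> z \<in> white M" if "z \<in> darts M" for z
    using mem[OF that white_darts] wf by simp
  have marksf: "f z \<in> marks N \<longleftrightarrow> z \<in> marks M" if "z \<in> darts M" for z
    using mem[OF that marks_darts] mf by simp
  have rl: "root_leaf N = f (root_leaf M)" using rotf[of "root_dart M"] rf by (simp add: root_leaf_def)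
  have ft: "full_tour N ?ts = map f (full_tour M ts)"
    unfolding full_tour_def forest_map_dtree(1) rl by simp
  have fl: "full_leaves N ?ts = map f (full_leaves M ts)"
    unfolding full_leaves_def forest_map_dtree(2) rl by simp
  have an: "all_nodes N ?ts = (\<lambda>(d, e, us). (f d, f e, map (map_dtree f) us)) ` all_nodes M ts"
    by (rule all_nodes_map[of N f M, OF rl])
  have anE: "\<exists>d' e' us'. (d', e', us') \<in> all_nodes M ts \<and> d = f d' \<and> e = f e' \<and> us = map (map_dtree f) us'"
    if "(d, e, us) \<in> all_nodes N ?ts" for d e us
    using that unfolding an by auto
  have leavesD: "z \<in> darts M" if "z \<in> set (full_leaves M ts)" for z using that set_leaves by blast
  show "opened_map N m ?ts"
  proof unfold_locales
    show "3 \<le> m" by (rule m_ge)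
    show "distinct (full_tour N ?ts)"
      unfolding ft distinct_map set_tour using distinct_tour inj by blast
    show "set (full_tour N ?ts) = darts N" unfolding ft set_map set_tour by (rule img)
    show "e = opp N d" if n: "(d, e, us) \<in> forest_nodes ?ts" for d e us
    proof -
      obtain d' e' us' where n': "(d', e', us') \<in> forest_nodes ts" "d = f d'" "e = f e'"
        using n unfolding forest_map_dtree(3) by auto
      have "d' \<in> darts M" using dnode_darts(3)[OF n'(1)] full_tour_darts by blast
      then show ?thesis using node_opp[OF n'(1)] oppf n' by simp
    qed
    show "map (rot N) (e # map pdart us) = map pdart us @ [e]" if n: "(d, e, us) \<in> all_nodes N ?ts" for d e us
    proof -
      obtain d' e' us' where n': "(d', e', us') \<in> all_nodes M ts" "d = f d'" "e = f e'" "us = map (map_dtree f) us'"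
        using anE[OF n] by blast
      have "\<forall>z\<in>set (e' # map pdart us'). rot N (f z) = f (rot M z)"
        using nodes_darts(2,3)[OF n'(1)] rotf by auto
      then have "map (rot N) (map f (e' # map pdart us')) = map f (map (rot M) (e' # map pdart us'))"
        by simp
      also have "\<dots> = map f (map pdart us' @ [e'])" unfolding node_rot[OF n'(1)] ..
      finally show ?thesis using n' by (simp add: comp_def)
    qed
    show "Suc (length us) = m" if n: "(d, e, us) \<in> all_nodes N ?ts" for d e us
    proof -
      obtain d' e' us' where "(d', e', us') \<in> all_nodes M ts" "us = map (map_dtree f) us'" using anE[OF n] by blast
      then show ?thesis using node_deg by simp
    qed
    show "length (filter is_dnode us) = 1" if n: "(d, e, us) \<in> all_nodes N ?ts" and w: "e \<in> white N" for d e us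
    proof -
      obtain d' e' us' where n': "(d', e', us') \<in> all_nodes M ts" "e = f e'" "us = map (map_dtree f) us'"
        using anE[OF n] by blast
      have "e' \<in> white M" using white[OF nodes_darts(2)[OF n'(1)]] w n'(2) by simp
      then show ?thesis using node_child[OF n'(1)] n'(3) by (simp add: filter_map comp_def)
    qed
    show "marks N \<subseteq> white N" using marks_white wf mf by blast
    show "marks N \<inter> tree_darts ?ts = {}"
    proof -
      have "z \<notin> marks N" if z: "z \<in> tree_darts ?ts" for z
      proof -
        obtain d e us where n: "(d, e, us) \<in> forest_nodes ?ts" "z = d \<or> z = e"
          using z unfolding tree_darts_def by (rule forest_edge_dartE)
        obtain d' e' us' where n': "(d', e', us') \<in> forest_nodes ts" "d = f d'" "e = f e'"
          using n unfolding forest_map_dtree(3) by auto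
        have "d' \<in> darts M" "e' \<in> darts M" using dnode_darts(3,4)[OF n'(1)] full_tour_darts by blast+
        moreover have "d' \<notin> marks M" "e' \<notin> marks M" using node_tree_darts[OF n'(1)] marks_tree by blast+
        ultimately show ?thesis using n(2) n'(2,3) marksf by auto
      qed
      then show ?thesis by blast
    qed
    show "before (full_tour N ?ts) z (opp N z)"
      if z: "z \<in> white N" "z \<in> set (full_leaves N ?ts)" "z \<notin> marks N" for z
    proof -
      obtain y where y: "z = f y" "y \<in> set (full_leaves M ts)" using z(2) unfolding fl by auto
      have yd: "y \<in> darts M" using leavesD[OF y(2)] .
      have "before (full_tour M ts) y (opp M y)"
        using forward[of y] z y white[OF yd] marksf[OF yd] by simp
      then have "before (map f (full_tour M ts)) (f y) (f (opp M y))" by (rule before_map)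
      then show ?thesis unfolding ft using y oppf[OF yd] by simp
    qed
    show "is_dnode (last ?ts)" using last_node by (simp add: last_map)
  qed
  have "map (shape N) ?ts = map (shape M) ts"
  proof -
    have "shape N (map_dtree f t) = shape M t" if t: "t \<in> set ts" for t
    proof (rule shape_map_dtree)
      fix z assume "z \<in> set (tour t)"
      then have "z \<in> set (forest_tour ts)" using t by auto
      then show "f z \<in> white N \<longleftrightarrow> z \<in> white M" using white full_tour_darts by blast
    qed
    then show ?thesis by simp
  qed
  moreover have lp: "leaf_pairs N (full_leaves N ?ts) = leaf_pairs M (full_leaves M ts)"
  proof -
    let ?L = "full_leaves M ts"
    have eq: "f (?L ! i) \<in> white N \<and> f (?L ! j) = opp N (f (?L ! i)) \<longleftrightarrow> ?L ! i \<in> white M \<and> ?L ! j = opp M (?L ! i)"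
      if ij: "i < length ?L" "j < length ?L" for i j
    proof -
      have d: "?L ! i \<in> darts M" "?L ! j \<in> darts M" "opp M (?L ! i) \<in> darts M" using leaf_nth_darts ij by simp_all
      have "f (?L ! j) = opp N (f (?L ! i)) \<longleftrightarrow> ?L ! j = opp M (?L ! i)"
        unfolding oppf[OF d(1), symmetric] using inj_on_eq_iff[OF inj d(2,3)] .
      then show ?thesis using white[OF d(1)] by simp
    qed
    have "(i, j) \<in> leaf_pairs N (map f ?L) \<longleftrightarrow> (i, j) \<in> leaf_pairs M ?L" for i j
    proof (cases "i < length ?L \<and> j < length ?L")
      case True
      then show ?thesis using eq[of i j] by (simp add: leaf_pairs_def)
    qed (auto simp: leaf_pairs_def)
    then show ?thesis unfolding fl by auto
  qed
  moreover have "marked_pairs (reading N ?ts) = marked_pairs (reading M ts)"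
  proof -
    have "full_leaves N ?ts ! i \<in> marks N \<longleftrightarrow> full_leaves M ts ! i \<in> marks M"
      if "(i, j) \<in> leaf_pairs M (full_leaves M ts)" for i j
      using that marksf[OF leaf_nth_darts[of i]] unfolding fl by (auto simp: leaf_pairs_def)
    then show ?thesis using lp by auto
  qed
  ultimately show "reading N ?ts = reading M ts"
    by (intro marked_tree.equality) (simp_all only: reading_simps, simp)
qed

section \<open>Equal readings give isomorphic maps\<close>

lemma length_tour_shape: "length (tour t) = psize (shape M t)"
proof (induction t)
  case (DNode d e ts)
  then have "map (\<lambda>t. length (tour t)) ts = map (\<lambda>t. psize (shape M t)) ts" by simp
  from arg_cong[OF this, of sum_list] show ?case by (simp add: length_concat comp_def del: map_eq_conv)
qed simp

text \<open>Equal shapes have tours of equal length, so the two concatenations split at the same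
  places. The claim for single trees is a hypothesis, so that the lemma serves the induction on
  trees and afterwards yields the claim for forests.\<close>

lemma shape_eq_map_list:
  assumes "\<And>v v'. v \<in> set vs \<Longrightarrow> shape M v = shape N v' \<Longrightarrow> map f (tour v) = tour v' \<Longrightarrow> map_dtree f v = v'"
    "map (shape M) vs = map (shape N) vs'" "map f (forest_tour vs) = forest_tour vs'"
  shows "map (map_dtree f) vs = vs'"
  using assms
proof (induction vs arbitrary: vs')
  case (Cons v vs)
  then obtain w ws where vs': "vs' = w # ws" by (cases vs') auto
  have s: "shape M v = shape N w" "map (shape M) vs = map (shape N) ws" using Cons.prems(2) vs' by auto
  have "length (map f (tour v)) = length (tour w)"
    using s(1) length_tour_shape[of v M] length_tour_shape[of w N] by simp
  then have m: "map f (tour v) = tour w" "map f (forest_tour vs) = forest_tour ws"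
    using Cons.prems(3) vs' by auto
  have "map_dtree f v = w" by (rule Cons.prems(1)[OF _ s(1) m(1)]) simp
  moreover have "map (map_dtree f) vs = ws"
    by (rule Cons.IH[OF _ s(2) m(2)]) (rule Cons.prems(1), simp_all)
  ultimately show ?case using vs' by simp
qed simp

lemma shape_eq_map_dtree:
  assumes "shape M t = shape N t'" "map f (tour t) = tour t'"
  shows "map_dtree f t = t'"
  using assms
proof (induction t arbitrary: t')
  case (DLeaf d)
  then show ?case by (cases t') auto
next
  case (DNode d e us)
  then obtain d' e' us' where t': "t' = DNode d' e' us'" by (cases t') auto
  have "map (map_dtree f) us = us'"
    by (rule shape_eq_map_list[where M = M and N = N]) (use DNode t' in auto)
  then show ?case using DNode.prems t' by simp
qed

lemma shape_eq_map_forest: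
  assumes "map (shape M) vs = map (shape N) vs'" "map f (forest_tour vs) = forest_tour vs'"
  shows "map (map_dtree f) vs = vs'"
  using shape_eq_map_list[OF shape_eq_map_dtree assms] .

lemma shape_node_color:
  assumes "shape N (map_dtree f t) = shape M t" "(d, e, us) \<in> dnodes t"
  shows "f e \<in> white N \<longleftrightarrow> e \<in> white M"
  using assms
proof (induction t)
  case (DNode d' e' ts)
  then show ?case by (fastforce simp: dart_color_def split: if_splits)
qed simp

text \<open>The isomorphism sends the dart at each position of one tour to the dart at the same
  position of the other. Equal shapes carry over rotation, colors and tree edges; equal pairs carry
  over the remaining edges, and equal marked pairs the marks.\<close>

lemma reading_eq_isomorphism:
  assumes "opened_map M m ts" "opened_map N m ts'" and eq: "reading M ts = reading N ts'"
  shows "\<exists>f. map_isomorphism f M N"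
proof -
  interpret M: opened_map M m ts by fact
  interpret N: opened_map N m ts' by fact
  let ?W = "full_tour M ts" and ?W' = "full_tour N ts'"
  let ?L = "full_leaves M ts" and ?L' = "full_leaves N ts'"
  have sh: "map (shape M) ts = map (shape N) ts'" using arg_cong[OF eq, of tree] by simp
  have prs: "leaf_pairs M ?L = leaf_pairs N ?L'" using arg_cong[OF eq, of pairs] by simp
  have mprs: "marked_pairs (reading M ts) = marked_pairs (reading N ts')" using eq by simp
  have len: "length ?W = length ?W'"
  proof -
    have "length (forest_tour ts) = sum_list (map psize (map (shape M) ts))" for ts and M :: marked_map
      by (induction ts) (auto simp: length_tour_shape)
    then show ?thesis using sh by (metis full_tour_def length_Cons)
  qed
  define f where "f z = the (map_of (zip ?W ?W') z)" for z
  have fW: "map f ?W = ?W'"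
  proof (rule nth_equalityI)
    fix i assume "i < length (map f ?W)"
    then show "map f ?W ! i = ?W' ! i"
      using len M.distinct_tour by (simp add: f_def map_of_zip_nth)
  qed (simp add: len)
  have rl: "root_leaf N = f (root_leaf M)" and ffor: "map f (forest_tour ts) = forest_tour ts'"
    using fW by (simp_all add: full_tour_def)
  have ts': "map (map_dtree f) ts = ts'" by (rule shape_eq_map_forest[OF sh ffor])
  have fL: "?L' = map f ?L"
    unfolding full_leaves_def rl using forest_map_dtree(2)[of f ts] ts' by simp
  have inj: "inj_on f (darts M)"
    using N.distinct_tour unfolding fW[symmetric] distinct_map M.set_tour by blast
  have img: "f ` darts M = darts N"
    using N.set_tour unfolding fW[symmetric] set_map M.set_tour .
  have an: "all_nodes N ts' = (\<lambda>(d, e, us). (f d, f e, map (map_dtree f) us)) ` all_nodes M ts"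
    using all_nodes_map[of N f M ts, OF rl] ts' by simp
  have node': "(f d, f e, map (map_dtree f) us) \<in> all_nodes N ts'" if "(d, e, us) \<in> all_nodes M ts" for d e us
    unfolding an using that by (rule rev_image_eqI) simp
  have fnode': "(f d, f e, map (map_dtree f) us) \<in> forest_nodes ts'" if "(d, e, us) \<in> forest_nodes ts" for d e us
  proof -
    have "forest_nodes ts' = (\<lambda>(d, e, us). (f d, f e, map (map_dtree f) us)) ` forest_nodes ts"
      using forest_map_dtree(3)[of f ts] ts' by simp
    then show ?thesis using that by (auto intro: rev_image_eqI)
  qed
  have rotf: "f (rot M z) = rot N (f z)" if z: "z \<in> darts M" for z
  proof -
    obtain d e us where n: "(d, e, us) \<in> all_nodes M ts" "z \<in> orbit (rot M) e" using M.dart_node[OF z] .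
    have zz: "z \<in> set (e # map pdart us)" using n(2) M.node_orbit[OF n(1)] by simp
    have "map (rot N) (map f (e # map pdart us)) = map f (map pdart us @ [e])"
      using N.node_rot[OF node'[OF n(1)]] by (simp add: comp_def)
    also have "\<dots> = map f (map (rot M) (e # map pdart us))" using M.node_rot[OF n(1)] by simp
    finally have "map (\<lambda>z. rot N (f z)) (e # map pdart us) = map (\<lambda>z. f (rot M z)) (e # map pdart us)"
      by (simp only: map_map comp_def)
    then show ?thesis using zz unfolding map_eq_conv by metis
  qed
  have white: "f z \<in> white N \<longleftrightarrow> z \<in> white M" if z: "z \<in> darts M" for z
  proof -
    obtain d e us where n: "(d, e, us) \<in> all_nodes M ts" "z \<in> orbit (rot M) e" using M.dart_node[OF z] .
    have "f e \<in> white N \<longleftrightarrow> e \<in> white M"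
    proof (cases "(d, e, us) = (root_leaf M, root_leaf M, ts)")
      case True
      then show ?thesis using rl N.root_leaf_white M.root_leaf_white by simp
    next
      case False
      then obtain t where t: "t \<in> set ts" "(d, e, us) \<in> dnodes t" using n(1) unfolding all_nodes_def by auto
      have "map (shape N) (map (map_dtree f) ts) = map (shape M) ts" using sh ts' by simp
      then have "shape N (map_dtree f t) = shape M t" using t(1) by simp
      then show ?thesis using t(2) by (rule shape_node_color)
    qed
    moreover have "z \<in> white M \<longleftrightarrow> e \<in> white M" by (rule M.orbit_white[OF M.nodes_darts(2)[OF n(1)] n(2)])
    moreover have "f z \<in> orbit (rot N) (f e)"
    proof -
      have "z \<in> insert e (pdart ` set us)" using n(2) M.node_orbit[OF n(1)] by simp
      then show ?thesis unfolding N.node_orbit[OF node'[OF n(1)]] by (auto simp: image_image)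
    qed
    then have "f z \<in> white N \<longleftrightarrow> f e \<in> white N" by (rule N.orbit_white[OF N.nodes_darts(2)[OF node'[OF n(1)]]])
    ultimately show ?thesis by simp
  qed
  have leaf_opp_white: "f (opp M z) = opp N (f z)" if z: "z \<in> set ?L" "z \<in> white M" for z
  proof -
    obtain i j where ij: "i < length ?L" "?L ! i = z" "j < length ?L" "?L ! j = opp M z"
      using z(1) M.leaf_opp[OF z(1)] by (auto simp: in_set_conv_nth)
    then have "(i, j) \<in> leaf_pairs N ?L'" using z(2) unfolding prs[symmetric] by (simp add: leaf_pairs_def)
    then show ?thesis using ij unfolding fL by (simp add: leaf_pairs_def)
  qed
  have oppf: "f (opp M z) = opp N (f z)" if z: "z \<in> darts M" for z
  proof (cases "z \<in> M.E")
    case True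
    then obtain d e us where n: "(d, e, us) \<in> forest_nodes ts" "z = d \<or> z = e" by (rule M.tree_dart_cases)
    have dd: "d \<in> darts M" using dnode_darts(3)[OF n(1)] M.full_tour_darts by blast
    then have fd: "f d \<in> darts N" using img by blast
    have "opp M d = e" "opp M e = d" using M.node_opp[OF n(1)] M.opp_opp[OF dd] by simp_all
    moreover have "opp N (f d) = f e" "opp N (f e) = f d"
      using N.node_opp[OF fnode'[OF n(1)]] N.opp_opp[OF fd] by simp_all
    ultimately show ?thesis using n(2) by metis
  next
    case False
    then have zL: "z \<in> set ?L" using M.set_leaves z by blast
    show ?thesis
    proof (cases "z \<in> white M")
      case False
      have o: "opp M z \<in> set ?L" "opp M z \<in> white M" "opp M (opp M z) = z" "opp M z \<in> darts M"
        using M.leaf_opp[OF zL] M.opp_white[OF z] False M.opp_opp[OF z] z by simp_all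
      have "f z = opp N (f (opp M z))" using leaf_opp_white[OF o(1,2)] o(3) by simp
      moreover have "f (opp M z) \<in> darts N" using o(4) img by blast
      ultimately show ?thesis using N.opp_opp by simp
    qed (rule leaf_opp_white[OF zL])
  qed
  have "map_isomorphism f M N"
    unfolding map_isomorphism_def
  proof (intro conjI ballI)
    show "bij_betw f (darts M) (darts N)" using inj img by (simp add: bij_betw_def)
    show "f (rot M d) = rot N (f d)" if "d \<in> darts M" for d by (rule rotf[OF that])
    show "f (opp M d) = opp N (f d)" if "d \<in> darts M" for d by (rule oppf[OF that])
    show "f ` white M = white N"
    proof
      show "f ` white M \<subseteq> white N" using white M.white_darts by blast
      show "white N \<subseteq> f ` white M"
      proof
        fix y assume y: "y \<in> white N"
        then obtain z where "z \<in> darts M" "y = f z" using N.white_darts img by blast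
        then show "y \<in> f ` white M" using white y by blast
      qed
    qed
    have "rot N (f (root_dart M)) = rot N (root_dart N)"
      using rotf[OF M.root_dart_darts] rl by (simp add: root_leaf_def)
    then show "f (root_dart M) = root_dart N" by simp
    have "marks N = (\<lambda>(i, j). map f ?L ! i) ` marked_pairs (reading M ts)"
      unfolding N.marks_marked_pairs mprs fL ..
    also have "\<dots> = f ` ((\<lambda>(i, j). ?L ! i) ` marked_pairs (reading M ts))"
      unfolding image_image by (rule image_cong) (auto simp: leaf_pairs_def)
    also have "\<dots> = f ` marks M" unfolding M.marks_marked_pairs[symmetric] ..
    finally show "f ` marks M = marks N" ..
  qed
  then show ?thesis by blast
qed

lemma map_family_opened_map:
  assumes M: "M \<in> map_family m a" and m: "m \<ge> 3"
  shows "\<exists>ts. opened_map M m ts"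
proof -
  have fam: "marked_regular_bipartite_map m M" "admissible m M" using M by (auto simp: map_family_def)
  interpret bipartite_map M by (rule marked_regular_bipartite_mapD(1)[OF fam(1)])
  have reg: "regular m M" by (rule marked_regular_bipartite_mapD(2)[OF fam(1)])
  have mw: "marks M \<subseteq> white M" by (rule admissible_marks_white[OF fam(2)])
  obtain Y where "root_matching M (marks M) Y" using admissible_iff[OF reg _ mw] fam(2) m by auto
  then show ?thesis by (rule opened_map_exists[OF reg m mw])
qed

section \<open>The bijection between trees and isomorphism classes of maps\<close>

theorem proposition3:
  fixes m a :: nat
  assumes "m \<ge> 3"
  shows "\<exists>f. bij_betw f (tree_family m a) (map_family m a // map_iso m) \<and>
             (\<forall>T\<in>tree_family m a. \<forall>M\<in>f T. card (black_vertices M) = black_nodes (tree T))"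
proof -
  \<comment> \<open>Taking all maps that open to \<open>T\<close> avoids the choice of a
    representative; \<open>cls\<close> shows that they form a single isomorphism class.\<close>
  define f where "f T = {M. \<exists>ts. opened_map M m ts \<and> reading M ts = T}" for T
  have fam: "marked_regular_bipartite_map m M" if "opened_map M m ts" for M ts
    using that by (rule opened_map.marked_regular_bipartite_map)
  have cls: "f T = map_iso m `` {M}" if o: "opened_map M m ts" "reading M ts = T" for M ts T
  proof
    show "f T \<subseteq> map_iso m `` {M}"
    proof
      fix N assume "N \<in> f T"
      then obtain us where N: "opened_map N m us" "reading N us = T" by (auto simp: f_def)
      have "\<exists>g. map_isomorphism g M N" by (rule reading_eq_isomorphism[OF o(1) N(1)]) (simp add: o N)
      then show "N \<in> map_iso m `` {M}" using fam[OF o(1)] fam[OF N(1)] by (auto simp: map_iso_def)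
    qed
    show "map_iso m `` {M} \<subseteq> f T"
    proof
      fix N assume "N \<in> map_iso m `` {M}"
      then obtain g where g: "map_isomorphism g M N" "marked_regular_bipartite_map m N" by (auto simp: map_iso_def)
      show "N \<in> f T" using opened_map.opened_map_transport[OF o(1) g] o(2) unfolding f_def by blast
    qed
  qed
  have in_fam: "M \<in> map_family m a" if o: "opened_map M m ts" "reading M ts \<in> tree_family m a" for M ts
    using opened_map.in_map_family[OF o(1)] opened_map.reading_tree_family[OF o(1)] o(2)
    unfolding map_family_def tree_family_def by auto
  have "bij_betw f (tree_family m a) (map_family m a // map_iso m)"
    unfolding bij_betw_def
  proof
    show "inj_on f (tree_family m a)"
    proof (rule inj_onI)
      fix T T' assume T: "T \<in> tree_family m a" "T' \<in> tree_family m a" "f T = f T'"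
      obtain M ts where o: "opened_map M m ts" "reading M ts = T"
        using tree_family_opened_map[OF T(1) assms] by blast
      then have "M \<in> f T'" using T(3) by (auto simp: f_def)
      then obtain ts' where o': "opened_map M m ts'" "reading M ts' = T'" by (auto simp: f_def)
      \<comment> \<open>A map common to both classes has only one opening, hence one
        reading.\<close>
      show "T = T'" using opened_map_unique[OF o(1) o'(1)] o o' by simp
    qed
    show "f ` tree_family m a = map_family m a // map_iso m"
    proof
      show "f ` tree_family m a \<subseteq> map_family m a // map_iso m"
      proof
        fix C assume "C \<in> f ` tree_family m a"
        then obtain T where T: "T \<in> tree_family m a" "C = f T" by blast
        obtain M ts where o: "opened_map M m ts" "reading M ts = T"
          using tree_family_opened_map[OF T(1) assms] by blast
        have "M \<in> map_family m a" using in_fam[OF o(1)] o(2) T(1) by simp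
        then show "C \<in> map_family m a // map_iso m" using cls[OF o] T(2) by (simp add: quotientI)
      qed
      show "map_family m a // map_iso m \<subseteq> f ` tree_family m a"
      proof
        fix C assume "C \<in> map_family m a // map_iso m"
        then obtain M where M: "M \<in> map_family m a" "C = map_iso m `` {M}" by (auto simp: quotient_def)
        obtain ts where o: "opened_map M m ts" using map_family_opened_map[OF M(1) assms] by blast
        have "reading M ts \<in> tree_family m (card (marks M))" by (rule opened_map.reading_tree_family[OF o])
        moreover have "card (marks M) = a"
        proof -
          interpret opened_map M m ts by fact
          show ?thesis using M(1) card_marked_edges[OF marks_white] by (simp add: map_family_def)
        qed
        ultimately have "reading M ts \<in> tree_family m a" by simp
        then show "C \<in> f ` tree_family m a" using cls[OF o refl] M(2) by blast
      qed
    qed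
  qed
  moreover have "card (black_vertices M) = black_nodes (tree T)" if "M \<in> f T" for T M
  proof -
    obtain ts where o: "opened_map M m ts" "reading M ts = T" using \<open>M \<in> f T\<close> by (auto simp: f_def)
    show ?thesis using opened_map.card_black_vertices[OF o(1)] o(2) by simp
  qed
  ultimately show ?thesis by blast
qed

end
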